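(* Let $(M,g,J)$ be a compact locally conformally Kähler manifold which is not Kähler, with fundamental form $\omega$ and Lee form $\theta$, and suppose that $M=G/H$ is homogeneous, i.e. $G$ is a compact connected Lie group acting effectively and transitively on $M$ and preserving both $g$ and $J$. Let $\mathfrak{z}$ be the center of the Lie algebra $\mathfrak{g}$ of $G$. If $\dim\mathfrak{z}\geq 2$, then $(M,g,J)$ is Vaisman, i.e. $\nabla\theta=0$, where $\nabla$ is the Levi-Civita connection of $g$.
   Context: A Hermitian manifold $(M,g,J)$ ($J$ an integrable complex structure, skew-symmetric with respect to $g$) is called locally conformally Kähler (LCK) if its fundamental 2-form $\omega:=g(J\cdot,\cdot)$ satisfies $d\omega=-2\theta\wedge\omega$ for some closed 1-form $\theta$ on $M$, called the Lee form. It is Vaisman if $\theta$ is parallel for the Levi-Civita connection of $g$. "Not Kähler" means $d\omega\neq 0$ (so in particular $\theta\neq 0$ and $\dim_{\mathbb{C}}M\geq 2$); in this situation $G$ also preserves $\omega$ and $\theta$. *)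

theory Defs
  imports
    "HOL-Analysis.Analysis"
    "HOL-Algebra.Group_Action"
    "HOL-Library.Function_Algebras"
begin

text \<open>
  A manifold is a Hausdorff second countable type together with a smooth atlas modelled on a
  euclidean space. Tangent vectors are derivations at a point of the algebra of smooth functions;
  tensor fields are families of multilinear maps on the tangent spaces that take smooth vector
  fields to smooth functions or smooth vector fields.
\<close>

instantiation "fun" :: (type, real_vector) real_vector
begin

definition scaleR_fun :: "real \<Rightarrow> ('a \<Rightarrow> 'b) \<Rightarrow> 'a \<Rightarrow> 'b"
  where "scaleR_fun c f = (\<lambda>x. c *\<^sub>R f x)"

instance
  by standard (simp_all add: scaleR_fun_def fun_eq_iff scaleR_add_right scaleR_add_left)

end


section \<open>Smooth manifolds\<close>

text \<open>Only meaningful for open sets, since \<open>at x\<close> is the unrestricted neighbourhood filter.\<close>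

fun k_smooth_on :: "nat \<Rightarrow> 'a set \<Rightarrow> ('a::real_normed_vector \<Rightarrow> 'b::real_normed_vector) \<Rightarrow> bool"
  where
    "k_smooth_on 0 S f \<longleftrightarrow> continuous_on S f"
  | "k_smooth_on (Suc k) S f \<longleftrightarrow>
       (\<forall>x\<in>S. f differentiable (at x)) \<and>
       (\<forall>v. k_smooth_on k S (\<lambda>x. frechet_derivative f (at x) v))"

definition smooth_on :: "'a set \<Rightarrow> ('a::real_normed_vector \<Rightarrow> 'b::real_normed_vector) \<Rightarrow> bool"
  where "smooth_on S f \<longleftrightarrow> (\<forall>k. k_smooth_on k S f)"

type_synonym ('m, 'e) atlas = "('m set \<times> ('m \<Rightarrow> 'e)) set"

definition smooth_atlas ::
    "('m::{t2_space, second_countable_topology}, 'e::euclidean_space) atlas \<Rightarrow> bool"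
  where "smooth_atlas A \<longleftrightarrow>
    (\<Union>(U, \<phi>)\<in>A. U) = UNIV \<and>
    (\<forall>(U, \<phi>)\<in>A. open U \<and> open (\<phi> ` U) \<and> homeomorphism U (\<phi> ` U) \<phi> (inv_into U \<phi>)) \<and>
    (\<forall>(U, \<phi>)\<in>A. \<forall>(V, \<psi>)\<in>A. smooth_on (\<phi> ` (U \<inter> V)) (\<psi> \<circ> inv_into U \<phi>))"

definition smooth_fun :: "('m, 'e::euclidean_space) atlas \<Rightarrow> ('m \<Rightarrow> real) \<Rightarrow> bool"
  where "smooth_fun A f \<longleftrightarrow> (\<forall>(U, \<phi>)\<in>A. smooth_on (\<phi> ` U) (f \<circ> inv_into U \<phi>))"

definition smooth_map ::
    "('m::topological_space, 'e::euclidean_space) atlas \<Rightarrow>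
     ('n::topological_space, 'f::euclidean_space) atlas \<Rightarrow> ('m \<Rightarrow> 'n) \<Rightarrow> bool"
  where "smooth_map A B F \<longleftrightarrow>
    continuous_on UNIV F \<and>
    (\<forall>(U, \<phi>)\<in>A. \<forall>(V, \<psi>)\<in>B. smooth_on (\<phi> ` (U \<inter> F -` V)) (\<psi> \<circ> F \<circ> inv_into U \<phi>))"

definition prod_atlas ::
    "('m, 'e) atlas \<Rightarrow> ('n, 'f) atlas \<Rightarrow> ('m \<times> 'n, 'e \<times> 'f) atlas"
  where "prod_atlas A B = {(U \<times> V, map_prod \<phi> \<psi>) | U \<phi> V \<psi>. (U, \<phi>) \<in> A \<and> (V, \<psi>) \<in> B}"


section \<open>Tangent vectors and vector fields\<close>

type_synonym 'm tvec = "('m \<Rightarrow> real) \<Rightarrow> real"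
type_synonym 'm vfield = "'m \<Rightarrow> 'm tvec"

text \<open>
  Derivations are extended by zero to non-smooth functions, so that equality of tangent vectors
  is equality in the function type.
\<close>

definition tangent_space :: "('m, 'e::euclidean_space) atlas \<Rightarrow> 'm \<Rightarrow> 'm tvec set"
  where "tangent_space A p = {v.
    (\<forall>f. \<not> smooth_fun A f \<longrightarrow> v f = 0) \<and>
    (\<forall>f h. smooth_fun A f \<longrightarrow> smooth_fun A h \<longrightarrow> v (f + h) = v f + v h) \<and>
    (\<forall>c f. smooth_fun A f \<longrightarrow> v (c *\<^sub>R f) = c * v f) \<and>
    (\<forall>f h. smooth_fun A f \<longrightarrow> smooth_fun A h \<longrightarrow> v (f * h) = v f * h p + f p * v h)}"

definition differential ::
    "('n, 'f::euclidean_space) atlas \<Rightarrow> ('m \<Rightarrow> 'n) \<Rightarrow> 'm tvec \<Rightarrow> 'n tvec"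
  where "differential B F v = (\<lambda>f. if smooth_fun B f then v (f \<circ> F) else 0)"

definition vector_fields :: "('m, 'e::euclidean_space) atlas \<Rightarrow> 'm vfield set"
  where "vector_fields A = {X.
    (\<forall>p. X p \<in> tangent_space A p) \<and>
    (\<forall>f. smooth_fun A f \<longrightarrow> smooth_fun A (\<lambda>p. X p f))}"

definition lie_bracket :: "'m vfield \<Rightarrow> 'm vfield \<Rightarrow> 'm vfield"
  where "lie_bracket X Y = (\<lambda>p f. X p (\<lambda>q. Y q f) - Y p (\<lambda>q. X q f))"


section \<open>Differential forms of low degree\<close>

definition one_form :: "('m, 'e::euclidean_space) atlas \<Rightarrow> ('m \<Rightarrow> 'm tvec \<Rightarrow> real) \<Rightarrow> bool"
  where "one_form A \<theta> \<longleftrightarrow>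
    (\<forall>p. \<forall>u\<in>tangent_space A p. \<forall>v\<in>tangent_space A p. \<forall>a b.
       \<theta> p (a *\<^sub>R u + b *\<^sub>R v) = a * \<theta> p u + b * \<theta> p v) \<and>
    (\<forall>X\<in>vector_fields A. smooth_fun A (\<lambda>p. \<theta> p (X p)))"

text \<open>
  The exterior derivatives of 1-forms and 2-forms by the invariant formula, and the wedge product
  of a 1-form with a 2-form, both in the convention where
  \<open>(\<alpha> \<and> \<beta>)(u, v) = \<alpha>(u) \<beta>(v) - \<alpha>(v) \<beta>(u)\<close> for 1-forms.
\<close>

definition ext_d1 ::
    "('m \<Rightarrow> 'm tvec \<Rightarrow> real) \<Rightarrow> 'm vfield \<Rightarrow> 'm vfield \<Rightarrow> 'm \<Rightarrow> real"
  where "ext_d1 \<theta> X Y p =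
    X p (\<lambda>q. \<theta> q (Y q)) - Y p (\<lambda>q. \<theta> q (X q)) - \<theta> p (lie_bracket X Y p)"

definition ext_d2 ::
    "('m \<Rightarrow> 'm tvec \<Rightarrow> 'm tvec \<Rightarrow> real) \<Rightarrow> 'm vfield \<Rightarrow> 'm vfield \<Rightarrow> 'm vfield \<Rightarrow> 'm \<Rightarrow> real"
  where "ext_d2 \<omega> X Y Z p =
    X p (\<lambda>q. \<omega> q (Y q) (Z q)) - Y p (\<lambda>q. \<omega> q (X q) (Z q)) + Z p (\<lambda>q. \<omega> q (X q) (Y q))
    - \<omega> p (lie_bracket X Y p) (Z p) + \<omega> p (lie_bracket X Z p) (Y p)
    - \<omega> p (lie_bracket Y Z p) (X p)"

definition wedge_1_2 ::
    "('m \<Rightarrow> 'm tvec \<Rightarrow> real) \<Rightarrow> ('m \<Rightarrow> 'm tvec \<Rightarrow> 'm tvec \<Rightarrow> real) \<Rightarrow>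
     'm \<Rightarrow> 'm tvec \<Rightarrow> 'm tvec \<Rightarrow> 'm tvec \<Rightarrow> real"
  where "wedge_1_2 \<theta> \<omega> p u v w = \<theta> p u * \<omega> p v w - \<theta> p v * \<omega> p u w + \<theta> p w * \<omega> p u v"


section \<open>Riemannian, Hermitian and locally conformally Kaehler structures\<close>

definition riemannian_metric ::
    "('m, 'e::euclidean_space) atlas \<Rightarrow> ('m \<Rightarrow> 'm tvec \<Rightarrow> 'm tvec \<Rightarrow> real) \<Rightarrow> bool"
  where "riemannian_metric A g \<longleftrightarrow>
    (\<forall>p. \<forall>u\<in>tangent_space A p. \<forall>v\<in>tangent_space A p. \<forall>w\<in>tangent_space A p. \<forall>a b.
       g p (a *\<^sub>R u + b *\<^sub>R v) w = a * g p u w + b * g p v w) \<and>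
    (\<forall>p. \<forall>u\<in>tangent_space A p. \<forall>v\<in>tangent_space A p. g p u v = g p v u) \<and>
    (\<forall>p. \<forall>u\<in>tangent_space A p. u \<noteq> 0 \<longrightarrow> g p u u > 0) \<and>
    (\<forall>X\<in>vector_fields A. \<forall>Y\<in>vector_fields A. smooth_fun A (\<lambda>p. g p (X p) (Y p)))"

definition almost_complex_structure ::
    "('m, 'e::euclidean_space) atlas \<Rightarrow> ('m \<Rightarrow> 'm tvec \<Rightarrow> 'm tvec) \<Rightarrow> bool"
  where "almost_complex_structure A J \<longleftrightarrow>
    (\<forall>p. \<forall>u\<in>tangent_space A p. J p u \<in> tangent_space A p \<and> J p (J p u) = - u) \<and>
    (\<forall>p. \<forall>u\<in>tangent_space A p. \<forall>v\<in>tangent_space A p. \<forall>a b.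
       J p (a *\<^sub>R u + b *\<^sub>R v) = a *\<^sub>R J p u + b *\<^sub>R J p v) \<and>
    (\<forall>X\<in>vector_fields A. (\<lambda>p. J p (X p)) \<in> vector_fields A)"

definition nijenhuis ::
    "('m \<Rightarrow> 'm tvec \<Rightarrow> 'm tvec) \<Rightarrow> 'm vfield \<Rightarrow> 'm vfield \<Rightarrow> 'm vfield"
  where "nijenhuis J X Y p =
    lie_bracket (\<lambda>q. J q (X q)) (\<lambda>q. J q (Y q)) p
    - J p (lie_bracket (\<lambda>q. J q (X q)) Y p)
    - J p (lie_bracket X (\<lambda>q. J q (Y q)) p)
    - lie_bracket X Y p"

definition complex_structure ::
    "('m, 'e::euclidean_space) atlas \<Rightarrow> ('m \<Rightarrow> 'm tvec \<Rightarrow> 'm tvec) \<Rightarrow> bool"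
  where "complex_structure A J \<longleftrightarrow>
    almost_complex_structure A J \<and>
    (\<forall>X\<in>vector_fields A. \<forall>Y\<in>vector_fields A. nijenhuis J X Y = 0)"

definition hermitian_structure ::
    "('m, 'e::euclidean_space) atlas \<Rightarrow> ('m \<Rightarrow> 'm tvec \<Rightarrow> 'm tvec \<Rightarrow> real) \<Rightarrow>
     ('m \<Rightarrow> 'm tvec \<Rightarrow> 'm tvec) \<Rightarrow> bool"
  where "hermitian_structure A g J \<longleftrightarrow>
    riemannian_metric A g \<and> complex_structure A J \<and>
    (\<forall>p. \<forall>u\<in>tangent_space A p. \<forall>v\<in>tangent_space A p. g p (J p u) v = - g p u (J p v))"

definition fundamental_form ::
    "('m \<Rightarrow> 'm tvec \<Rightarrow> 'm tvec \<Rightarrow> real) \<Rightarrow> ('m \<Rightarrow> 'm tvec \<Rightarrow> 'm tvec) \<Rightarrow>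
     'm \<Rightarrow> 'm tvec \<Rightarrow> 'm tvec \<Rightarrow> real"
  where "fundamental_form g J p u v = g p (J p u) v"

definition lee_form ::
    "('m, 'e::euclidean_space) atlas \<Rightarrow> ('m \<Rightarrow> 'm tvec \<Rightarrow> 'm tvec \<Rightarrow> real) \<Rightarrow>
     ('m \<Rightarrow> 'm tvec \<Rightarrow> 'm tvec) \<Rightarrow> ('m \<Rightarrow> 'm tvec \<Rightarrow> real) \<Rightarrow> bool"
  where "lee_form A g J \<theta> \<longleftrightarrow>
    one_form A \<theta> \<and>
    (\<forall>X\<in>vector_fields A. \<forall>Y\<in>vector_fields A. \<forall>p. ext_d1 \<theta> X Y p = 0) \<and>
    (\<forall>X\<in>vector_fields A. \<forall>Y\<in>vector_fields A. \<forall>Z\<in>vector_fields A. \<forall>p.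
       ext_d2 (fundamental_form g J) X Y Z p =
       - 2 * wedge_1_2 \<theta> (fundamental_form g J) p (X p) (Y p) (Z p))"

definition lck ::
    "('m, 'e::euclidean_space) atlas \<Rightarrow> ('m \<Rightarrow> 'm tvec \<Rightarrow> 'm tvec \<Rightarrow> real) \<Rightarrow>
     ('m \<Rightarrow> 'm tvec \<Rightarrow> 'm tvec) \<Rightarrow> bool"
  where "lck A g J \<longleftrightarrow> hermitian_structure A g J \<and> (\<exists>\<theta>. lee_form A g J \<theta>)"

definition kaehler ::
    "('m, 'e::euclidean_space) atlas \<Rightarrow> ('m \<Rightarrow> 'm tvec \<Rightarrow> 'm tvec \<Rightarrow> real) \<Rightarrow>
     ('m \<Rightarrow> 'm tvec \<Rightarrow> 'm tvec) \<Rightarrow> bool"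
  where "kaehler A g J \<longleftrightarrow>
    hermitian_structure A g J \<and>
    (\<forall>X\<in>vector_fields A. \<forall>Y\<in>vector_fields A. \<forall>Z\<in>vector_fields A. \<forall>p.
       ext_d2 (fundamental_form g J) X Y Z p = 0)"

definition affine_connection ::
    "('m, 'e::euclidean_space) atlas \<Rightarrow> ('m vfield \<Rightarrow> 'm vfield \<Rightarrow> 'm vfield) \<Rightarrow> bool"
  where "affine_connection A nabla \<longleftrightarrow>
    (\<forall>X\<in>vector_fields A. \<forall>Y\<in>vector_fields A. nabla X Y \<in> vector_fields A) \<and>
    (\<forall>X\<in>vector_fields A. \<forall>X'\<in>vector_fields A. \<forall>Y\<in>vector_fields A.
       nabla (X + X') Y = nabla X Y + nabla X' Y) \<and>
    (\<forall>X\<in>vector_fields A. \<forall>Y\<in>vector_fields A. \<forall>Y'\<in>vector_fields A.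
       nabla X (Y + Y') = nabla X Y + nabla X Y') \<and>
    (\<forall>f X Y. smooth_fun A f \<longrightarrow> X \<in> vector_fields A \<longrightarrow> Y \<in> vector_fields A \<longrightarrow>
       nabla (\<lambda>p. f p *\<^sub>R X p) Y = (\<lambda>p. f p *\<^sub>R nabla X Y p) \<and>
       nabla X (\<lambda>p. f p *\<^sub>R Y p) = (\<lambda>p. X p f *\<^sub>R Y p + f p *\<^sub>R nabla X Y p))"

definition levi_civita ::
    "('m, 'e::euclidean_space) atlas \<Rightarrow> ('m \<Rightarrow> 'm tvec \<Rightarrow> 'm tvec \<Rightarrow> real) \<Rightarrow>
     ('m vfield \<Rightarrow> 'm vfield \<Rightarrow> 'm vfield) \<Rightarrow> bool"
  where "levi_civita A g nabla \<longleftrightarrow>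
    affine_connection A nabla \<and>
    (\<forall>X\<in>vector_fields A. \<forall>Y\<in>vector_fields A. nabla X Y - nabla Y X = lie_bracket X Y) \<and>
    (\<forall>X\<in>vector_fields A. \<forall>Y\<in>vector_fields A. \<forall>Z\<in>vector_fields A. \<forall>p.
       X p (\<lambda>q. g q (Y q) (Z q)) = g p (nabla X Y p) (Z p) + g p (Y p) (nabla X Z p))"

definition parallel_one_form ::
    "('m, 'e::euclidean_space) atlas \<Rightarrow> ('m vfield \<Rightarrow> 'm vfield \<Rightarrow> 'm vfield) \<Rightarrow>
     ('m \<Rightarrow> 'm tvec \<Rightarrow> real) \<Rightarrow> bool"
  where "parallel_one_form A nabla \<theta> \<longleftrightarrow>
    (\<forall>X\<in>vector_fields A. \<forall>Y\<in>vector_fields A. \<forall>p.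
       X p (\<lambda>q. \<theta> q (Y q)) - \<theta> p (nabla X Y p) = 0)"


section \<open>Lie groups and their actions\<close>

definition lie_group ::
    "'g::{t2_space, second_countable_topology} monoid \<Rightarrow> ('g, 'd::euclidean_space) atlas \<Rightarrow> bool"
  where "lie_group G B \<longleftrightarrow>
    group G \<and> carrier G = UNIV \<and> smooth_atlas B \<and>
    smooth_map (prod_atlas B B) B (\<lambda>(a, b). a \<otimes>\<^bsub>G\<^esub> b) \<and>
    smooth_map B B (\<lambda>a. inv\<^bsub>G\<^esub> a)"

definition lie_algebra :: "'g monoid \<Rightarrow> ('g, 'd::euclidean_space) atlas \<Rightarrow> 'g vfield set"
  where "lie_algebra G B = {X \<in> vector_fields B.
    \<forall>a b. differential B (\<lambda>c. a \<otimes>\<^bsub>G\<^esub> c) (X b) = X (a \<otimes>\<^bsub>G\<^esub> b)}"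

definition lie_algebra_center :: "'g monoid \<Rightarrow> ('g, 'd::euclidean_space) atlas \<Rightarrow> 'g vfield set"
  where "lie_algebra_center G B =
    {X \<in> lie_algebra G B. \<forall>Y\<in>lie_algebra G B. lie_bracket X Y = 0}"

definition smooth_action ::
    "'g::topological_space monoid \<Rightarrow> ('g, 'd::euclidean_space) atlas \<Rightarrow>
     ('m::topological_space, 'e::euclidean_space) atlas \<Rightarrow> ('g \<Rightarrow> 'm \<Rightarrow> 'm) \<Rightarrow> bool"
  where "smooth_action G B A \<Phi> \<longleftrightarrow>
    group_action G UNIV \<Phi> \<and> smooth_map (prod_atlas B A) A (\<lambda>(a, p). \<Phi> a p)"

definition preserves_metric ::
    "('m, 'e::euclidean_space) atlas \<Rightarrow> ('m \<Rightarrow> 'm tvec \<Rightarrow> 'm tvec \<Rightarrow> real) \<Rightarrow> ('m \<Rightarrow> 'm) \<Rightarrow> bool"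
  where "preserves_metric A g F \<longleftrightarrow>
    (\<forall>p. \<forall>u\<in>tangent_space A p. \<forall>v\<in>tangent_space A p.
       g (F p) (differential A F u) (differential A F v) = g p u v)"

definition preserves_complex_structure ::
    "('m, 'e::euclidean_space) atlas \<Rightarrow> ('m \<Rightarrow> 'm tvec \<Rightarrow> 'm tvec) \<Rightarrow> ('m \<Rightarrow> 'm) \<Rightarrow> bool"
  where "preserves_complex_structure A J F \<longleftrightarrow>
    (\<forall>p. \<forall>u\<in>tangent_space A p. J (F p) (differential A F u) = differential A F (J p u))"

end

theory Submission
  imports Defs "HOL-Computational_Algebra.Polynomial" "HOL-Real_Asymp.Real_Asymp"
begin

text \<open>
  Since \<open>\<theta> \<and> \<omega>\<close> determines \<open>\<theta>\<close> in complex dimension at least two, \<open>\<theta>\<close> is \<open>G\<close>-invariant; being closed it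
  is constant on fundamental fields, and by transitivity it is nonzero on one of them. Averaging over
  the compact group \<open>G\<close> gives a central fundamental field \<open>\<xi>\<close> with \<open>\<theta>(\<xi>) \<noteq> 0\<close>. If the center has
  dimension at least two, it also contains \<open>X \<noteq> 0\<close> with \<open>\<theta>(X) = 0\<close>. The invariant fields \<open>\<xi>, X, J\<xi>, JX\<close>
  commute and have constant pairings, so \<open>d\<omega> = -2 \<theta> \<and> \<omega>\<close> vanishes on their span. As \<open>\<theta>(\<xi>) \<noteq> 0\<close>, this span is
  a complex line, hence \<open>JX\<close> is a fundamental field as well. Cartan's formula for \<open>X\<close> then shows that \<open>\<theta>\<close> is
  a constant multiple of the dual of the Killing field \<open>JX\<close>, and a closed form dual to a Killing field is parallel.
\<close>

section \<open>Calculus of smooth maps between euclidean spaces\<close>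

text \<open>No vector field is integrated anywhere. A Lie derivative along a fundamental field is
  the derivative of a pullback in the group variable at the identity, and symmetry of second
  derivatives in product charts exchanges the derivation on G with the one on M. Where a
  one-parameter subgroup would be usual, limits of Euler polygons supply one group element different
  from the identity; where local surjectivity of the orbit map would be usual, compactness of G
  supplies elements near the identity that carry a point to given nearby points. The latter are
  enough because \<theta> is closed: its local primitive turns a statement about derivatives into
  one about values. The commutation of \<xi>, X, J\<xi>, JX has two sources. A fundamental field
  commutes with every invariant field, which covers all brackets with \<xi> or X; for the bracket of
  J\<xi> and JX it is integrability of J that is used. The part X' of X orthogonal to \<xi> and
  J\<xi> is not known to be fundamental, which is why it is reached in two steps.\<close>

lemma has_derivative_cong_open:
  assumes "open S" "x \<in> S" "\<And>y. y \<in> S \<Longrightarrow> f y = g y"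
  shows "(f has_derivative D) (at x) \<longleftrightarrow> (g has_derivative D) (at x)"
  using has_derivative_transform_within_open[of f D x UNIV S g]
    has_derivative_transform_within_open[of g D x UNIV S f] assms by auto

lemma frechet_derivative_cong_open:
  assumes "open S" "x \<in> S" "\<And>y. y \<in> S \<Longrightarrow> f y = g y"
  shows "frechet_derivative f (at x) = frechet_derivative g (at x)"
  unfolding frechet_derivative_def using has_derivative_cong_open[OF assms] by simp

lemma k_smooth_on_cong:
  assumes "open S" "\<And>x. x \<in> S \<Longrightarrow> f x = g x"
  shows "k_smooth_on k S f \<longleftrightarrow> k_smooth_on k S g"
  using assms(2)
proof (induction k arbitrary: f g)
  case 0
  then show ?case by (simp cong: continuous_on_cong)
next
  case (Suc k)
  have d: "f differentiable (at x) \<longleftrightarrow> g differentiable (at x)" if "x \<in> S" for x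
    unfolding differentiable_def using has_derivative_cong_open[of S x f g] assms(1) Suc.prems that
    by simp
  have "k_smooth_on k S (\<lambda>x. frechet_derivative f (at x) v) \<longleftrightarrow>
        k_smooth_on k S (\<lambda>x. frechet_derivative g (at x) v)" for v
    by (rule Suc.IH) (use frechet_derivative_cong_open[of S _ f g] assms(1) Suc.prems in simp)
  then show ?case using d by auto
qed

lemma k_smooth_on_subset: "k_smooth_on k S f \<Longrightarrow> T \<subseteq> S \<Longrightarrow> k_smooth_on k T f"
  by (induction k arbitrary: f) (auto intro: continuous_on_subset)

text \<open>The iterated derivatives are taken with the unrestricted \<open>at x\<close>, so only
  the neighbourhoods \<open>T\<close> have to be open; \<open>S\<close> is arbitrary.\<close>

lemma k_smooth_on_local:
  assumes "\<And>x. x \<in> S \<Longrightarrow> \<exists>T. open T \<and> x \<in> T \<and> k_smooth_on k T f"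
  shows "k_smooth_on k S f"
  using assms
proof (induction k arbitrary: f)
  case 0
  have "continuous (at x within S) f" if "x \<in> S" for x
    using 0[OF that] by (auto simp: continuous_on_eq_continuous_at intro: continuous_at_imp_continuous_at_within)
  then show ?case by (simp add: continuous_on_eq_continuous_within)
next
  case (Suc k)
  have "f differentiable (at x)" if "x \<in> S" for x
    using Suc.prems[OF that] by auto
  moreover have "k_smooth_on k S (\<lambda>x. frechet_derivative f (at x) v)" for v
    by (rule Suc.IH) (use Suc.prems in fastforce)
  ultimately show ?case by auto
qed

lemma k_smooth_on_SucD: "k_smooth_on (Suc k) S f \<Longrightarrow> k_smooth_on k S f"
proof (induction k arbitrary: f)
  case 0
  then show ?case
    by (auto intro!: differentiable_imp_continuous_on simp: differentiable_on_def differentiable_at_withinI)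
next
  case (Suc k)
  then show ?case by (metis k_smooth_on.simps(2))
qed

lemma k_smooth_on_const: "k_smooth_on k S (\<lambda>x. c)"
  by (induction k arbitrary: c) auto

lemma frechet_derivative_eqI: "(f has_derivative D) (at x) \<Longrightarrow> frechet_derivative f (at x) v = D v"
  using frechet_derivative_at by metis

lemma has_derivative_frechet:
  "f differentiable (at x) \<Longrightarrow> (f has_derivative frechet_derivative f (at x)) (at x)"
  by (simp add: frechet_derivative_works)

lemma k_smooth_on_Suc_iff:
  assumes "open S" "\<And>x. x \<in> S \<Longrightarrow> (f has_derivative D x) (at x)"
  shows "k_smooth_on (Suc k) S f \<longleftrightarrow> (\<forall>v. k_smooth_on k S (\<lambda>x. D x v))"
proof -
  have "k_smooth_on k S (\<lambda>x. frechet_derivative f (at x) v) \<longleftrightarrow> k_smooth_on k S (\<lambda>x. D x v)" for v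
    by (rule k_smooth_on_cong[OF assms(1)]) (simp add: frechet_derivative_eqI assms(2))
  moreover have "\<forall>x\<in>S. f differentiable (at x)" using assms(2) differentiableI by blast
  ultimately show ?thesis by simp
qed

lemma k_smooth_on_SucI:
  assumes "open S" "\<And>x. x \<in> S \<Longrightarrow> (f has_derivative D x) (at x)"
    "\<And>v. k_smooth_on k S (\<lambda>x. D x v)"
  shows "k_smooth_on (Suc k) S f"
  using k_smooth_on_Suc_iff[OF assms(1,2)] assms(3) by blast

lemma k_smooth_on_Suc_has_derivative:
  "k_smooth_on (Suc k) S f \<Longrightarrow> x \<in> S \<Longrightarrow> (f has_derivative frechet_derivative f (at x)) (at x)"
  by (simp add: has_derivative_frechet)

lemma k_smooth_on_linear_comp:
  assumes "bounded_linear h" "open S"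
  shows "k_smooth_on k S f \<Longrightarrow> k_smooth_on k S (\<lambda>x. h (f x))"
proof (induction k arbitrary: f)
  case 0
  then show ?case using assms by (simp add: bounded_linear.continuous_on)
next
  case (Suc k)
  show ?case
  proof (rule k_smooth_on_SucI[OF assms(2)])
    show "((\<lambda>x. h (f x)) has_derivative (\<lambda>v. h (frechet_derivative f (at x) v))) (at x)"
      if "x \<in> S" for x
      by (rule bounded_linear.has_derivative[OF assms(1) k_smooth_on_Suc_has_derivative[OF Suc.prems that]])
    show "k_smooth_on k S (\<lambda>x. h (frechet_derivative f (at x) v))" for v
      by (rule Suc.IH) (use Suc.prems in auto)
  qed
qed

lemma k_smooth_on_ident: "k_smooth_on k S (\<lambda>x. x)"
  by (cases k) (auto simp: k_smooth_on_const)

lemma k_smooth_on_add: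
  assumes "open S"
  shows "k_smooth_on k S f \<Longrightarrow> k_smooth_on k S g \<Longrightarrow> k_smooth_on k S (\<lambda>x. f x + g x)"
proof (induction k arbitrary: f g)
  case 0
  then show ?case by (simp add: continuous_on_add)
next
  case (Suc k)
  show ?case
  proof (rule k_smooth_on_SucI[OF assms])
    show "((\<lambda>x. f x + g x) has_derivative
        (\<lambda>v. frechet_derivative f (at x) v + frechet_derivative g (at x) v)) (at x)" if "x \<in> S" for x
      by (rule has_derivative_add[OF k_smooth_on_Suc_has_derivative[OF Suc.prems(1) that]
            k_smooth_on_Suc_has_derivative[OF Suc.prems(2) that]])
    show "k_smooth_on k S (\<lambda>x. frechet_derivative f (at x) v + frechet_derivative g (at x) v)" for v
      by (rule Suc.IH) (use Suc.prems in auto)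
  qed
qed

lemma k_smooth_on_bilinear:
  assumes "bounded_bilinear b" "open S"
  shows "k_smooth_on k S f \<Longrightarrow> k_smooth_on k S g \<Longrightarrow> k_smooth_on k S (\<lambda>x. b (f x) (g x))"
proof (induction k arbitrary: f g)
  case 0
  then show ?case by (simp add: bounded_bilinear.continuous_on[OF assms(1)])
next
  case (Suc k)
  show ?case
  proof (rule k_smooth_on_SucI[OF assms(2)])
    show "((\<lambda>x. b (f x) (g x)) has_derivative
        (\<lambda>v. b (f x) (frechet_derivative g (at x) v) + b (frechet_derivative f (at x) v) (g x))) (at x)"
      if "x \<in> S" for x
      by (rule bounded_bilinear.FDERIV[OF assms(1) k_smooth_on_Suc_has_derivative[OF Suc.prems(1) that]
            k_smooth_on_Suc_has_derivative[OF Suc.prems(2) that]])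
    show "k_smooth_on k S (\<lambda>x. b (f x) (frechet_derivative g (at x) v) + b (frechet_derivative f (at x) v) (g x))" for v
      by (intro k_smooth_on_add assms(2) Suc.IH)
        (use Suc.prems k_smooth_on_SucD[OF Suc.prems(1)] k_smooth_on_SucD[OF Suc.prems(2)] in auto)
  qed
qed

lemma k_smooth_on_sum:
  assumes "open S" "\<And>i. i \<in> I \<Longrightarrow> k_smooth_on k S (f i)"
  shows "k_smooth_on k S (\<lambda>x. \<Sum>i\<in>I. f i x)"
  using assms(2)
  by (induction I rule: infinite_finite_induct) (auto simp: k_smooth_on_const intro!: k_smooth_on_add assms(1))

text \<open>The chain rule produces a direction that varies with x, while the definition only
  differentiates in fixed directions. Expanding it over \<open>Basis\<close> gives scalar factors
  times derivatives of \<open>h\<close> in fixed directions, to which the induction hypothesis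
  applies; hence the euclidean codomain of \<open>f\<close>.\<close>

lemma k_smooth_on_compose:
  fixes f :: "'a::real_normed_vector \<Rightarrow> 'b::euclidean_space" and h :: "'b \<Rightarrow> 'c::real_normed_vector"
  assumes "open S" "open T" "f ` S \<subseteq> T"
  shows "k_smooth_on k T h \<Longrightarrow> k_smooth_on k S f \<Longrightarrow> k_smooth_on k S (\<lambda>x. h (f x))"
proof (induction k arbitrary: h)
  case 0
  then show ?case using continuous_on_compose2[of T h S f] assms by simp
next
  case (Suc k)
  show ?case
  proof (rule k_smooth_on_SucI[OF assms(1)])
    show "((\<lambda>x. h (f x)) has_derivative
        (\<lambda>v. \<Sum>i\<in>Basis. (frechet_derivative f (at x) v \<bullet> i) *\<^sub>R frechet_derivative h (at (f x)) i)) (at x)"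
      if "x \<in> S" for x
    proof -
      have fx: "f x \<in> T" using assms that by auto
      have h': "(h has_derivative frechet_derivative h (at (f x))) (at (f x))"
        by (rule k_smooth_on_Suc_has_derivative[OF Suc.prems(1) fx])
      have lin: "linear (frechet_derivative h (at (f x)))"
        using h' has_derivative_linear by blast
      have eq: "frechet_derivative h (at (f x)) w = (\<Sum>i\<in>Basis. (w \<bullet> i) *\<^sub>R frechet_derivative h (at (f x)) i)" for w
      proof -
        have "frechet_derivative h (at (f x)) w = frechet_derivative h (at (f x)) (\<Sum>i\<in>Basis. (w \<bullet> i) *\<^sub>R i)"
          by (simp add: euclidean_representation)
        then show ?thesis by (simp only: linear_sum[OF lin] linear_cmul[OF lin])
      qed
      have "((\<lambda>x. h (f x)) has_derivative (\<lambda>v. frechet_derivative h (at (f x)) (frechet_derivative f (at x) v))) (at x)"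
        using has_derivative_compose[OF k_smooth_on_Suc_has_derivative[OF Suc.prems(2) that] h'] .
      then show ?thesis by (simp only: eq[symmetric])
    qed
    have f: "k_smooth_on k S f" "\<And>v. k_smooth_on k S (\<lambda>x. frechet_derivative f (at x) v)"
      using Suc.prems(2) k_smooth_on_SucD[OF Suc.prems(2)] by auto
    have h: "k_smooth_on k T (\<lambda>y. frechet_derivative h (at y) v)" for v
      using Suc.prems(1) by auto
    show "k_smooth_on k S (\<lambda>x. \<Sum>i\<in>Basis. (frechet_derivative f (at x) v \<bullet> i) *\<^sub>R frechet_derivative h (at (f x)) i)" for v
      by (intro k_smooth_on_sum assms(1) k_smooth_on_bilinear[OF bounded_bilinear_scaleR]
          k_smooth_on_linear_comp[OF bounded_linear_inner_left] f Suc.IH[OF h])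
  qed
qed

lemma smooth_on_cong:
  "open S \<Longrightarrow> (\<And>x. x \<in> S \<Longrightarrow> f x = g x) \<Longrightarrow> smooth_on S f \<longleftrightarrow> smooth_on S g"
  unfolding smooth_on_def using k_smooth_on_cong by blast

lemma smooth_on_eq:
  "open S \<Longrightarrow> smooth_on S f \<Longrightarrow> (\<And>x. x \<in> S \<Longrightarrow> f x = g x) \<Longrightarrow> smooth_on S g"
  using smooth_on_cong by blast

lemma smooth_on_subset: "smooth_on S f \<Longrightarrow> T \<subseteq> S \<Longrightarrow> smooth_on T f"
  unfolding smooth_on_def using k_smooth_on_subset by blast

lemma smooth_on_local:
  "(\<And>x. x \<in> S \<Longrightarrow> \<exists>T. open T \<and> x \<in> T \<and> smooth_on T f) \<Longrightarrow> smooth_on S f"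
  unfolding smooth_on_def by (meson k_smooth_on_local)

lemma smooth_on_const: "smooth_on S (\<lambda>x. c)"
  unfolding smooth_on_def by (simp add: k_smooth_on_const)

lemma smooth_on_ident: "smooth_on S (\<lambda>x. x)"
  unfolding smooth_on_def by (simp add: k_smooth_on_ident)

lemma smooth_on_linear_comp:
  "bounded_linear h \<Longrightarrow> open S \<Longrightarrow> smooth_on S f \<Longrightarrow> smooth_on S (\<lambda>x. h (f x))"
  unfolding smooth_on_def using k_smooth_on_linear_comp by blast

lemma smooth_on_linear: "bounded_linear h \<Longrightarrow> open S \<Longrightarrow> smooth_on S h"
  using smooth_on_linear_comp[OF _ _ smooth_on_ident] by blast

lemma smooth_on_add:
  "open S \<Longrightarrow> smooth_on S f \<Longrightarrow> smooth_on S g \<Longrightarrow> smooth_on S (\<lambda>x. f x + g x)"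
  unfolding smooth_on_def using k_smooth_on_add by blast

lemma smooth_on_bilinear:
  "bounded_bilinear b \<Longrightarrow> open S \<Longrightarrow> smooth_on S f \<Longrightarrow> smooth_on S g \<Longrightarrow> smooth_on S (\<lambda>x. b (f x) (g x))"
  unfolding smooth_on_def using k_smooth_on_bilinear by blast

lemmas smooth_on_scaleR = smooth_on_bilinear[OF bounded_bilinear_scaleR]
lemmas smooth_on_mult = smooth_on_bilinear[OF bounded_bilinear_mult]
lemmas smooth_on_inner = smooth_on_bilinear[OF bounded_bilinear_inner]

lemma smooth_on_minus: "open S \<Longrightarrow> smooth_on S f \<Longrightarrow> smooth_on S (\<lambda>x. - f x)"
  using smooth_on_linear_comp[OF bounded_linear_minus[OF bounded_linear_ident]] by blast

lemma smooth_on_diff: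
  "open S \<Longrightarrow> smooth_on S f \<Longrightarrow> smooth_on S g \<Longrightarrow> smooth_on S (\<lambda>x. f x - g x)"
  using smooth_on_add[of S f "\<lambda>x. - g x"] smooth_on_minus[of S g] by simp

lemma smooth_on_sum:
  "open S \<Longrightarrow> (\<And>i. i \<in> I \<Longrightarrow> smooth_on S (f i)) \<Longrightarrow> smooth_on S (\<lambda>x. \<Sum>i\<in>I. f i x)"
  unfolding smooth_on_def using k_smooth_on_sum[of S I _ f] by blast

lemma smooth_on_compose:
  fixes f :: "'a::real_normed_vector \<Rightarrow> 'b::euclidean_space"
  assumes "open S" "open T" "f ` S \<subseteq> T" "smooth_on T h" "smooth_on S f"
  shows "smooth_on S (\<lambda>x. h (f x))"
  using assms k_smooth_on_compose[OF assms(1-3)] unfolding smooth_on_def by blast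

lemma smooth_on_Pair:
  assumes "open S" "smooth_on S f" "smooth_on S g"
  shows "smooth_on S (\<lambda>x. (f x, g x))"
proof -
  have "smooth_on S (\<lambda>x. (f x, 0) + (0, g x))"
    by (intro smooth_on_add assms smooth_on_linear_comp[of "\<lambda>y. (y, 0)"]
        smooth_on_linear_comp[of "\<lambda>y. (0, y)"] bounded_linear_intros)
  then show ?thesis by simp
qed

lemma smooth_on_fst: "open S \<Longrightarrow> smooth_on S f \<Longrightarrow> smooth_on S (\<lambda>x. fst (f x))"
  using smooth_on_linear_comp[OF bounded_linear_fst] by blast

lemma smooth_on_snd: "open S \<Longrightarrow> smooth_on S f \<Longrightarrow> smooth_on S (\<lambda>x. snd (f x))"
  using smooth_on_linear_comp[OF bounded_linear_snd] by blast

lemma smooth_on_continuous: "smooth_on S f \<Longrightarrow> continuous_on S f"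
  unfolding smooth_on_def using k_smooth_on.simps(1) by blast

lemma smooth_on_has_derivative:
  "smooth_on S f \<Longrightarrow> x \<in> S \<Longrightarrow> (f has_derivative frechet_derivative f (at x)) (at x)"
  unfolding smooth_on_def using k_smooth_on_Suc_has_derivative by blast

lemma smooth_on_frechet_derivative:
  "smooth_on S f \<Longrightarrow> smooth_on S (\<lambda>x. frechet_derivative f (at x) v)"
  unfolding smooth_on_def by (metis k_smooth_on.simps(2))

lemma smooth_on_linear_frechet:
  "smooth_on S f \<Longrightarrow> x \<in> S \<Longrightarrow> linear (frechet_derivative f (at x))"
  using smooth_on_has_derivative has_derivative_linear by blast

lemma frechet_derivative_expand:
  fixes f :: "'a::euclidean_space \<Rightarrow> 'b::real_normed_vector"
  assumes "smooth_on S f" "x \<in> S"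
  shows "frechet_derivative f (at x) w = (\<Sum>i\<in>Basis. (w \<bullet> i) *\<^sub>R frechet_derivative f (at x) i)"
proof -
  note lin = smooth_on_linear_frechet[OF assms]
  have "frechet_derivative f (at x) w = frechet_derivative f (at x) (\<Sum>i\<in>Basis. (w \<bullet> i) *\<^sub>R i)"
    by (simp add: euclidean_representation)
  then show ?thesis by (simp only: linear_sum[OF lin] linear_cmul[OF lin])
qed

text \<open>Base point and direction may both vary with x. The basis expansion again reduces this to
  fixed directions.\<close>

lemma smooth_on_frechet_derivative_joint:
  fixes f :: "'a::euclidean_space \<Rightarrow> 'b::real_normed_vector"
  assumes "open S" "smooth_on S f" "open T" "smooth_on T u" "smooth_on T v" "u ` T \<subseteq> S"
  shows "smooth_on T (\<lambda>x. frechet_derivative f (at (u x)) (v x))"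
proof -
  have "smooth_on T (\<lambda>x. \<Sum>i\<in>Basis. (v x \<bullet> i) *\<^sub>R frechet_derivative f (at (u x)) i)"
    by (intro smooth_on_sum smooth_on_scaleR smooth_on_inner smooth_on_const assms
        smooth_on_compose[OF assms(3,1,6) smooth_on_frechet_derivative[OF assms(2)]])
  moreover have "frechet_derivative f (at (u x)) (v x) =
      (\<Sum>i\<in>Basis. (v x \<bullet> i) *\<^sub>R frechet_derivative f (at (u x)) i)" if "x \<in> T" for x
    using frechet_derivative_expand[OF assms(2)] assms(6) that by blast
  ultimately show ?thesis
    by (simp add: smooth_on_cong[OF assms(3), of "\<lambda>x. frechet_derivative f (at (u x)) (v x)"])
qed

section \<open>Smooth steps and bump functions\<close>

lemma smooth_on_real_derivative:
  fixes f :: "real \<Rightarrow> real"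
  assumes "open S" "\<And>k. \<And>x. x \<in> S \<Longrightarrow> (F k has_real_derivative F (Suc k) x) (at x)"
  shows "smooth_on S (F k)"
proof -
  have "k_smooth_on n S (F k)" for n
  proof (induction n arbitrary: k)
    case 0
    have "continuous_on S (F k)"
      by (rule continuous_at_imp_continuous_on) (use DERIV_isCont[OF assms(2)] in blast)
    then show ?case by simp
  next
    case (Suc n)
    show ?case
      by (rule k_smooth_on_SucI[OF assms(1) has_field_derivative_imp_has_derivative[OF assms(2)]])
        (auto intro!: k_smooth_on_bilinear[OF bounded_bilinear_mult assms(1)] Suc.IH k_smooth_on_const)
  qed
  then show ?thesis by (simp add: smooth_on_def)
qed

text \<open>The flat function exp(-1/x) continued by 0. A polynomial in 1/x is carried along because
  the family is then closed under differentiation: \<open>P\<close> becomes X^2 (P - P'), where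
  \<open>[:0,0,1:]\<close> is X^2.\<close>

definition exp_recip :: "real poly \<Rightarrow> real \<Rightarrow> real"
  where "exp_recip P x = (if x \<le> 0 then 0 else poly P (1 / x) * exp (- (1 / x)))"

lemma poly_exp_tendsto_0: "((\<lambda>y. poly P y * exp (- y)) \<longlongrightarrow> (0::real)) at_top"
proof -
  have "((\<lambda>y. \<Sum>i\<le>degree P. coeff P i * (y ^ i / exp y)) \<longlongrightarrow> (\<Sum>i\<le>degree P. coeff P i * 0)) at_top"
    by (intro tendsto_intros tendsto_power_div_exp_0)
  moreover have "poly P y * exp (- y) = (\<Sum>i\<le>degree P. coeff P i * (y ^ i / exp y))" for y
    by (simp add: poly_altdef sum_distrib_right exp_minus divide_inverse mult.assoc)
  ultimately show ?thesis by simp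
qed

lemma exp_recip_derivative:
  "(exp_recip P has_real_derivative exp_recip ([:0,0,1:] * (P - pderiv P)) x) (at x)"
proof (cases x "0::real" rule: linorder_cases)
  case less
  have "((\<lambda>_. 0) has_real_derivative 0) (at x)" by simp
  then have "(exp_recip P has_real_derivative 0) (at x)"
    by (rule has_field_derivative_transform_within_open[where S="{..<0}"]) (use less in \<open>auto simp: exp_recip_def\<close>)
  then show ?thesis using less by (simp add: exp_recip_def)
next
  case greater
  have "((\<lambda>x. poly P (1 / x) * exp (- (1 / x))) has_real_derivative
      (poly (pderiv P) (1 / x) * (- 1 / x\<^sup>2)) * exp (- (1 / x)) + poly P (1 / x) * (exp (- (1 / x)) * (1 / x\<^sup>2))) (at x)"
    using greater by (auto intro!: derivative_eq_intros DERIV_chain2[OF poly_DERIV] simp: power2_eq_square)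
  then have "(exp_recip P has_real_derivative
      (poly (pderiv P) (1 / x) * (- 1 / x\<^sup>2)) * exp (- (1 / x)) + poly P (1 / x) * (exp (- (1 / x)) * (1 / x\<^sup>2))) (at x)"
    by (rule has_field_derivative_transform_within_open[where S="{0<..}"]) (use greater in \<open>auto simp: exp_recip_def\<close>)
  moreover have "(poly (pderiv P) (1 / x) * (- 1 / x\<^sup>2)) * exp (- (1 / x)) + poly P (1 / x) * (exp (- (1 / x)) * (1 / x\<^sup>2))
      = exp_recip ([:0,0,1:] * (P - pderiv P)) x"
    using greater by (simp add: exp_recip_def power2_eq_square field_simps)
  ultimately show ?thesis by simp
next
  case equal
  \<comment> \<open>With y = 1/h the difference quotient at 0 from the right is y P(y) exp(-y), and
    \<open>pCons 0 P\<close> is the polynomial y P(y).\<close>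
  have "((\<lambda>h. poly (pCons 0 P) (inverse h) * exp (- (inverse h))) \<longlongrightarrow> 0) (at_right 0)"
    by (rule filterlim_compose[OF poly_exp_tendsto_0 filterlim_inverse_at_top_right])
  then have "((\<lambda>h. exp_recip P h / h) \<longlongrightarrow> 0) (at_right 0)"
    by (rule Lim_transform_eventually)
      (auto simp: exp_recip_def eventually_at_filter field_simps inverse_eq_divide)
  moreover have "((\<lambda>h. exp_recip P h / h) \<longlongrightarrow> 0) (at_left 0)"
    by (rule Lim_transform_eventually[OF tendsto_const]) (auto simp: exp_recip_def eventually_at_filter)
  ultimately have "((\<lambda>h. exp_recip P h / h) \<longlongrightarrow> 0) (at 0)"
    by (simp add: filterlim_split_at)
  then show ?thesis using equal by (simp add: DERIV_def exp_recip_def)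
qed

lemma smooth_on_exp_recip: "smooth_on UNIV (exp_recip P)"
proof -
  define Q where "Q k = ((\<lambda>P. [:0,0,1:] * (P - pderiv P)) ^^ k) P" for k
  have "smooth_on UNIV (exp_recip (Q 0))"
    by (rule smooth_on_real_derivative[where F="\<lambda>k. exp_recip (Q k)"])
      (use exp_recip_derivative in \<open>auto simp: Q_def\<close>)
  then show ?thesis by (simp add: Q_def)
qed

lemma smooth_on_inverse_pos: "smooth_on {0<..} (inverse :: real \<Rightarrow> real)"
proof -
  \<comment> \<open>The k-th derivative of 1/x.\<close>
  define F :: "nat \<Rightarrow> real \<Rightarrow> real" where "F k x = (-1) ^ k * fact k * inverse (x ^ Suc k)" for k x
  have "smooth_on {0<..} (F 0)"
  proof (rule smooth_on_real_derivative)
    fix k and x :: real assume "x \<in> {0<..}"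
    then have "x > 0" by simp
    have "((\<lambda>x. inverse (x ^ Suc k)) has_real_derivative - (real (Suc k) * inverse (x ^ Suc (Suc k)))) (at x)"
    proof -
      have "((\<lambda>x. inverse (x ^ Suc k)) has_real_derivative
          - (inverse (x ^ Suc k) * (real (Suc k) * x ^ k) * inverse (x ^ Suc k))) (at x)"
        using DERIV_inverse'[OF DERIV_pow[of "Suc k" x]] \<open>x > 0\<close> by simp
      moreover have "inverse (x ^ Suc k) * (real (Suc k) * x ^ k) * inverse (x ^ Suc k) =
          real (Suc k) * inverse (x ^ Suc (Suc k))"
        using \<open>x > 0\<close> by (simp add: field_simps del: of_nat_Suc)
      ultimately show ?thesis by (simp only:)
    qed
    from DERIV_cmult[OF this, of "(-1) ^ k * fact k"]
    show "(F k has_real_derivative F (Suc k) x) (at x)"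
      unfolding F_def[abs_def] by (simp add: algebra_simps)
  qed simp
  then show ?thesis by (simp add: F_def[abs_def])
qed

lemma smooth_step:
  "\<exists>s::real \<Rightarrow> real. smooth_on UNIV s \<and> (\<forall>x\<le>0. s x = 0) \<and> (\<forall>x\<ge>1. s x = 1)"
proof -
  \<comment> \<open>The classical quotient \<sigma>(x) / (\<sigma>(x) + \<sigma>(1 - x)); its
    denominator is positive since x and 1 - x are not both nonpositive.\<close>
  let ?\<sigma> = "exp_recip 1"
  have pos: "?\<sigma> x + ?\<sigma> (1 - x) > 0" for x
    by (auto simp: exp_recip_def add_pos_nonneg add_nonneg_pos)
  have "smooth_on UNIV (\<lambda>x. ?\<sigma> (1 - x))"
    by (rule smooth_on_compose[OF open_UNIV open_UNIV _ smooth_on_exp_recip])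
      (auto intro!: smooth_on_diff smooth_on_const smooth_on_ident)
  then have "smooth_on UNIV (\<lambda>x. inverse (?\<sigma> x + ?\<sigma> (1 - x)))"
    by (intro smooth_on_compose[OF open_UNIV _ _ smooth_on_inverse_pos] smooth_on_add smooth_on_exp_recip)
      (use pos in auto)
  then have "smooth_on UNIV (\<lambda>x. ?\<sigma> x * inverse (?\<sigma> x + ?\<sigma> (1 - x)))"
    by (intro smooth_on_mult smooth_on_exp_recip) auto
  moreover have "?\<sigma> x * inverse (?\<sigma> x + ?\<sigma> (1 - x)) = 1" if "x \<ge> 1" for x
  proof -
    have "?\<sigma> (1 - x) = 0" "?\<sigma> x > 0" using that by (auto simp: exp_recip_def)
    then show ?thesis by simp
  qed
  moreover have "?\<sigma> x * inverse (?\<sigma> x + ?\<sigma> (1 - x)) = 0" if "x \<le> 0" for x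
    using that by (simp add: exp_recip_def)
  ultimately show ?thesis by (intro exI[of _ "\<lambda>x. ?\<sigma> x * inverse (?\<sigma> x + ?\<sigma> (1 - x))"]) auto
qed

lemma smooth_plateau:
  fixes x0 :: "'a::euclidean_space"
  assumes "r > 0"
  shows "\<exists>b::'a \<Rightarrow> real. smooth_on UNIV b \<and> (\<forall>x\<in>cball x0 r. b x = 1) \<and> (\<forall>x. x \<notin> ball x0 (2 * r) \<longrightarrow> b x = 0)"
proof -
  obtain s :: "real \<Rightarrow> real" where s: "smooth_on UNIV s" "\<And>x. x \<le> 0 \<Longrightarrow> s x = 0" "\<And>x. x \<ge> 1 \<Longrightarrow> s x = 1"
    using smooth_step by blast
  \<comment> \<open>The squared distance is smooth at the centre too. The affine rescaling takes
    radius r to 1 and radius 2r to 0, the two thresholds of the step.\<close>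
  let ?q = "\<lambda>x. (4 * r\<^sup>2 - (x - x0) \<bullet> (x - x0)) * (1 / (3 * r\<^sup>2))"
  have sm: "smooth_on UNIV (\<lambda>x. s (?q x))"
    by (intro smooth_on_compose[OF open_UNIV open_UNIV _ s(1)] smooth_on_mult smooth_on_diff
        smooth_on_inner smooth_on_const smooth_on_ident) auto
  have "s (?q x) = 1" if "x \<in> cball x0 r" for x
  proof (rule s(3))
    have "(x - x0) \<bullet> (x - x0) \<le> r\<^sup>2"
      using that assms by (auto simp: dist_norm norm_minus_commute power2_norm_eq_inner[symmetric] intro!: power_mono)
    then show "?q x \<ge> 1" using assms by (simp add: field_simps)
  qed
  moreover have "s (?q x) = 0" if "x \<notin> ball x0 (2 * r)" for x
  proof (rule s(2))
    have "(2 * r)\<^sup>2 \<le> (norm (x - x0))\<^sup>2"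
      using that assms by (intro power_mono) (auto simp: dist_norm norm_minus_commute)
    then show "?q x \<le> 0" using assms
      by (auto simp: power2_norm_eq_inner power_mult_distrib intro!: divide_nonpos_pos)
  qed
  ultimately show ?thesis using sm by (intro exI[of _ "\<lambda>x. s (?q x)"]) auto
qed

section \<open>Integrals along rays: Hadamard's lemma and the Poincare lemma for 1-forms\<close>

lemma has_real_derivative_along_line:
  fixes g :: "'a::real_normed_vector \<Rightarrow> real"
  assumes "smooth_on S g" "c t \<in> S" "(c has_derivative (\<lambda>h. h *\<^sub>R v)) (at t within T)"
  shows "((\<lambda>t. g (c t)) has_real_derivative frechet_derivative g (at (c t)) v) (at t within T)"
proof -
  have "(\<lambda>h. frechet_derivative g (at (c t)) (h *\<^sub>R v)) = (*) (frechet_derivative g (at (c t)) v)"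
    using linear_cmul[OF smooth_on_linear_frechet[OF assms(1,2)]] by (auto simp: mult.commute)
  then show ?thesis
    using has_derivative_compose[OF assms(3) smooth_on_has_derivative[OF assms(1,2)]]
    by (simp add: has_field_derivative_def)
qed

lemma scaled_point_in_ball:
  fixes x :: "'a::real_normed_vector"
  assumes "x \<in> ball x0 r" "0 \<le> t" "t \<le> 1"
  shows "x0 + t *\<^sub>R (x - x0) \<in> ball x0 r"
proof -
  have "norm (t *\<^sub>R (x - x0)) \<le> norm (x - x0)" using assms by (simp add: mult_left_le_one_le)
  then show ?thesis using assms by (auto simp: dist_norm norm_minus_commute)
qed

text \<open>Each differentiation under the integral produces one more factor t. With a general
  weight \<open>t ^ m\<close> the derivative is an integral of the same kind, so that smoothness
  follows by induction on the order.\<close>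

lemma has_derivative_radial_integral:
  fixes g :: "'a::euclidean_space \<Rightarrow> real"
  assumes g: "smooth_on (ball x0 r) g" and x: "x \<in> ball x0 r"
  shows "((\<lambda>x. integral {0..1} (\<lambda>t. t ^ m * g (x0 + t *\<^sub>R (x - x0)))) has_derivative
    (\<lambda>v. integral {0..1} (\<lambda>t. t ^ Suc m * frechet_derivative g (at (x0 + t *\<^sub>R (x - x0))) v))) (at x)"
proof -
  let ?U = "ball x0 r"
  let ?y = "\<lambda>x t. x0 + t *\<^sub>R (x - x0)"
  \<comment> \<open>Leibniz' rule asks for a derivative that is continuous as a bounded linear map,
    so it is assembled from the inner products with the basis vectors.\<close>
  define fx where "fx x t = (\<Sum>i\<in>Basis. (t ^ Suc m * frechet_derivative g (at (?y x t)) i) *\<^sub>R blinfun_inner_right i)"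
    for x t
  have fx: "blinfun_apply (fx x t) v = t ^ Suc m * frechet_derivative g (at (?y x t)) v"
    if "x \<in> ?U" "t \<in> {0..1}" for x t v
  proof -
    have "blinfun_apply (fx x t) v = t ^ Suc m * (\<Sum>i\<in>Basis. (v \<bullet> i) *\<^sub>R frechet_derivative g (at (?y x t)) i)"
      by (simp add: fx_def blinfun.sum_left blinfun.scaleR_left inner_commute sum_distrib_left algebra_simps)
    also have "\<dots> = t ^ Suc m * frechet_derivative g (at (?y x t)) v"
      using frechet_derivative_expand[OF g scaled_point_in_ball[OF that(1)], of t v] that(2) by simp
    finally show ?thesis .
  qed
  have cy: "continuous_on (?U \<times> {0..1}) (\<lambda>z. ?y (fst z) (snd z))"
    by (intro continuous_intros)
  have im: "(\<lambda>z. ?y (fst z) (snd z)) ` (?U \<times> {0..1}) \<subseteq> ?U"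
    using scaled_point_in_ball by (fastforce simp: )
  have "continuous_on (?U \<times> {0..1}) (\<lambda>(x, t). fx x t)"
    unfolding fx_def split_beta
    by (intro continuous_intros continuous_on_compose2[OF smooth_on_continuous[OF smooth_on_frechet_derivative[OF g]] cy im])
  moreover have "(\<lambda>t. t ^ m * g (?y x t)) integrable_on cbox 0 1" if "x \<in> ?U" for x
    by (intro integrable_continuous continuous_intros
        continuous_on_compose2[OF smooth_on_continuous[OF g], where f="?y x"])
      (use scaled_point_in_ball[OF that] in auto)
  moreover have "((\<lambda>x. t ^ m * g (?y x t)) has_derivative blinfun_apply (fx x t)) (at x within ?U)"
    if "x \<in> ?U" "t \<in> cbox 0 1" for x t
  proof -
    have t: "t \<in> {0..1}" using that by auto
    have yin: "?y x t \<in> ?U" using scaled_point_in_ball[OF that(1)] t by auto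
    have d: "((\<lambda>x. ?y x t) has_derivative (\<lambda>v. t *\<^sub>R v)) (at x within ?U)"
      by (auto intro!: derivative_eq_intros)
    have "((\<lambda>x. g (?y x t)) has_derivative (\<lambda>v. frechet_derivative g (at (?y x t)) (t *\<^sub>R v))) (at x within ?U)"
      by (rule has_derivative_compose[OF d smooth_on_has_derivative[OF g yin]])
    then have "((\<lambda>x. t ^ m * g (?y x t)) has_derivative (\<lambda>v. t ^ m * frechet_derivative g (at (?y x t)) (t *\<^sub>R v))) (at x within ?U)"
      by (rule has_derivative_mult_right)
    moreover have "t ^ m * frechet_derivative g (at (?y x t)) (t *\<^sub>R v) = fx x t v" for v
      using fx[OF that(1) t] linear_cmul[OF smooth_on_linear_frechet[OF g yin]] by simp
    ultimately show ?thesis by simp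
  qed
  ultimately have "((\<lambda>x. integral (cbox 0 1) (\<lambda>t. t ^ m * g (?y x t))) has_derivative
      blinfun_apply (integral (cbox 0 1) (fx x))) (at x within ?U)"
    by (intro leibniz_rule[where fx=fx] x) auto
  moreover have "blinfun_apply (integral (cbox 0 1) (fx x)) =
      (\<lambda>v. integral {0..1} (\<lambda>t. t ^ Suc m * frechet_derivative g (at (?y x t)) v))"
  proof
    fix v
    have "continuous_on {0..1} (fx x)"
      unfolding fx_def
      by (intro continuous_intros continuous_on_compose2[OF smooth_on_continuous[OF smooth_on_frechet_derivative[OF g]], where f="?y x"])
        (use scaled_point_in_ball[OF x] in auto)
    then have "fx x integrable_on cbox 0 1" by (intro integrable_continuous) auto
    then have "blinfun_apply (integral (cbox 0 1) (fx x)) v = integral (cbox 0 1) (\<lambda>t. fx x t v)"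
      by (rule blinfun_apply_integral)
    also have "\<dots> = integral {0..1} (\<lambda>t. t ^ Suc m * frechet_derivative g (at (?y x t)) v)"
      unfolding cbox_interval by (rule integral_cong) (rule fx[OF x])
    finally show "blinfun_apply (integral (cbox 0 1) (fx x)) v =
        integral {0..1} (\<lambda>t. t ^ Suc m * frechet_derivative g (at (?y x t)) v)" .
  qed
  ultimately show ?thesis
    unfolding cbox_interval at_within_open[OF x open_ball] by (simp only:)
qed

lemma smooth_on_radial_integral:
  fixes g :: "'a::euclidean_space \<Rightarrow> real"
  assumes "smooth_on (ball x0 r) g"
  shows "smooth_on (ball x0 r) (\<lambda>x. integral {0..1} (\<lambda>t. t ^ m * g (x0 + t *\<^sub>R (x - x0))))"
proof -
  have "k_smooth_on k (ball x0 r) (\<lambda>x. integral {0..1} (\<lambda>t. t ^ m * g (x0 + t *\<^sub>R (x - x0))))" for k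
    using assms
  proof (induction k arbitrary: m g)
    case 0
    show ?case
      using has_derivative_continuous[OF has_derivative_radial_integral[OF 0]]
      by (auto intro: continuous_at_imp_continuous_on)
  next
    case (Suc k)
    show ?case
      by (rule k_smooth_on_SucI[OF open_ball has_derivative_radial_integral[OF Suc.prems]])
        (auto intro!: Suc.IH smooth_on_frechet_derivative Suc.prems simp del: power_Suc)
  qed
  then show ?thesis by (simp add: smooth_on_def)
qed

lemma radial_ftc:
  fixes g :: "'a::euclidean_space \<Rightarrow> real"
  assumes g: "smooth_on (ball x0 r) g" and x: "x \<in> ball x0 r" 
  shows "((\<lambda>t. frechet_derivative g (at (x0 + t *\<^sub>R (x - x0))) (x - x0)) has_integral g x - g x0) {0..1}"
proof -
  have "((\<lambda>t. frechet_derivative g (at (x0 + t *\<^sub>R (x - x0))) (x - x0)) has_integral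
      g (x0 + 1 *\<^sub>R (x - x0)) - g (x0 + 0 *\<^sub>R (x - x0))) {0..1}"
  proof (rule fundamental_theorem_of_calculus)
    fix t :: real assume t: "t \<in> {0..1}"
    have yin: "x0 + t *\<^sub>R (x - x0) \<in> ball x0 r" using scaled_point_in_ball[OF x] t by auto
    have d: "((\<lambda>t. x0 + t *\<^sub>R (x - x0)) has_derivative (\<lambda>h. h *\<^sub>R (x - x0))) (at t within {0..1})"
      by (auto intro!: derivative_eq_intros)
    show "((\<lambda>t. g (x0 + t *\<^sub>R (x - x0))) has_vector_derivative
        frechet_derivative g (at (x0 + t *\<^sub>R (x - x0))) (x - x0)) (at t within {0..1})"
      using has_real_derivative_along_line[OF g yin d]
      by (simp add: has_real_derivative_iff_has_vector_derivative)
  qed simp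
  then show ?thesis by simp
qed

text \<open>Integrate the derivative of \<open>f\<close> along the segment from \<open>x0\<close> to
  x and split the direction \<open>x - x0\<close> into basis components: \<open>h i\<close> is the
  mean of the i-th partial derivative over the segment.\<close>

lemma hadamard:
  fixes f :: "'a::euclidean_space \<Rightarrow> real"
  assumes f: "smooth_on (ball x0 r) f" and r: "r > 0"
  shows "\<exists>h. (\<forall>i\<in>Basis. smooth_on (ball x0 r) (h i) \<and> h i x0 = frechet_derivative f (at x0) i) \<and>
    (\<forall>x\<in>ball x0 r. f x = f x0 + (\<Sum>i\<in>Basis. ((x - x0) \<bullet> i) * h i x))"
proof -
  define h where "h i x = integral {0..1} (\<lambda>t. t ^ 0 * frechet_derivative f (at (x0 + t *\<^sub>R (x - x0))) i)" for i x
  have h: "smooth_on (ball x0 r) (h i)" for i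
    unfolding h_def[abs_def] by (rule smooth_on_radial_integral[OF smooth_on_frechet_derivative[OF f]])
  have "f x = f x0 + (\<Sum>i\<in>Basis. ((x - x0) \<bullet> i) * h i x)" if x: "x \<in> ball x0 r" for x
  proof -
    have "(\<Sum>i\<in>Basis. ((x - x0) \<bullet> i) * h i x)
        = integral {0..1} (\<lambda>t. \<Sum>i\<in>Basis. ((x - x0) \<bullet> i) * frechet_derivative f (at (x0 + t *\<^sub>R (x - x0))) i)"
      unfolding h_def power_0 mult_1_left integral_mult_right[symmetric]
      by (intro integral_sum[symmetric] finite_Basis integrable_continuous_real continuous_intros
          continuous_on_compose2[OF smooth_on_continuous[OF smooth_on_frechet_derivative[OF f]]])
        (use scaled_point_in_ball[OF x] in auto)
    also have "\<dots> = integral {0..1} (\<lambda>t. frechet_derivative f (at (x0 + t *\<^sub>R (x - x0))) (x - x0))"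
    proof (rule integral_cong)
      fix t :: real assume "t \<in> {0..1}"
      then show "(\<Sum>i\<in>Basis. ((x - x0) \<bullet> i) * frechet_derivative f (at (x0 + t *\<^sub>R (x - x0))) i) =
          frechet_derivative f (at (x0 + t *\<^sub>R (x - x0))) (x - x0)"
        using frechet_derivative_expand[OF f scaled_point_in_ball[OF x], of t "x - x0"] by simp
    qed
    also have "\<dots> = f x - f x0" using radial_ftc[OF f x] by (rule integral_unique)
    finally show ?thesis by simp
  qed
  then show ?thesis using h by (intro exI[of _ h]) (auto simp: h_def)
qed


text \<open>The primitive is the integral of the form along rays from \<open>x0\<close>. Once
  closedness has exchanged the indices, the integrand of its j-th partial derivative is the
  derivative of t \<theta>_j along the ray, which integrates to \<theta>_j at the end point.\<close>

lemma poincare_one_form: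
  fixes \<theta> :: "'a::euclidean_space \<Rightarrow> 'a \<Rightarrow> real"
  assumes sm: "\<And>i. i \<in> Basis \<Longrightarrow> smooth_on (ball x0 r) (\<theta> i)"
    and closed: "\<And>i j x. i \<in> Basis \<Longrightarrow> j \<in> Basis \<Longrightarrow> x \<in> ball x0 r \<Longrightarrow>
      frechet_derivative (\<theta> i) (at x) j = frechet_derivative (\<theta> j) (at x) i"
  shows "\<exists>F. \<forall>x\<in>ball x0 r. (F has_derivative (\<lambda>v. \<Sum>i\<in>Basis. (v \<bullet> i) * \<theta> i x)) (at x)"
proof -
  let ?y = "\<lambda>x t. x0 + t *\<^sub>R (x - x0)"
  define H where "H i x = integral {0..1} (\<lambda>t. t ^ 0 * \<theta> i (?y x t))" for i x
  define H' where "H' i x v = integral {0..1} (\<lambda>t. t ^ Suc 0 * frechet_derivative (\<theta> i) (at (?y x t)) v)" for i x v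
  have H: "(H i has_derivative H' i x) (at x)" if "i \<in> Basis" "x \<in> ball x0 r" for i x
    unfolding H_def[abs_def] H'_def[abs_def] by (rule has_derivative_radial_integral[OF sm[OF that(1)] that(2)])
  define F where "F x = (\<Sum>i\<in>Basis. ((x - x0) \<bullet> i) * H i x)" for x
  have "(F has_derivative (\<lambda>v. \<Sum>i\<in>Basis. (v \<bullet> i) * \<theta> i x)) (at x)" if x: "x \<in> ball x0 r" for x
  proof -
    note yin = scaled_point_in_ball[OF x]
    have F: "(F has_derivative (\<lambda>v. \<Sum>i\<in>Basis. ((x - x0) \<bullet> i) * H' i x v + (v \<bullet> i) * H i x)) (at x)"
      unfolding F_def[abs_def] using H[OF _ x] by (auto intro!: derivative_eq_intros simp: algebra_simps)
    have "(\<Sum>i\<in>Basis. ((x - x0) \<bullet> i) * H' i x j + (j \<bullet> i) * H i x) = \<theta> j x" if j: "j \<in> Basis" for j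
    proof -
      let ?D = "\<lambda>t. frechet_derivative (\<theta> j) (at (?y x t)) (x - x0)"
      have cD: "continuous_on {0..1} (\<lambda>t. frechet_derivative (\<theta> k) (at (?y x t)) i)" if "k \<in> Basis" for k i
        by (intro continuous_intros continuous_on_compose2[OF smooth_on_continuous[OF smooth_on_frechet_derivative[OF sm[OF that]]]])
          (use yin in auto)
      have c\<theta>: "continuous_on {0..1} (\<lambda>t. \<theta> j (?y x t))"
        by (intro continuous_intros continuous_on_compose2[OF smooth_on_continuous[OF sm[OF j]]])
          (use yin in auto)
      have "((\<lambda>t. t * ?D t + \<theta> j (?y x t)) has_integral (1 * \<theta> j (?y x 1) - 0 * \<theta> j (?y x 0))) {0..1}"
      proof (rule fundamental_theorem_of_calculus)
        fix t :: real assume t: "t \<in> {0..1}"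
        have d: "((\<lambda>t. ?y x t) has_derivative (\<lambda>h. h *\<^sub>R (x - x0))) (at t within {0..1})"
          by (auto intro!: derivative_eq_intros)
        have yt: "?y x t \<in> ball x0 r" using yin t by auto
        have "((\<lambda>t. \<theta> j (?y x t)) has_real_derivative ?D t) (at t within {0..1})"
          by (rule has_real_derivative_along_line[OF sm[OF j] yt d])
        from DERIV_mult[OF DERIV_ident this]
        show "((\<lambda>t. t * \<theta> j (?y x t)) has_vector_derivative t * ?D t + \<theta> j (?y x t)) (at t within {0..1})"
          by (simp add: has_real_derivative_iff_has_vector_derivative algebra_simps)
      qed simp
      then have I: "integral {0..1} (\<lambda>t. t * ?D t + \<theta> j (?y x t)) = \<theta> j x"
        by (simp add: integral_unique)
      \<comment> \<open>Closedness turns the derivative of component j along the ray into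
        derivatives of all components in direction j, which is what differentiating \<open>F\<close>
        produces.\<close>
      have eq: "?D t = (\<Sum>i\<in>Basis. ((x - x0) \<bullet> i) * frechet_derivative (\<theta> i) (at (?y x t)) j)"
        if "t \<in> {0..1}" for t
      proof -
        have yt: "?y x t \<in> ball x0 r" using yin that by auto
        show ?thesis
          unfolding frechet_derivative_expand[OF sm[OF j] yt, of "x - x0"] real_scaleR_def
          by (intro sum.cong refl arg_cong2[where f="(*)"] closed j yt)
      qed
      have "(\<Sum>i\<in>Basis. ((x - x0) \<bullet> i) * H' i x j) =
          integral {0..1} (\<lambda>t. \<Sum>i\<in>Basis. ((x - x0) \<bullet> i) * (t * frechet_derivative (\<theta> i) (at (?y x t)) j))"
        unfolding H'_def power_Suc power_0 mult_1_right integral_mult_right[symmetric]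
        by (intro integral_sum[symmetric] finite_Basis integrable_continuous_real continuous_intros cD)
      also have "\<dots> = integral {0..1} (\<lambda>t. t * ?D t)"
        by (rule integral_cong) (simp add: eq sum_distrib_left mult.left_commute)
      finally have a: "(\<Sum>i\<in>Basis. ((x - x0) \<bullet> i) * H' i x j) = integral {0..1} (\<lambda>t. t * ?D t)" .
      have b: "(\<Sum>i\<in>Basis. (j \<bullet> i) * H i x) = integral {0..1} (\<lambda>t. \<theta> j (?y x t))"
        using j by (simp add: inner_Basis if_distrib[of "\<lambda>c. c * _"] H_def cong: if_cong)
      have cD': "continuous_on {0..1} ?D"
      proof -
        have "continuous_on {0..1} (\<lambda>t. \<Sum>i\<in>Basis. ((x - x0) \<bullet> i) * frechet_derivative (\<theta> i) (at (?y x t)) j)"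
          by (intro continuous_intros cD)
        then show ?thesis by (rule continuous_on_eq) (rule eq[symmetric])
      qed
      have "integral {0..1} (\<lambda>t. t * ?D t + \<theta> j (?y x t)) =
          integral {0..1} (\<lambda>t. t * ?D t) + integral {0..1} (\<lambda>t. \<theta> j (?y x t))"
        by (intro Henstock_Kurzweil_Integration.integral_add integrable_continuous_real continuous_intros cD' c\<theta>)
      then show ?thesis using I a b by (simp add: sum.distrib)
    qed
    note basis = this
    let ?L = "\<lambda>v. \<Sum>i\<in>Basis. ((x - x0) \<bullet> i) * H' i x v + (v \<bullet> i) * H i x"
    have lin: "linear ?L" using F has_derivative_linear by blast
    have "?L v = (\<Sum>i\<in>Basis. (v \<bullet> i) * \<theta> i x)" for v
    proof -
      have "?L v = ?L (\<Sum>j\<in>Basis. (v \<bullet> j) *\<^sub>R j)" by (simp add: euclidean_representation)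
      also have "\<dots> = (\<Sum>j\<in>Basis. (v \<bullet> j) *\<^sub>R ?L j)" by (simp only: linear_sum[OF lin] linear_cmul[OF lin])
      also have "\<dots> = (\<Sum>j\<in>Basis. (v \<bullet> j) * \<theta> j x)" by (intro sum.cong refl) (simp only: basis real_scaleR_def)
      finally show ?thesis .
    qed
    then have "?L = (\<lambda>v. \<Sum>i\<in>Basis. (v \<bullet> i) * \<theta> i x)" by blast
    with F show ?thesis by simp
  qed
  then show ?thesis by blast
qed

section \<open>Symmetry of second derivatives\<close>

lemma second_difference:
  fixes f :: "'a::euclidean_space \<Rightarrow> real"
  assumes f: "smooth_on (ball x e) f" and h: "0 < h" "h * (norm u + norm v) < e"
  shows "\<exists>s t. 0 \<le> s \<and> s \<le> h \<and> 0 \<le> t \<and> t \<le> h \<and>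
    f (x + h *\<^sub>R u + h *\<^sub>R v) - f (x + h *\<^sub>R u) - f (x + h *\<^sub>R v) + f x =
    h * h * frechet_derivative (\<lambda>y. frechet_derivative f (at y) u) (at (x + s *\<^sub>R u + t *\<^sub>R v)) v"
proof -
  let ?Du = "\<lambda>y. frechet_derivative f (at y) u"
  have inb: "x + s *\<^sub>R u + t *\<^sub>R v \<in> ball x e" if "0 \<le> s" "s \<le> h" "0 \<le> t" "t \<le> h" for s t
  proof -
    have "norm (s *\<^sub>R u + t *\<^sub>R v) \<le> s * norm u + t * norm v"
      using norm_triangle_ineq[of "s *\<^sub>R u" "t *\<^sub>R v"] that by simp
    also have "\<dots> \<le> h * norm u + h * norm v" using that by (intro add_mono mult_right_mono) auto
    also have "\<dots> < e" using h by (simp add: algebra_simps)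
    finally have "dist (x + s *\<^sub>R u + t *\<^sub>R v) x < e" by (simp add: dist_norm add.assoc)
    then show ?thesis by (simp add: dist_commute)
  qed
  have d1: "((\<lambda>s. g (x + s *\<^sub>R u + t *\<^sub>R v)) has_real_derivative frechet_derivative g (at (x + s *\<^sub>R u + t *\<^sub>R v)) u) (at s)"
    if g: "smooth_on (ball x e) g" and "0 \<le> s" "s \<le> h" "0 \<le> t" "t \<le> h" for g :: "'a \<Rightarrow> real" and s t
  proof -
    have d: "((\<lambda>s. x + s *\<^sub>R u + t *\<^sub>R v) has_derivative (\<lambda>h. h *\<^sub>R u)) (at s)"
      by (auto intro!: derivative_eq_intros)
    show ?thesis
      by (rule has_real_derivative_along_line[OF g inb[OF that(2-)] d])
  qed
  have d2: "((\<lambda>t. g (x + s *\<^sub>R u + t *\<^sub>R v)) has_real_derivative frechet_derivative g (at (x + s *\<^sub>R u + t *\<^sub>R v)) v) (at t)"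
    if g: "smooth_on (ball x e) g" and "0 \<le> s" "s \<le> h" "0 \<le> t" "t \<le> h" for g :: "'a \<Rightarrow> real" and s t
  proof -
    have d: "((\<lambda>t. x + s *\<^sub>R u + t *\<^sub>R v) has_derivative (\<lambda>h. h *\<^sub>R v)) (at t)"
      by (auto intro!: derivative_eq_intros)
    show ?thesis
      by (rule has_real_derivative_along_line[OF g inb[OF that(2-)] d])
  qed
  \<comment> \<open>The mean value theorem is applied in s to the increment in direction v, and
    afterwards in t to the derivative in direction u.\<close>
  have "\<exists>s. 0 < s \<and> s < h \<and>
      (f (x + h *\<^sub>R u + h *\<^sub>R v) - f (x + h *\<^sub>R u + 0 *\<^sub>R v)) - (f (x + 0 *\<^sub>R u + h *\<^sub>R v) - f (x + 0 *\<^sub>R u + 0 *\<^sub>R v))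
      = (h - 0) * (?Du (x + s *\<^sub>R u + h *\<^sub>R v) - ?Du (x + s *\<^sub>R u + 0 *\<^sub>R v))"
    using h(1) by (intro MVT2[of 0 h "\<lambda>s. f (x + s *\<^sub>R u + h *\<^sub>R v) - f (x + s *\<^sub>R u + 0 *\<^sub>R v)"] DERIV_diff d1 f) auto
  then obtain s where s: "0 < s" "s < h"
      "(f (x + h *\<^sub>R u + h *\<^sub>R v) - f (x + h *\<^sub>R u)) - (f (x + h *\<^sub>R v) - f x)
      = h * (?Du (x + s *\<^sub>R u + h *\<^sub>R v) - ?Du (x + s *\<^sub>R u + 0 *\<^sub>R v))"
    by auto
  have "\<exists>t. 0 < t \<and> t < h \<and> ?Du (x + s *\<^sub>R u + h *\<^sub>R v) - ?Du (x + s *\<^sub>R u + 0 *\<^sub>R v)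
      = (h - 0) * frechet_derivative ?Du (at (x + s *\<^sub>R u + t *\<^sub>R v)) v"
    using h(1) s(1,2) by (intro MVT2 d2 smooth_on_frechet_derivative f) auto
  then obtain t where t: "0 < t" "t < h" "?Du (x + s *\<^sub>R u + h *\<^sub>R v) - ?Du (x + s *\<^sub>R u + 0 *\<^sub>R v)
      = h * frechet_derivative ?Du (at (x + s *\<^sub>R u + t *\<^sub>R v)) v" by auto
  show ?thesis
  proof (intro exI conjI)
    show "f (x + h *\<^sub>R u + h *\<^sub>R v) - f (x + h *\<^sub>R u) - f (x + h *\<^sub>R v) + f x =
        h * h * frechet_derivative ?Du (at (x + s *\<^sub>R u + t *\<^sub>R v)) v"
      using s(3) unfolding t(3) mult.assoc by linarith
  qed (use s t in auto)
qed

text \<open>The second difference is symmetric in u and v, and \<open>second_difference\<close>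
  evaluates it as either mixed derivative at a point close to x. If the two differed at x,
  continuity would keep them apart on a small parallelogram.\<close>

lemma symmetric_second_derivative:
  fixes f :: "'a::euclidean_space \<Rightarrow> real"
  assumes S: "open S" "smooth_on S f" "x \<in> S"
  shows "frechet_derivative (\<lambda>y. frechet_derivative f (at y) u) (at x) v =
    frechet_derivative (\<lambda>y. frechet_derivative f (at y) v) (at x) u"
proof (rule ccontr)
  let ?A = "\<lambda>y. frechet_derivative (\<lambda>y. frechet_derivative f (at y) u) (at y) v"
  let ?B = "\<lambda>y. frechet_derivative (\<lambda>y. frechet_derivative f (at y) v) (at y) u"
  assume ne: "?A x \<noteq> ?B x"
  define \<epsilon> where "\<epsilon> = \<bar>?A x - ?B x\<bar> / 2"
  have "\<epsilon> > 0" using ne by (simp add: \<epsilon>_def)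
  obtain e where e: "e > 0" "ball x e \<subseteq> S" using S openE by blast
  have f: "smooth_on (ball x e) f" using S(2) e(2) smooth_on_subset by blast
  have "isCont ?A x" "isCont ?B x"
    using smooth_on_continuous[OF smooth_on_frechet_derivative[OF smooth_on_frechet_derivative[OF f]]] e(1)
    by (auto simp: continuous_on_eq_continuous_at)
  then obtain d1 d2 where d: "d1 > 0" "\<And>y. dist y x < d1 \<Longrightarrow> dist (?A y) (?A x) < \<epsilon>"
      "d2 > 0" "\<And>y. dist y x < d2 \<Longrightarrow> dist (?B y) (?B x) < \<epsilon>"
    using \<open>\<epsilon> > 0\<close> unfolding continuous_at_eps_delta by metis
  define m where "m = min e (min d1 d2)"
  define N where "N = norm u + norm v + 1"
  \<comment> \<open>The summand 1 in \<open>N\<close> keeps it positive for u = v = 0, and the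
    factor 1/2 keeps the parallelogram strictly within distance \<open>m\<close>, where
    \<open>f\<close> is smooth and both continuity estimates hold.\<close>
  define h where "h = m / N / 2"
  have m: "m > 0" using e d by (simp add: m_def)
  have n: "N > 0" by (simp add: add_nonneg_pos N_def)
  have h: "h > 0" using m n by (simp add: h_def)
  have "h * (norm u + norm v) \<le> h * N" using h by (simp add: N_def)
  also have "\<dots> = m / 2" using n by (simp add: h_def)
  also have "\<dots> < m" using m by simp
  finally have hm: "h * (norm u + norm v) < m" .
  have near: "dist (x + s *\<^sub>R u + t *\<^sub>R v) x < m" if "0 \<le> s" "s \<le> h" "0 \<le> t" "t \<le> h" for s t
  proof -
    have "norm (s *\<^sub>R u + t *\<^sub>R v) \<le> s * norm u + t * norm v"
      using norm_triangle_ineq[of "s *\<^sub>R u" "t *\<^sub>R v"] that by simp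
    also have "\<dots> \<le> h * norm u + h * norm v" using that by (intro add_mono mult_right_mono) auto
    also have "\<dots> < m" using hm by (simp add: algebra_simps)
    finally show ?thesis by (simp add: dist_norm add.assoc)
  qed
  obtain s t where st: "0 \<le> s" "s \<le> h" "0 \<le> t" "t \<le> h"
    "f (x + h *\<^sub>R u + h *\<^sub>R v) - f (x + h *\<^sub>R u) - f (x + h *\<^sub>R v) + f x = h * h * ?A (x + s *\<^sub>R u + t *\<^sub>R v)"
    using second_difference[OF f h, of u v] hm by (auto simp: m_def)
  obtain s' t' where st': "0 \<le> s'" "s' \<le> h" "0 \<le> t'" "t' \<le> h"
    "f (x + h *\<^sub>R v + h *\<^sub>R u) - f (x + h *\<^sub>R v) - f (x + h *\<^sub>R u) + f x = h * h * ?B (x + s' *\<^sub>R v + t' *\<^sub>R u)"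
    using second_difference[OF f h, of v u] hm by (auto simp: m_def add.commute)
  have "x + h *\<^sub>R v + h *\<^sub>R u = x + h *\<^sub>R u + h *\<^sub>R v" by (simp add: algebra_simps)
  then have "h * h * ?A (x + s *\<^sub>R u + t *\<^sub>R v) = h * h * ?B (x + s' *\<^sub>R v + t' *\<^sub>R u)"
    using st(5) st'(5) by (simp only:)
  then have AB: "?A (x + s *\<^sub>R u + t *\<^sub>R v) = ?B (x + s' *\<^sub>R v + t' *\<^sub>R u)" using h by simp
  have "dist (?A (x + s *\<^sub>R u + t *\<^sub>R v)) (?A x) < \<epsilon>"
    using near[OF st(1-4)] by (intro d(2)) (simp add: m_def)
  moreover have "x + s' *\<^sub>R v + t' *\<^sub>R u = x + t' *\<^sub>R u + s' *\<^sub>R v" by (simp add: algebra_simps)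
  then have "dist (?B (x + s' *\<^sub>R v + t' *\<^sub>R u)) (?B x) < \<epsilon>"
    using near[OF st'(3,4,1,2)] by (intro d(4)) (simp only: m_def min_less_iff_conj)
  moreover have "False" if "\<bar>a - A\<bar> < \<bar>A - B\<bar> / 2" "\<bar>a - B\<bar> < \<bar>A - B\<bar> / 2" for a A B :: real
    using that abs_triangle_ineq4[of "a - B" "a - A"] by simp
  ultimately show False using AB unfolding dist_real_def \<epsilon>_def by metis
qed


section \<open>Euler polygons\<close>

lemma euler_step_estimate:
  fixes F :: "'a::euclidean_space \<Rightarrow> real"
  assumes S: "open S" "cball y0 r \<subseteq> S" and F: "smooth_on S F"
    and V: "continuous_on (cball y0 r) V" and M: "\<And>x. x \<in> cball y0 r \<Longrightarrow> norm (V x) \<le> M" "M > 0"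
    and FV: "\<And>x. x \<in> cball y0 r \<Longrightarrow> frechet_derivative F (at x) (V x) = 0" and "\<epsilon> > 0"
  shows "\<exists>\<delta>>0. \<forall>h x. 0 \<le> h \<longrightarrow> h < \<delta> \<longrightarrow> x \<in> cball y0 r \<longrightarrow> x + h *\<^sub>R V x \<in> cball y0 r \<longrightarrow>
    \<bar>F (x + h *\<^sub>R V x) - F x\<bar> \<le> h * \<epsilon>"
proof -
  let ?C = "cball y0 r"
  \<comment> \<open>The mean value theorem evaluates the derivative of \<open>F\<close> at an
    intermediate point but keeps \<open>V\<close> at x. With independent base points, uniform
    continuity compares that value with the diagonal, where \<open>FV\<close> makes it zero.\<close>
  define G where "G z = (\<Sum>i\<in>Basis. (V (fst z) \<bullet> i) * frechet_derivative F (at (snd z)) i)" for z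
  have c: "continuous_on ?C (\<lambda>y. frechet_derivative F (at y) i)" for i
    using smooth_on_continuous[OF smooth_on_frechet_derivative[OF F]] S(2) continuous_on_subset by blast
  have "continuous_on (?C \<times> ?C) (\<lambda>z. frechet_derivative F (at (snd z)) i)"
      "continuous_on (?C \<times> ?C) (\<lambda>z. V (fst z))" for i
    by (rule continuous_on_compose2[OF c continuous_on_snd[OF continuous_on_id]]
        continuous_on_compose2[OF V continuous_on_fst[OF continuous_on_id]]; auto)+
  then have "continuous_on (?C \<times> ?C) G" unfolding G_def[abs_def] by (intro continuous_intros)
  then have "uniformly_continuous_on (?C \<times> ?C) G"
    by (intro compact_uniformly_continuous compact_Times) auto
  then obtain d where d: "d > 0" "\<And>z z'. z \<in> ?C \<times> ?C \<Longrightarrow> z' \<in> ?C \<times> ?C \<Longrightarrow> dist z' z < d \<Longrightarrow> dist (G z') (G z) < \<epsilon>"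
    unfolding uniformly_continuous_on_def using \<open>\<epsilon> > 0\<close> by metis
  have G: "G (x, y) = frechet_derivative F (at y) (V x)" if "y \<in> ?C" for x y
    using frechet_derivative_expand[OF F, of y "V x"] S(2) that by (auto simp: G_def)
  have "\<bar>F (x + h *\<^sub>R V x) - F x\<bar> \<le> h * \<epsilon>"
    if h: "0 \<le> h" "h < d / M" and x: "x \<in> ?C" "x + h *\<^sub>R V x \<in> ?C" for h x
  proof (cases "h = 0")
    case False
    then have "h > 0" using h by simp
    have inC: "x + t *\<^sub>R V x \<in> ?C" if "0 \<le> t" "t \<le> h" for t
    proof -
      have "(1 - t / h) *\<^sub>R x + (t / h) *\<^sub>R (x + h *\<^sub>R V x) \<in> ?C"
        using that \<open>h > 0\<close> x by (intro convexD[OF convex_cball]) auto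
      moreover have "(1 - t / h) *\<^sub>R x + (t / h) *\<^sub>R (x + h *\<^sub>R V x) = x + t *\<^sub>R V x"
        using \<open>h > 0\<close> by (simp add: algebra_simps)
      ultimately show ?thesis by simp
    qed
    have "\<exists>t. 0 < t \<and> t < h \<and> F (x + h *\<^sub>R V x) - F (x + 0 *\<^sub>R V x) = (h - 0) * frechet_derivative F (at (x + t *\<^sub>R V x)) (V x)"
    proof (rule MVT2[OF \<open>h > 0\<close>])
      fix t :: real assume "0 \<le> t" "t \<le> h"
      then have "x + t *\<^sub>R V x \<in> S" using inC S(2) by blast
      then show "((\<lambda>t. F (x + t *\<^sub>R V x)) has_real_derivative frechet_derivative F (at (x + t *\<^sub>R V x)) (V x)) (at t)"
        by (intro has_real_derivative_along_line[OF F]) (auto intro!: derivative_eq_intros)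
    qed
    then obtain t where t: "0 < t" "t < h" "F (x + h *\<^sub>R V x) - F x = h * G (x, x + t *\<^sub>R V x)"
      using G inC by (metis add_0_right diff_zero less_imp_le scaleR_zero_left)
    have "dist (x, x + t *\<^sub>R V x) (x, x) = t * norm (V x)" using t by (simp add: dist_Pair_Pair dist_norm)
    also have "\<dots> \<le> h * M" using t M(1)[OF x(1)] M(2) by (intro mult_mono) auto
    also have "\<dots> < d" using h M by (simp add: field_simps)
    finally have "dist (G (x, x + t *\<^sub>R V x)) (G (x, x)) < \<epsilon>"
      using x(1) inC[of t] t by (intro d(2)) auto
    then have "\<bar>G (x, x + t *\<^sub>R V x)\<bar> \<le> \<epsilon>" using G[OF x(1)] FV[OF x(1)] by (simp add: dist_real_def)
    then show ?thesis using t(3) \<open>h > 0\<close> by (simp add: abs_mult)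
  qed simp
  then show ?thesis using d(1) M(2) by (intro exI[of _ "d / M"]) auto
qed

text \<open>
  A substitute for the flow of \<open>V\<close>: any limit of the end points of Euler polygons of a fixed
  length is a point that no common first integral of \<open>V\<close> separates from the starting point.
\<close>

lemma euler_polygon:
  fixes V :: "'a::euclidean_space \<Rightarrow> 'a"
  assumes r: "r > 0" and S: "open S" "cball y0 r \<subseteq> S" and V: "continuous_on (cball y0 r) V" "V y0 \<noteq> 0"
  shows "\<exists>x\<in>cball y0 r. x \<noteq> y0 \<and> (\<forall>F::'a \<Rightarrow> real. smooth_on S F \<longrightarrow>
    (\<forall>y\<in>cball y0 r. frechet_derivative F (at y) (V y) = 0) \<longrightarrow> F x = F y0)"
proof -
  define c where "c = V y0"
  have c: "norm c > 0" using V(2) by (simp add: c_def)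
  have "\<forall>e>0. \<exists>d>0. \<forall>x'\<in>cball y0 r. dist x' y0 < d \<longrightarrow> dist (V x') (V y0) < e"
    using V(1) r by (auto simp: continuous_on_iff)
  then obtain d where d: "d > 0" "\<And>x. x \<in> cball y0 r \<Longrightarrow> dist x y0 < d \<Longrightarrow> dist (V x) c < norm c / 2"
    using c unfolding c_def by (metis half_gt_zero)
  \<comment> \<open>On this ball \<open>V\<close> differs from c by at most half the length of c, so
    a polygon neither turns back nor runs faster than 3/2 times that length.\<close>
  define \<rho> where "\<rho> = min r (d / 2)"
  have \<rho>: "\<rho> > 0" "cball y0 \<rho> \<subseteq> cball y0 r" using r d(1) by (auto simp: \<rho>_def)
  have near: "norm (V x - c) \<le> norm c / 2" if "x \<in> cball y0 \<rho>" for x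
  proof -
    have "dist x y0 < d" using that d(1) by (auto simp: \<rho>_def dist_commute)
    then show ?thesis using d(2)[of x] \<rho>(2) that by (auto simp: dist_norm intro: less_imp_le)
  qed
  \<comment> \<open>At speed at most 3/2 |c| a polygon of duration s travels at most 3/4 \<rho> and
    stays in the ball.\<close>
  define s where "s = \<rho> / (2 * norm c)"
  have s: "s > 0" using \<rho> c by (simp add: s_def)
  define X where "X h k = ((\<lambda>x. x + h *\<^sub>R V x) ^^ k) y0" for h :: real and k
  have X0: "X h 0 = y0" and XS: "X h (Suc k) = X h k + h *\<^sub>R V (X h k)" for h k by (simp_all add: X_def)
  have inv: "norm (X h k - y0 - (real k * h) *\<^sub>R c) \<le> real k * h * (norm c / 2) \<and> X h k \<in> cball y0 \<rho>"
    if h: "h \<ge> 0" "real K * h = s" and k: "k \<le> K" for h k K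
    using k
  proof (induction k)
    case 0
    then show ?case using \<rho> by (simp add: X0)
  next
    case (Suc k)
    then have IH: "norm (X h k - y0 - (real k * h) *\<^sub>R c) \<le> real k * h * (norm c / 2)" "X h k \<in> cball y0 \<rho>" by auto
    have eq: "X h (Suc k) - y0 - (real (Suc k) * h) *\<^sub>R c =
        (X h k - y0 - (real k * h) *\<^sub>R c) + h *\<^sub>R (V (X h k) - c)"
      by (simp add: XS algebra_simps)
    have "norm (X h (Suc k) - y0 - (real (Suc k) * h) *\<^sub>R c) \<le> real k * h * (norm c / 2) + h * (norm c / 2)"
      unfolding eq using h(1) mult_left_mono[OF near[OF IH(2)] h(1)]
      by (intro norm_triangle_le add_mono IH(1)) simp
    then have a: "norm (X h (Suc k) - y0 - (real (Suc k) * h) *\<^sub>R c) \<le> real (Suc k) * h * (norm c / 2)"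
      by (simp add: algebra_simps)
    have ks: "real (Suc k) * h \<le> s" using h Suc.prems by (metis mult_right_mono of_nat_le_iff)
    have "norm (X h (Suc k) - y0) \<le> norm (X h (Suc k) - y0 - (real (Suc k) * h) *\<^sub>R c) + norm ((real (Suc k) * h) *\<^sub>R c)"
      by (subst add.commute) (rule norm_triangle_sub)
    also have "\<dots> \<le> real (Suc k) * h * (norm c / 2) + real (Suc k) * h * norm c"
      using a h(1) by (intro add_mono) auto
    also have "\<dots> = real (Suc k) * h * (3 / 2 * norm c)" by (simp add: algebra_simps)
    also have "\<dots> \<le> s * (3 / 2 * norm c)" using ks c by (intro mult_right_mono) auto
    also have "\<dots> = 3 / 4 * \<rho>" using c by (simp add: s_def)
    also have "\<dots> \<le> \<rho>" using \<rho> by simp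
    finally show ?case using a by (simp add: dist_norm norm_minus_commute)
  qed
  \<comment> \<open>End point after \<open>Suc n\<close> equal steps of total duration s.\<close>
  define Z where "Z n = X (s / real (Suc n)) (Suc n)" for n
  have h: "s / real (Suc n) \<ge> 0" "real (Suc n) * (s / real (Suc n)) = s" for n using s by auto
  have Z: "Z n \<in> cball y0 \<rho>" and Zlow: "norm (Z n - y0) \<ge> s * (norm c / 2)" for n
  proof -
    have *: "norm (Z n - y0 - s *\<^sub>R c) \<le> s * (norm c / 2)" "Z n \<in> cball y0 \<rho>"
      using inv[OF h(1,2)[of n], of "Suc n"] unfolding h(2) Z_def by auto
    have "norm (s *\<^sub>R c) \<le> norm (Z n - y0) + norm (Z n - y0 - s *\<^sub>R c)"
      using norm_triangle_ineq4[of "Z n - y0" "Z n - y0 - s *\<^sub>R c"] by simp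
    then show "Z n \<in> cball y0 \<rho>" "norm (Z n - y0) \<ge> s * (norm c / 2)" using * s by auto
  qed
  have "compact (cball y0 \<rho>)" by simp
  then obtain x \<phi> where x: "x \<in> cball y0 \<rho>" "strict_mono \<phi>" "(Z \<circ> \<phi>) \<longlonglongrightarrow> x"
    unfolding compact_def using Z by metis
  \<comment> \<open>Every polygon is displaced by at least s |c| / 2. The bound survives the limit
    and separates it from \<open>y0\<close>.\<close>
  have "norm (x - y0) \<ge> s * (norm c / 2)"
    using x(3) Zlow by (intro tendsto_lowerbound[of "\<lambda>n. norm ((Z \<circ> \<phi>) n - y0)" "norm (x - y0)" sequentially])
      (auto intro!: tendsto_intros simp: o_def)
  moreover have "s * (norm c / 2) > 0" using s c by simp
  ultimately have "x \<noteq> y0" by auto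
  moreover have "F x = F y0" if F: "smooth_on S F" and FV: "\<forall>y\<in>cball y0 r. frechet_derivative F (at y) (V y) = 0"
    for F :: "'a \<Rightarrow> real"
  proof -
    have S\<rho>: "cball y0 \<rho> \<subseteq> S" using \<rho>(2) S(2) by blast
    have "(\<lambda>n. F (Z n) - F y0) \<longlonglongrightarrow> 0"
    proof (rule LIMSEQ_I)
      fix e :: real assume "e > 0"
      \<comment> \<open>The errors of the single steps add up to at most the total duration s times
        \<epsilon>, that is e/2.\<close>
      define \<epsilon> where "\<epsilon> = e / (2 * s)"
      have \<epsilon>: "\<epsilon> > 0" using \<open>e > 0\<close> s by (simp add: \<epsilon>_def)
      have M: "norm (V y) \<le> 3 / 2 * norm c" if "y \<in> cball y0 \<rho>" for y
        using near[OF that] norm_triangle_sub[of "V y" c] by simp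
      have FV': "frechet_derivative F (at y) (V y) = 0" if "y \<in> cball y0 \<rho>" for y
        using FV \<rho>(2) that by blast
      have "3 / 2 * norm c > 0" using c by simp
      from euler_step_estimate[OF S(1) S\<rho> F continuous_on_subset[OF V(1) \<rho>(2)] M this FV' \<epsilon>]
      obtain \<delta> where \<delta>: "\<delta> > 0" "\<And>h x. 0 \<le> h \<Longrightarrow> h < \<delta> \<Longrightarrow> x \<in> cball y0 \<rho> \<Longrightarrow> x + h *\<^sub>R V x \<in> cball y0 \<rho> \<Longrightarrow>
          \<bar>F (x + h *\<^sub>R V x) - F x\<bar> \<le> h * \<epsilon>"
        by blast
      obtain N where N: "s / \<delta> < real N" using reals_Archimedean2 by blast
      have "norm (F (Z n) - F y0 - 0) < e" if n: "n \<ge> N" for n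
      proof -
        let ?h = "s / real (Suc n)"
        have "s < real N * \<delta>" using N \<delta>(1) by (simp add: field_simps)
        also have "\<dots> \<le> real (Suc n) * \<delta>" using n \<delta>(1) by (intro mult_right_mono) auto
        finally have hd: "?h < \<delta>" by (simp add: field_simps)
        have "\<bar>F (X ?h k) - F y0\<bar> \<le> real k * ?h * \<epsilon>" if "k \<le> Suc n" for k
          using that
        proof (induction k)
          case 0
          then show ?case by (simp add: X0)
        next
          case (Suc k)
          have "\<bar>F (X ?h k + ?h *\<^sub>R V (X ?h k)) - F (X ?h k)\<bar> \<le> ?h * \<epsilon>"
            using inv[OF h[of n], of k] inv[OF h[of n], of "Suc k"] Suc.prems
            by (intro \<delta>(2) h(1) hd) (simp_all add: XS)
          then have "\<bar>F (X ?h (Suc k)) - F y0\<bar> \<le> real k * ?h * \<epsilon> + ?h * \<epsilon>"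
            using Suc unfolding XS by linarith
          then show ?case by (simp add: algebra_simps add_divide_distrib)
        qed
        from this[of "Suc n"] have "\<bar>F (Z n) - F y0\<bar> \<le> s * \<epsilon>" unfolding Z_def h(2) by simp
        also have "\<dots> < e" using s \<open>e > 0\<close> by (simp add: \<epsilon>_def)
        finally show ?thesis by simp
      qed
      then show "\<exists>N. \<forall>n\<ge>N. norm (F (Z n) - F y0 - 0) < e" by blast
    qed
    then have "(\<lambda>n. F ((Z \<circ> \<phi>) n) - F y0) \<longlonglongrightarrow> 0" 
      using LIMSEQ_subseq_LIMSEQ[OF _ x(2), of "\<lambda>n. F (Z n) - F y0"] by (simp add: o_def)
    moreover have "(\<lambda>n. F ((Z \<circ> \<phi>) n) - F y0) \<longlonglongrightarrow> F x - F y0"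
    proof -
      have "isCont F x"
        using smooth_on_continuous[OF F] S(1) S\<rho> x(1) by (auto simp: continuous_on_eq_continuous_at)
      then show ?thesis by (intro tendsto_diff tendsto_const isCont_tendsto_compose[OF _ x(3)])
    qed
    ultimately have "0 = F x - F y0" using LIMSEQ_unique by blast
    then show ?thesis by simp
  qed
  ultimately show ?thesis using x(1) \<rho>(2) by blast
qed

text \<open>
  Averaging over a compact group without Haar measure: the vector in the invariant affine
  hyperplane that minimises the invariant norm is unique, because this norm is a supremum over a compact
  family of euclidean norms that is attained and hence strictly convex.
\<close>

lemma compact_group_invariant_vector:
  fixes \<rho> :: "'g::topological_space \<Rightarrow> 'd::euclidean_space \<Rightarrow> 'd" and \<alpha> :: "'d \<Rightarrow> real"
  assumes comp: "compact (UNIV :: 'g set)"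
    and lin: "\<And>b. linear (\<rho> b)" and cont: "\<And>x. continuous_on UNIV (\<lambda>b. \<rho> b x)"
    and mult: "\<And>a b. \<exists>c. \<forall>x. \<rho> a (\<rho> b x) = \<rho> c x"
    and inj: "\<And>b x. \<rho> b x = 0 \<Longrightarrow> x = 0" and e: "\<And>x. \<rho> e x = x"
    and \<alpha>: "linear \<alpha>" "\<And>b x. \<alpha> (\<rho> b x) = \<alpha> x" "\<alpha> x0 \<noteq> 0"
  shows "\<exists>x. \<alpha> x \<noteq> 0 \<and> (\<forall>b. \<rho> b x = x)"
proof -
  \<comment> \<open>Sublevel sets of the invariant norm, the supremum over b of |\<rho> b x|, inside
    the hyperplane on which \<alpha> equals \<open>\<alpha> x0\<close>. The minimum sought is the
    infimum of the levels in \<open>R\<close>.\<close>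
  define C where "C c = {x. \<alpha> x = \<alpha> x0 \<and> (\<forall>b. norm (\<rho> b x) \<le> c)}" for c
  define R where "R = {c. C c \<noteq> {}}"
  have att: "\<exists>b. \<forall>b'. norm (\<rho> b' x) \<le> norm (\<rho> b x)" for x
  proof -
    have "continuous_on UNIV (\<lambda>b. norm (\<rho> b x))" by (intro continuous_intros cont)
    from continuous_attains_sup[OF comp _ this] show ?thesis by auto
  qed
  have R0: "c \<ge> 0" if "c \<in> R" for c
  proof -
    obtain x where "norm (\<rho> e x) \<le> c" using \<open>c \<in> R\<close> by (auto simp: R_def C_def)
    then show ?thesis using norm_ge_zero order_trans by blast
  qed
  have bdd: "bdd_below R" using R0 by (meson bdd_belowI)
  have Rne: "R \<noteq> {}" using att[of x0] by (auto simp: R_def C_def)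
  define m where "m = Inf R"
  have compC: "compact (C c)" for c
  proof -
    have "C c = {x. \<alpha> x = \<alpha> x0} \<inter> (\<Inter>b. {x. norm (\<rho> b x) \<le> c})" by (auto simp: C_def)
    moreover have "closed {x. norm (\<rho> b x) \<le> c}" for b
      by (intro closed_Collect_le continuous_intros linear_continuous_on linear_linear[THEN iffD2] lin)
    moreover have "closed {x. \<alpha> x = \<alpha> x0}"
      by (intro closed_Collect_eq continuous_intros linear_continuous_on linear_linear[THEN iffD2] \<alpha>(1))
    ultimately have "closed (C c)" by (simp only:) (intro closed_Int closed_INT ballI)
    \<comment> \<open>The element e acts as the identity, so the invariant norm dominates the
      euclidean one.\<close>
    moreover have "C c \<subseteq> cball 0 c" using e by (auto simp: C_def) metis
    ultimately show ?thesis by (meson bounded_cball bounded_subset compact_eq_bounded_closed)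
  qed
  have "C (m + 1 / real (Suc n)) \<noteq> {}" for n
  proof -
    have "\<exists>c\<in>R. c < m + 1 / real (Suc n)" unfolding m_def using Rne bdd by (subst cInf_less_iff[symmetric]) auto
    then obtain c where "c \<in> R" "c < m + 1 / real (Suc n)" by blast
    moreover have "C c \<subseteq> C c'" if "c \<le> c'" for c' using that by (auto simp: C_def intro: order_trans)
    ultimately show ?thesis unfolding R_def by (metis (mono_tags, lifting) less_imp_le mem_Collect_eq subset_empty)
  qed
  moreover have "C (m + 1 / real (Suc n')) \<subseteq> C (m + 1 / real (Suc n))" if "n \<le> n'" for n n'
  proof -
    have "1 / real (Suc n') \<le> 1 / real (Suc n)" using that by (simp add: frac_le)
    then show ?thesis by (auto simp: C_def intro: order_trans)
  qed
  ultimately have "(\<Inter>n. C (m + 1 / real (Suc n))) \<noteq> {}"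
    using compact_nest[of "\<lambda>n. C (m + 1 / real (Suc n))"] compC by blast
  then obtain x where x: "\<And>n. x \<in> C (m + 1 / real (Suc n))" by blast
  have \<alpha>x: "\<alpha> x = \<alpha> x0" using x[of 0] by (simp add: C_def)
  have xm: "norm (\<rho> b x) \<le> m" for b
  proof (rule field_le_epsilon)
    fix \<epsilon> :: real assume "\<epsilon> > 0"
    then obtain n where "inverse (real (Suc n)) < \<epsilon>" using reals_Archimedean by blast
    then show "norm (\<rho> b x) \<le> m + \<epsilon>" using x[of n] by (auto simp: C_def inverse_eq_divide intro: order_trans)
  qed
  \<comment> \<open>Otherwise the midpoint of x and its image, two minimisers, has invariant norm
    below \<open>m\<close> by the parallelogram law. The inequality stays strict because it is read
    at a b where the supremum for the midpoint is attained.\<close>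
  have "\<rho> a x = x" for a
  proof (rule ccontr)
    assume ne: "\<rho> a x \<noteq> x"
    define y where "y = \<rho> a x"
    have ym: "norm (\<rho> b y) \<le> m" for b using mult[of b a] xm by (auto simp: y_def)
    define z where "z = (1/2) *\<^sub>R (x + y)"
    have \<alpha>z: "\<alpha> z = \<alpha> x0" by (simp add: z_def y_def linear_add[OF \<alpha>(1)] linear_cmul[OF \<alpha>(1)] \<alpha>(2) \<alpha>x)
    obtain b where b: "\<And>b'. norm (\<rho> b' z) \<le> norm (\<rho> b z)" using att by blast
    have "norm (\<rho> b z) \<in> R" using b \<alpha>z by (auto simp: R_def C_def)
    then have le: "m \<le> norm (\<rho> b z)" unfolding m_def by (rule cInf_lower[OF _ bdd])
    have "\<rho> b (x - y) \<noteq> 0" using inj[of b "x - y"] ne by (auto simp: y_def)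
    then have pos: "norm (\<rho> b x - \<rho> b y) > 0" by (simp add: linear_diff[OF lin])
    have "\<rho> b z = (1/2) *\<^sub>R (\<rho> b x + \<rho> b y)" by (simp add: z_def linear_add[OF lin] linear_cmul[OF lin])
    then have "4 * (norm (\<rho> b z))\<^sup>2 = (norm (\<rho> b x + \<rho> b y))\<^sup>2" by (simp add: power_divide)
    also have "\<dots> = 2 * (norm (\<rho> b x))\<^sup>2 + 2 * (norm (\<rho> b y))\<^sup>2 - (norm (\<rho> b x - \<rho> b y))\<^sup>2"
      by (simp add: power2_norm_eq_inner algebra_simps inner_commute)
    also have "\<dots> < 2 * (norm (\<rho> b x))\<^sup>2 + 2 * (norm (\<rho> b y))\<^sup>2" using pos by simp
    also have "\<dots> \<le> 2 * m\<^sup>2 + 2 * m\<^sup>2" using xm ym by (intro add_mono mult_left_mono power_mono) auto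
    finally have "(norm (\<rho> b z))\<^sup>2 < m\<^sup>2" by simp
    moreover have "0 \<le> m" using xm[of e] norm_ge_zero order_trans by blast
    ultimately show False using le by (meson not_le power_mono)
  qed
  then show ?thesis using \<alpha>x \<alpha>(3) by (intro exI[of _ x]) auto
qed

section \<open>Smooth maps between manifolds\<close>

lemma smooth_atlasD:
  assumes "smooth_atlas A" "(U, \<phi>) \<in> A"
  shows "open U" "open (\<phi> ` U)" "continuous_on U \<phi>" "continuous_on (\<phi> ` U) (inv_into U \<phi>)" "inj_on \<phi> U"
proof -
  have *: "open U \<and> open (\<phi> ` U) \<and> homeomorphism U (\<phi> ` U) \<phi> (inv_into U \<phi>)"
    using assms unfolding smooth_atlas_def by blast
  then show "open U" "open (\<phi> ` U)" "continuous_on U \<phi>" "continuous_on (\<phi> ` U) (inv_into U \<phi>)"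
    by (auto simp: homeomorphism_def)
  show "inj_on \<phi> U" using * by (metis homeomorphism_apply1 inj_on_inverseI)
qed

lemma smooth_atlas_transition:
  "smooth_atlas A \<Longrightarrow> (U, \<phi>) \<in> A \<Longrightarrow> (V, \<psi>) \<in> A \<Longrightarrow> smooth_on (\<phi> ` (U \<inter> V)) (\<psi> \<circ> inv_into U \<phi>)"
  unfolding smooth_atlas_def by blast

lemma smooth_atlas_covers:
  assumes "smooth_atlas A"
  obtains U \<phi> where "(U, \<phi>) \<in> A" "p \<in> U"
proof -
  have "p \<in> (\<Union>(U, \<phi>)\<in>A. U)" using assms by (simp add: smooth_atlas_def)
  then show thesis using that by auto
qed

lemma open_chart_image:
  assumes "smooth_atlas A" "(U, \<phi>) \<in> A" "open W"
  shows "open (\<phi> ` (U \<inter> W))"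
proof -
  have "\<phi> ` (U \<inter> W) = \<phi> ` U \<inter> inv_into U \<phi> -` W"
    using smooth_atlasD(5)[OF assms(1,2)] by (auto simp: inv_into_f_f f_inv_into_f)
  then show ?thesis
    using continuous_open_preimage[OF smooth_atlasD(4,2)[OF assms(1,2)] assms(3)] by simp
qed

lemma open_chart_preimage:
  "smooth_atlas A \<Longrightarrow> (U, \<phi>) \<in> A \<Longrightarrow> open T \<Longrightarrow> open (U \<inter> \<phi> -` T)"
  by (rule continuous_open_preimage[OF smooth_atlasD(3,1)])

lemma smooth_fun_chart:
  "smooth_fun A f \<Longrightarrow> (U, \<phi>) \<in> A \<Longrightarrow> smooth_on (\<phi> ` U) (f \<circ> inv_into U \<phi>)"
  unfolding smooth_fun_def by blast

text \<open>One chart near each point is enough, since any other chart differs from it by a smooth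
  transition map.\<close>

lemma smooth_fun_localI:
  assumes A: "smooth_atlas A"
    and loc: "\<And>p. \<exists>U \<phi> W. (U, \<phi>) \<in> A \<and> open W \<and> p \<in> W \<and> W \<subseteq> U \<and> smooth_on (\<phi> ` W) (f \<circ> inv_into U \<phi>)"
  shows "smooth_fun A f"
  unfolding smooth_fun_def
proof (intro ballI, clarify)
  fix V \<psi> assume V: "(V, \<psi>) \<in> A"
  show "smooth_on (\<psi> ` V) (f \<circ> inv_into V \<psi>)"
  proof (rule smooth_on_local)
    fix y assume "y \<in> \<psi> ` V"
    then obtain x where x: "x \<in> V" "y = \<psi> x" by blast
    obtain U \<phi> W where U: "(U, \<phi>) \<in> A" "open W" "x \<in> W" "W \<subseteq> U" "smooth_on (\<phi> ` W) (f \<circ> inv_into U \<phi>)"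
      using loc by blast
    have oW: "open (\<phi> ` W)" using open_chart_image[OF A U(1,2)] U(4) by (simp add: Int_absorb1)
    let ?T = "\<psi> ` (V \<inter> W)"
    have oT: "open ?T" by (rule open_chart_image[OF A V U(2)])
    have "smooth_on ?T (\<lambda>z. (f \<circ> inv_into U \<phi>) ((\<phi> \<circ> inv_into V \<psi>) z))"
    proof (rule smooth_on_compose[OF oT oW _ U(5)])
      show "smooth_on ?T (\<phi> \<circ> inv_into V \<psi>)"
        by (rule smooth_on_subset[OF smooth_atlas_transition[OF A V U(1)]]) (use U(4) in blast)
      show "(\<phi> \<circ> inv_into V \<psi>) ` ?T \<subseteq> \<phi> ` W"
        using smooth_atlasD(5)[OF A V] by (auto simp: inv_into_f_f)
    qed
    moreover have "(f \<circ> inv_into U \<phi>) ((\<phi> \<circ> inv_into V \<psi>) z) = (f \<circ> inv_into V \<psi>) z" if "z \<in> ?T" for z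
      using that U(4) smooth_atlasD(5)[OF A V] smooth_atlasD(5)[OF A U(1)] by (auto simp: inv_into_f_f subset_iff)
    ultimately have "smooth_on ?T (f \<circ> inv_into V \<psi>)" by (rule smooth_on_eq[OF oT])
    then show "\<exists>T. open T \<and> y \<in> T \<and> smooth_on T (f \<circ> inv_into V \<psi>)" using oT x U(3) by blast
  qed
qed

lemma smooth_fun_continuous:
  assumes A: "smooth_atlas A" and f: "smooth_fun A f"
  shows "continuous_on UNIV f"
proof -
  have "isCont f p" for p
  proof -
    obtain U \<phi> where U: "(U, \<phi>) \<in> A" "p \<in> U" using smooth_atlas_covers[OF A] .
    note cd = smooth_atlasD[OF A U(1)]
    have "continuous_on U (\<lambda>q. (f \<circ> inv_into U \<phi>) (\<phi> q))"
      by (rule continuous_on_compose2[OF smooth_on_continuous[OF smooth_fun_chart[OF f U(1)]] cd(3)]) auto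
    then have "continuous_on U f"
      by (rule continuous_on_eq) (simp add: inv_into_f_f[OF cd(5)])
    then show ?thesis using cd(1) U(2) by (simp add: continuous_on_eq_continuous_at)
  qed
  then show ?thesis by (simp add: continuous_on_eq_continuous_at)
qed

lemma smooth_fun_const: "smooth_fun A (\<lambda>p. c)"
  unfolding smooth_fun_def by (auto simp: o_def smooth_on_const)

lemma smooth_fun_add:
  assumes "smooth_atlas A" "smooth_fun A f" "smooth_fun A g"
  shows "smooth_fun A (\<lambda>p. f p + g p)"
proof -
  have "smooth_on (\<phi> ` U) ((\<lambda>p. f p + g p) \<circ> inv_into U \<phi>)" if "(U, \<phi>) \<in> A" for U \<phi>
    using smooth_on_add[OF smooth_atlasD(2)[OF assms(1) that] smooth_fun_chart[OF assms(2) that]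
        smooth_fun_chart[OF assms(3) that]] by (simp add: o_def)
  then show ?thesis by (auto simp: smooth_fun_def)
qed

lemma smooth_fun_mult:
  assumes "smooth_atlas A" "smooth_fun A f" "smooth_fun A g"
  shows "smooth_fun A (\<lambda>p. f p * g p)"
proof -
  have "smooth_on (\<phi> ` U) ((\<lambda>p. f p * g p) \<circ> inv_into U \<phi>)" if "(U, \<phi>) \<in> A" for U \<phi>
    using smooth_on_mult[OF smooth_atlasD(2)[OF assms(1) that] smooth_fun_chart[OF assms(2) that]
        smooth_fun_chart[OF assms(3) that]] by (simp add: o_def)
  then show ?thesis by (auto simp: smooth_fun_def)
qed

lemma smooth_fun_cmult: "smooth_atlas A \<Longrightarrow> smooth_fun A f \<Longrightarrow> smooth_fun A (\<lambda>p. c * f p)"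
  using smooth_fun_mult[OF _ smooth_fun_const] .

lemma smooth_fun_diff:
  "smooth_atlas A \<Longrightarrow> smooth_fun A f \<Longrightarrow> smooth_fun A g \<Longrightarrow> smooth_fun A (\<lambda>p. f p - g p)"
  using smooth_fun_add[of A f "\<lambda>p. (-1) * g p"] smooth_fun_cmult[of A g "-1"] by simp

lemma smooth_fun_sum:
  "smooth_atlas A \<Longrightarrow> (\<And>i. i \<in> I \<Longrightarrow> smooth_fun A (f i)) \<Longrightarrow> smooth_fun A (\<lambda>p. \<Sum>i\<in>I. f i p)"
  by (induction I rule: infinite_finite_induct) (auto simp: smooth_fun_const intro!: smooth_fun_add)

lemma smooth_mapD:
  assumes "smooth_map A B F"
  shows "continuous_on UNIV F"
    "(U, \<phi>) \<in> A \<Longrightarrow> (V, \<psi>) \<in> B \<Longrightarrow> smooth_on (\<phi> ` (U \<inter> F -` V)) (\<psi> \<circ> F \<circ> inv_into U \<phi>)"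
  using assms unfolding smooth_map_def by blast+

lemma smooth_fun_compose:
  assumes A: "smooth_atlas A" and B: "smooth_atlas B" and F: "smooth_map A B F" and f: "smooth_fun B f"
  shows "smooth_fun A (\<lambda>p. f (F p))"
proof (rule smooth_fun_localI[OF A])
  fix p
  obtain U \<phi> where U: "(U, \<phi>) \<in> A" "p \<in> U" using smooth_atlas_covers[OF A] .
  obtain V \<psi> where V: "(V, \<psi>) \<in> B" "F p \<in> V" using smooth_atlas_covers[OF B] .
  note cU = smooth_atlasD[OF A U(1)] and cV = smooth_atlasD[OF B V(1)]
  let ?W = "U \<inter> F -` V"
  have oF: "open (F -` V)" using smooth_mapD(1)[OF F] cV(1) open_vimage by blast
  have oT: "open (\<phi> ` ?W)" by (rule open_chart_image[OF A U(1) oF])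
  have "smooth_on (\<phi> ` ?W) (\<lambda>z. (f \<circ> inv_into V \<psi>) ((\<psi> \<circ> F \<circ> inv_into U \<phi>) z))"
    by (rule smooth_on_compose[OF oT cV(2) _ smooth_fun_chart[OF f V(1)] smooth_mapD(2)[OF F U(1) V(1)]])
      (auto simp: inv_into_f_f[OF cU(5)])
  moreover have "(f \<circ> inv_into V \<psi>) ((\<psi> \<circ> F \<circ> inv_into U \<phi>) z) = ((\<lambda>p. f (F p)) \<circ> inv_into U \<phi>) z"
    if "z \<in> \<phi> ` ?W" for z
    using that by (auto simp: inv_into_f_f[OF cU(5)] inv_into_f_f[OF cV(5)])
  ultimately have "smooth_on (\<phi> ` ?W) ((\<lambda>p. f (F p)) \<circ> inv_into U \<phi>)" by (rule smooth_on_eq[OF oT])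
  then show "\<exists>U \<phi> W. (U, \<phi>) \<in> A \<and> open W \<and> p \<in> W \<and> W \<subseteq> U \<and> smooth_on (\<phi> ` W) ((\<lambda>p. f (F p)) \<circ> inv_into U \<phi>)"
    using U V(2) oF cU(1) by (metis IntI Int_lower1 open_Int vimageI2)
qed

text \<open>Smoothness is checked near a single point, so that one chart of the middle manifold,
  around the image of that point, can be inserted between the two maps.\<close>

lemma smooth_map_compose:
  fixes A :: "('m::{t2_space,second_countable_topology}, 'e::euclidean_space) atlas"
    and B :: "('n::{t2_space,second_countable_topology}, 'f::euclidean_space) atlas"
    and C :: "('k::{t2_space,second_countable_topology}, 'h::euclidean_space) atlas"
  assumes A: "smooth_atlas A" and B: "smooth_atlas B" and C: "smooth_atlas C"
    and F: "smooth_map A B F" and H: "smooth_map B C H"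
  shows "smooth_map A C (\<lambda>p. H (F p))"
  unfolding smooth_map_def
proof (intro conjI ballI, goal_cases)
  case 1
  show ?case by (rule continuous_on_compose2[OF smooth_mapD(1)[OF H] smooth_mapD(1)[OF F]]) auto
next
  case (2 c)
  obtain U \<phi> where c: "c = (U, \<phi>)" by (cases c)
  have U: "(U, \<phi>) \<in> A" using 2 c by simp
  show ?case unfolding c prod.case
  proof (intro ballI, clarify)
    fix W \<chi>' assume W: "(W, \<chi>') \<in> C"
    note cU = smooth_atlasD[OF A U] and cW = smooth_atlasD[OF C W]
    show "smooth_on (\<phi> ` (U \<inter> (\<lambda>p. H (F p)) -` W)) (\<chi>' \<circ> (\<lambda>p. H (F p)) \<circ> inv_into U \<phi>)"
    proof (rule smooth_on_local)
      fix y assume "y \<in> \<phi> ` (U \<inter> (\<lambda>p. H (F p)) -` W)"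
      then obtain x where x: "y = \<phi> x" "x \<in> U" "H (F x) \<in> W" by blast
      obtain V \<psi> where V: "(V, \<psi>) \<in> B" "F x \<in> V" using smooth_atlas_covers[OF B] .
      note cV = smooth_atlasD[OF B V(1)]
      have oH: "open (H -` W)" using smooth_mapD(1)[OF H] cW(1) open_vimage by blast
      have oF: "open (F -` (V \<inter> H -` W))" using smooth_mapD(1)[OF F] cV(1) oH open_vimage by blast
      let ?T = "\<phi> ` (U \<inter> F -` (V \<inter> H -` W))"
      have oT: "open ?T" by (rule open_chart_image[OF A U oF])
      have "smooth_on ?T (\<lambda>z. (\<chi>' \<circ> H \<circ> inv_into V \<psi>) ((\<psi> \<circ> F \<circ> inv_into U \<phi>) z))"
      proof (rule smooth_on_compose[OF oT open_chart_image[OF B V(1) oH] _ smooth_mapD(2)[OF H V(1) W]])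
        show "smooth_on ?T (\<psi> \<circ> F \<circ> inv_into U \<phi>)"
          by (rule smooth_on_subset[OF smooth_mapD(2)[OF F U V(1)]]) blast
      qed (auto simp: inv_into_f_f[OF cU(5)])
      moreover have "(\<chi>' \<circ> H \<circ> inv_into V \<psi>) ((\<psi> \<circ> F \<circ> inv_into U \<phi>) z) = (\<chi>' \<circ> (\<lambda>p. H (F p)) \<circ> inv_into U \<phi>) z"
        if "z \<in> ?T" for z
        using that by (auto simp: inv_into_f_f[OF cU(5)] inv_into_f_f[OF cV(5)])
      ultimately have "smooth_on ?T (\<chi>' \<circ> (\<lambda>p. H (F p)) \<circ> inv_into U \<phi>)" by (rule smooth_on_eq[OF oT])
      then show "\<exists>T. open T \<and> y \<in> T \<and> smooth_on T (\<chi>' \<circ> (\<lambda>p. H (F p)) \<circ> inv_into U \<phi>)"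
        using oT x V(2) by blast
    qed
  qed
qed

lemma smooth_map_ident: "smooth_atlas A \<Longrightarrow> smooth_map A A (\<lambda>x. x)"
  unfolding smooth_map_def using smooth_atlas_transition by (fastforce simp: o_def)

lemma smooth_map_const: "smooth_atlas B \<Longrightarrow> smooth_map A B (\<lambda>x. c)"
  unfolding smooth_map_def by (auto simp: o_def smooth_on_const)

section \<open>Product manifolds\<close>

lemma inv_into_map_prod:
  assumes "inj_on \<phi> U" "inj_on \<psi> V" "z \<in> \<phi> ` U \<times> \<psi> ` V"
  shows "inv_into (U \<times> V) (map_prod \<phi> \<psi>) z = (inv_into U \<phi> (fst z), inv_into V \<psi> (snd z))"
proof -
  obtain x y where "x \<in> U" "y \<in> V" "z = map_prod \<phi> \<psi> (x, y)" using assms(3) by auto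
  moreover have "inj_on (map_prod \<phi> \<psi>) (U \<times> V)" using assms(1,2) by (rule map_prod_inj_on)
  ultimately show ?thesis using assms(1,2) by (simp add: inv_into_f_f del: map_prod_simp)
qed

lemma prod_atlasI: "(U, \<phi>) \<in> A \<Longrightarrow> (V, \<psi>) \<in> B \<Longrightarrow> (U \<times> V, map_prod \<phi> \<psi>) \<in> prod_atlas A B"
  unfolding prod_atlas_def by blast

lemma prod_atlasE:
  assumes "c \<in> prod_atlas A B"
  obtains U \<phi> V \<psi> where "c = (U \<times> V, map_prod \<phi> \<psi>)" "(U, \<phi>) \<in> A" "(V, \<psi>) \<in> B"
  using assms unfolding prod_atlas_def by blast

lemma map_prod_image_Times: "map_prod \<phi> \<psi> ` (U \<times> V) = \<phi> ` U \<times> \<psi> ` V"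
  by force

lemma smooth_atlas_prod:
  fixes A :: "('m::{t2_space,second_countable_topology}, 'e::euclidean_space) atlas"
    and B :: "('n::{t2_space,second_countable_topology}, 'f::euclidean_space) atlas"
  assumes A: "smooth_atlas A" and B: "smooth_atlas B"
  shows "smooth_atlas (prod_atlas A B)"
  unfolding smooth_atlas_def
proof (intro conjI ballI, goal_cases)
  case 1
  have "\<exists>c\<in>prod_atlas A B. z \<in> fst c" for z
  proof -
    obtain U \<phi> where "(U, \<phi>) \<in> A" "fst z \<in> U" using smooth_atlas_covers[OF A] .
    moreover obtain V \<psi> where "(V, \<psi>) \<in> B" "snd z \<in> V" using smooth_atlas_covers[OF B] .
    ultimately show ?thesis
      by (intro bexI[of _ "(U \<times> V, map_prod \<phi> \<psi>)"] prod_atlasI) (auto simp: mem_Times_iff)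
  qed
  then show ?case by fastforce
next
  case (2 c)
  then obtain U \<phi> V \<psi> where c: "c = (U \<times> V, map_prod \<phi> \<psi>)" "(U, \<phi>) \<in> A" "(V, \<psi>) \<in> B" by (rule prod_atlasE)
  note cU = smooth_atlasD[OF A c(2)] and cV = smooth_atlasD[OF B c(3)]
  let ?i = "\<lambda>z. (inv_into U \<phi> (fst z), inv_into V \<psi> (snd z))"
  have i: "inv_into (U \<times> V) (map_prod \<phi> \<psi>) z = ?i z" if "z \<in> \<phi> ` U \<times> \<psi> ` V" for z
    using inv_into_map_prod[OF cU(5) cV(5) that] .
  have ci: "continuous_on (\<phi> ` U \<times> \<psi> ` V) ?i"
    by (intro continuous_on_Pair continuous_on_compose2[OF cU(4) continuous_on_fst[OF continuous_on_id]]
        continuous_on_compose2[OF cV(4) continuous_on_snd[OF continuous_on_id]]) auto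
  have cm: "continuous_on (U \<times> V) (map_prod \<phi> \<psi>)"
    unfolding map_prod_def split_beta
    by (intro continuous_on_Pair continuous_on_compose2[OF cU(3) continuous_on_fst[OF continuous_on_id]]
        continuous_on_compose2[OF cV(3) continuous_on_snd[OF continuous_on_id]]) auto
  have "homeomorphism (U \<times> V) (\<phi> ` U \<times> \<psi> ` V) (map_prod \<phi> \<psi>) (inv_into (U \<times> V) (map_prod \<phi> \<psi>))"
    unfolding homeomorphism_def
  proof (intro conjI ballI)
    show "continuous_on (\<phi> ` U \<times> \<psi> ` V) (inv_into (U \<times> V) (map_prod \<phi> \<psi>))"
      using ci by (rule continuous_on_eq) (simp add: i)
    show "inv_into (U \<times> V) (map_prod \<phi> \<psi>) ` (\<phi> ` U \<times> \<psi> ` V) = U \<times> V"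
      unfolding map_prod_image_Times[symmetric] by (simp add: map_prod_inj_on cU(5) cV(5))
  qed (use cm cU(5) cV(5) in \<open>auto simp: i inv_into_f_f map_prod_image_Times f_inv_into_f\<close>)
  then show ?case unfolding c(1) prod.case map_prod_image_Times
    using cU cV by (auto intro: open_Times)
next
  case (3 c)
  obtain U \<phi> V \<psi> where c: "c = (U \<times> V, map_prod \<phi> \<psi>)" "(U, \<phi>) \<in> A" "(V, \<psi>) \<in> B"
    using 3 prod_atlasE by metis
  note cU = smooth_atlasD[OF A c(2)] and cV = smooth_atlasD[OF B c(3)]
  show ?case unfolding c(1) prod.case
  proof (intro ballI, clarify)
    fix W \<zeta> assume "(W, \<zeta>) \<in> prod_atlas A B"
    then obtain U' \<phi>' V' \<psi>' where c': "W = U' \<times> V'" "\<zeta> = map_prod \<phi>' \<psi>'" "(U', \<phi>') \<in> A" "(V', \<psi>') \<in> B"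
      by (auto elim!: prod_atlasE)
    have im: "map_prod \<phi> \<psi> ` (U \<times> V \<inter> U' \<times> V') = \<phi> ` (U \<inter> U') \<times> \<psi> ` (V \<inter> V')"
      by (auto simp: Times_Int_Times map_prod_image_Times)
    have oU: "open (\<phi> ` (U \<inter> U'))" and oV: "open (\<psi> ` (V \<inter> V'))"
      using open_chart_image[OF A c(2)] open_chart_image[OF B c(3)] smooth_atlasD(1)[OF A c'(3)]
        smooth_atlasD(1)[OF B c'(4)] by blast+
    have o: "open (\<phi> ` (U \<inter> U') \<times> \<psi> ` (V \<inter> V'))" by (rule open_Times[OF oU oV])
    have "smooth_on (\<phi> ` (U \<inter> U') \<times> \<psi> ` (V \<inter> V'))
        (\<lambda>z. ((\<phi>' \<circ> inv_into U \<phi>) (fst z), (\<psi>' \<circ> inv_into V \<psi>) (snd z)))"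
      by (intro smooth_on_Pair o
          smooth_on_compose[OF o oU _ smooth_atlas_transition[OF A c(2) c'(3)] smooth_on_fst[OF o smooth_on_ident]]
          smooth_on_compose[OF o oV _ smooth_atlas_transition[OF B c(3) c'(4)] smooth_on_snd[OF o smooth_on_ident]])
        auto
    moreover have "((\<phi>' \<circ> inv_into U \<phi>) (fst z), (\<psi>' \<circ> inv_into V \<psi>) (snd z)) =
        (map_prod \<phi>' \<psi>' \<circ> inv_into (U \<times> V) (map_prod \<phi> \<psi>)) z" if "z \<in> \<phi> ` (U \<inter> U') \<times> \<psi> ` (V \<inter> V')" for z
    proof -
      have "z \<in> \<phi> ` U \<times> \<psi> ` V" using that by auto
      from inv_into_map_prod[OF cU(5) cV(5) this] show ?thesis by simp
    qed
    ultimately have "smooth_on (\<phi> ` (U \<inter> U') \<times> \<psi> ` (V \<inter> V')) (map_prod \<phi>' \<psi>' \<circ> inv_into (U \<times> V) (map_prod \<phi> \<psi>))"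
      by (rule smooth_on_eq[OF o])
    then show "smooth_on (map_prod \<phi> \<psi> ` (U \<times> V \<inter> W)) (\<zeta> \<circ> inv_into (U \<times> V) (map_prod \<phi> \<psi>))"
      unfolding c'(1,2) im .
  qed
qed

lemma smooth_map_Pair:
  assumes A: "smooth_atlas A" and BC: "smooth_atlas B" "smooth_atlas C"
    and F: "smooth_map A B F" and H: "smooth_map A C H"
  shows "smooth_map A (prod_atlas B C) (\<lambda>x. (F x, H x))"
  unfolding smooth_map_def
proof (intro conjI ballI, goal_cases)
  case 1
  show ?case by (intro continuous_on_Pair smooth_mapD(1)[OF F] smooth_mapD(1)[OF H])
next
  case (2 c)
  obtain U \<phi> where c: "c = (U, \<phi>)" by (cases c)
  have U: "(U, \<phi>) \<in> A" using 2 c by simp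
  show ?case unfolding c prod.case
  proof (intro ballI, clarify)
    fix W \<zeta> assume "(W, \<zeta>) \<in> prod_atlas B C"
    then obtain V \<psi> V' \<psi>' where W: "W = V \<times> V'" "\<zeta> = map_prod \<psi> \<psi>'" "(V, \<psi>) \<in> B" "(V', \<psi>') \<in> C"
      by (auto elim!: prod_atlasE)
    let ?T = "\<phi> ` (U \<inter> (\<lambda>x. (F x, H x)) -` (V \<times> V'))"
    have "open ((\<lambda>x. (F x, H x)) -` (V \<times> V'))"
      using open_vimage[OF smooth_atlasD(1)[OF BC(1) W(3)] smooth_mapD(1)[OF F]]
        open_vimage[OF smooth_atlasD(1)[OF BC(2) W(4)] smooth_mapD(1)[OF H]]
      by (simp add: vimage_def Collect_conj_eq open_Int)
    then have o: "open ?T" by (rule open_chart_image[OF A U])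
    have "smooth_on ?T (\<lambda>x. ((\<psi> \<circ> F \<circ> inv_into U \<phi>) x, (\<psi>' \<circ> H \<circ> inv_into U \<phi>) x))"
      by (intro smooth_on_Pair o smooth_on_subset[OF smooth_mapD(2)[OF F U W(3)]]
          smooth_on_subset[OF smooth_mapD(2)[OF H U W(4)]]) auto
    then show "smooth_on (\<phi> ` (U \<inter> (\<lambda>x. (F x, H x)) -` W)) (\<zeta> \<circ> (\<lambda>x. (F x, H x)) \<circ> inv_into U \<phi>)"
      unfolding W(1,2) by (simp add: o_def)
  qed
qed

lemma smooth_map_fst:
  assumes A: "smooth_atlas A" and B: "smooth_atlas B"
  shows "smooth_map (prod_atlas A B) A fst"
  unfolding smooth_map_def
proof (intro conjI ballI, goal_cases)
  case 1
  show ?case by (intro continuous_intros)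
next
  case (2 c)
  then obtain U \<phi> V \<psi> where c: "c = (U \<times> V, map_prod \<phi> \<psi>)" "(U, \<phi>) \<in> A" "(V, \<psi>) \<in> B" by (rule prod_atlasE)
  note cU = smooth_atlasD[OF A c(2)] and cV = smooth_atlasD[OF B c(3)]
  show ?case unfolding c prod.case
  proof (intro ballI, clarify)
    fix U' \<phi>' assume U': "(U', \<phi>') \<in> A"
    have im: "map_prod \<phi> \<psi> ` (U \<times> V \<inter> fst -` U') = \<phi> ` (U \<inter> U') \<times> \<psi> ` V"
      by force
    have oU: "open (\<phi> ` (U \<inter> U'))" using open_chart_image[OF A c(2) smooth_atlasD(1)[OF A U']] .
    have o: "open (\<phi> ` (U \<inter> U') \<times> \<psi> ` V)" by (rule open_Times[OF oU cV(2)])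
    have "smooth_on (\<phi> ` (U \<inter> U') \<times> \<psi> ` V) (\<lambda>z. (\<phi>' \<circ> inv_into U \<phi>) (fst z))"
      by (intro smooth_on_compose[OF o oU _ smooth_atlas_transition[OF A c(2) U'] smooth_on_fst[OF o smooth_on_ident]]) auto
    moreover have "(\<phi>' \<circ> inv_into U \<phi>) (fst z) = (\<phi>' \<circ> fst \<circ> inv_into (U \<times> V) (map_prod \<phi> \<psi>)) z"
      if "z \<in> \<phi> ` (U \<inter> U') \<times> \<psi> ` V" for z
    proof -
      have "z \<in> \<phi> ` U \<times> \<psi> ` V" using that by auto
      from inv_into_map_prod[OF cU(5) cV(5) this] show ?thesis by simp
    qed
    ultimately show "smooth_on (map_prod \<phi> \<psi> ` (U \<times> V \<inter> fst -` U')) (\<phi>' \<circ> fst \<circ> inv_into (U \<times> V) (map_prod \<phi> \<psi>))"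
      unfolding im by (rule smooth_on_eq[OF o])
  qed
qed

lemma smooth_map_snd:
  assumes A: "smooth_atlas A" and B: "smooth_atlas B"
  shows "smooth_map (prod_atlas A B) B snd"
  unfolding smooth_map_def
proof (intro conjI ballI, goal_cases)
  case 1
  show ?case by (intro continuous_intros)
next
  case (2 c)
  then obtain U \<phi> V \<psi> where c: "c = (U \<times> V, map_prod \<phi> \<psi>)" "(U, \<phi>) \<in> A" "(V, \<psi>) \<in> B" by (rule prod_atlasE)
  note cU = smooth_atlasD[OF A c(2)] and cV = smooth_atlasD[OF B c(3)]
  show ?case unfolding c prod.case
  proof (intro ballI, clarify)
    fix V' \<psi>' assume V': "(V', \<psi>') \<in> B"
    have im: "map_prod \<phi> \<psi> ` (U \<times> V \<inter> snd -` V') = \<phi> ` U \<times> \<psi> ` (V \<inter> V')"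
      by force
    have oV: "open (\<psi> ` (V \<inter> V'))" using open_chart_image[OF B c(3) smooth_atlasD(1)[OF B V']] .
    have o: "open (\<phi> ` U \<times> \<psi> ` (V \<inter> V'))" by (rule open_Times[OF cU(2) oV])
    have "smooth_on (\<phi> ` U \<times> \<psi> ` (V \<inter> V')) (\<lambda>z. (\<psi>' \<circ> inv_into V \<psi>) (snd z))"
      by (intro smooth_on_compose[OF o oV _ smooth_atlas_transition[OF B c(3) V'] smooth_on_snd[OF o smooth_on_ident]]) auto
    moreover have "(\<psi>' \<circ> inv_into V \<psi>) (snd z) = (\<psi>' \<circ> snd \<circ> inv_into (U \<times> V) (map_prod \<phi> \<psi>)) z"
      if "z \<in> \<phi> ` U \<times> \<psi> ` (V \<inter> V')" for z
    proof -
      have "z \<in> \<phi> ` U \<times> \<psi> ` V" using that by auto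
      from inv_into_map_prod[OF cU(5) cV(5) this] show ?thesis by simp
    qed
    ultimately show "smooth_on (map_prod \<phi> \<psi> ` (U \<times> V \<inter> snd -` V')) (\<psi>' \<circ> snd \<circ> inv_into (U \<times> V) (map_prod \<phi> \<psi>))"
      unfolding im by (rule smooth_on_eq[OF o])
  qed
qed

section \<open>Tangent vectors in coordinates\<close>

text \<open>Over \<open>T\<close> the function is a product of smooth functions, and off the
  preimage of \<open>K\<close> it is zero. Both regions are open, the second because that preimage
  is compact and hence closed in a Hausdorff space, and together they cover the manifold.\<close>

lemma smooth_bump_extension:
  fixes A :: "('m::{t2_space,second_countable_topology}, 'e::euclidean_space) atlas"
  assumes A: "smooth_atlas A" and U: "(U, \<phi>) \<in> A" and T: "open T" "T \<subseteq> \<phi> ` U"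
    and b: "smooth_on UNIV b" and K: "compact K" "K \<subseteq> T" "\<And>z. z \<notin> K \<Longrightarrow> b z = 0"
    and g: "smooth_on T g"
  shows "smooth_fun A (\<lambda>q. if q \<in> U then b (\<phi> q) * g (\<phi> q) else 0)" (is "smooth_fun A ?F")
proof (rule smooth_fun_localI[OF A])
  fix p
  note cU = smooth_atlasD[OF A U]
  show "\<exists>U' \<phi>' W. (U', \<phi>') \<in> A \<and> open W \<and> p \<in> W \<and> W \<subseteq> U' \<and> smooth_on (\<phi>' ` W) (?F \<circ> inv_into U' \<phi>')"
  proof (cases "p \<in> U \<and> \<phi> p \<in> T")
    case True
    let ?W = "U \<inter> \<phi> -` T"
    have im: "\<phi> ` ?W = T" using T(2) by auto
    have "smooth_on T (\<lambda>z. b z * g z)" by (intro smooth_on_mult T(1) g smooth_on_subset[OF b]) auto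
    moreover have "b z * g z = (?F \<circ> inv_into U \<phi>) z" if "z \<in> T" for z
    proof -
      have "z \<in> \<phi> ` U" using that T(2) by blast
      then show ?thesis by (simp add: f_inv_into_f inv_into_into)
    qed
    ultimately have "smooth_on T (?F \<circ> inv_into U \<phi>)" by (rule smooth_on_eq[OF T(1)])
    then have "smooth_on (\<phi> ` ?W) (?F \<circ> inv_into U \<phi>)" by (simp only: im)
    moreover have "open ?W" by (rule open_chart_preimage[OF A U T(1)])
    ultimately show ?thesis using U True by blast
  next
    case False
    let ?L = "inv_into U \<phi> ` K"
    have KU: "K \<subseteq> \<phi> ` U" using K(2) T(2) by blast
    have "compact ?L" using K(1) continuous_on_subset[OF cU(4) KU] by (intro compact_continuous_image)
    then have "closed ?L" by (rule compact_imp_closed)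
    obtain V \<psi> where V: "(V, \<psi>) \<in> A" "p \<in> V" using smooth_atlas_covers[OF A] .
    have pL: "p \<notin> ?L"
    proof
      assume "p \<in> ?L"
      then obtain z where z: "z \<in> K" "p = inv_into U \<phi> z" by blast
      then have "p \<in> U" "\<phi> p = z" using KU by (auto simp: inv_into_into f_inv_into_f subset_iff)
      then show False using False z K(2) by blast
    qed
    have zero: "?F q = 0" if "q \<notin> ?L" for q
      using that K(3) cU(5) by (metis image_eqI inv_into_f_f mult_zero_left)
    let ?W = "V \<inter> - ?L"
    have oW: "open ?W" using smooth_atlasD(1)[OF A V(1)] \<open>closed ?L\<close> by auto
    have o: "open (\<psi> ` ?W)" using open_chart_image[OF A V(1), of "- ?L"] \<open>closed ?L\<close> by auto
    have "smooth_on (\<psi> ` ?W) (?F \<circ> inv_into V \<psi>)"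
    proof (rule smooth_on_eq[OF o smooth_on_const[where c=0]])
      fix z assume "z \<in> \<psi> ` ?W"
      then obtain q where q: "z = \<psi> q" "q \<in> V" "q \<notin> ?L" by blast
      then have "inv_into V \<psi> z = q" using smooth_atlasD(5)[OF A V(1)] by simp
      then show "0 = (?F \<circ> inv_into V \<psi>) z" using zero[OF q(3)] by (simp only: o_def)
    qed
    then show ?thesis using V oW pL by blast
  qed
qed

lemma tangent_spaceD:
  assumes "u \<in> tangent_space A p"
  shows "\<not> smooth_fun A f \<Longrightarrow> u f = 0"
    "smooth_fun A f \<Longrightarrow> smooth_fun A h \<Longrightarrow> u (\<lambda>q. f q + h q) = u f + u h"
    "smooth_fun A f \<Longrightarrow> u (\<lambda>q. c * f q) = c * u f"
    "smooth_fun A f \<Longrightarrow> smooth_fun A h \<Longrightarrow> u (\<lambda>q. f q * h q) = u f * h p + f p * u h"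
  using assms unfolding tangent_space_def by (auto simp: plus_fun_def times_fun_def scaleR_fun_def)

lemma tangent_spaceI:
  assumes "\<And>f. \<not> smooth_fun A f \<Longrightarrow> u f = 0"
    "\<And>f h. smooth_fun A f \<Longrightarrow> smooth_fun A h \<Longrightarrow> u (\<lambda>q. f q + h q) = u f + u h"
    "\<And>c f. smooth_fun A f \<Longrightarrow> u (\<lambda>q. c * f q) = c * u f"
    "\<And>f h. smooth_fun A f \<Longrightarrow> smooth_fun A h \<Longrightarrow> u (\<lambda>q. f q * h q) = u f * h p + f p * u h"
  shows "u \<in> tangent_space A p"
  using assms unfolding tangent_space_def by (auto simp: plus_fun_def times_fun_def scaleR_fun_def)

text \<open>Tangent vectors vanish on functions that are not smooth by convention, so nothing has to
  be compared there.\<close>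

lemma tangent_eqI:
  assumes "u \<in> tangent_space A p" "v \<in> tangent_space A q" "\<And>f. smooth_fun A f \<Longrightarrow> u f = v f"
  shows "u = v"
proof
  fix f show "u f = v f"
    using assms tangent_spaceD(1)[OF assms(1), of f] tangent_spaceD(1)[OF assms(2), of f] by (cases "smooth_fun A f") auto
qed

lemma tangent_const: "u \<in> tangent_space A p \<Longrightarrow> u (\<lambda>q. c) = 0"
proof -
  assume u: "u \<in> tangent_space A p"
  have "u (\<lambda>q. 1 * 1) = u (\<lambda>q. 1) * 1 + 1 * u (\<lambda>q. 1)" by (rule tangent_spaceD(4)[OF u smooth_fun_const smooth_fun_const])
  then have "u (\<lambda>q. 1) = 0" by simp
  then show ?thesis using tangent_spaceD(3)[OF u smooth_fun_const, of c 1] by simp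
qed

lemma tangent_diff:
  assumes "smooth_atlas A" "u \<in> tangent_space A p" "smooth_fun A f" "smooth_fun A h"
  shows "u (\<lambda>q. f q - h q) = u f - u h"
  using tangent_spaceD(2)[OF assms(2,3) smooth_fun_cmult[OF assms(1,4), of "-1"]]
    tangent_spaceD(3)[OF assms(2,4), of "-1"] by simp

lemma tangent_minus:
  assumes "u \<in> tangent_space A p" "smooth_fun A h"
  shows "u (\<lambda>q. - h q) = - u h"
  using tangent_spaceD(3)[OF assms, of "-1"] by simp

lemma tangent_sum:
  assumes A: "smooth_atlas A" and u: "u \<in> tangent_space A p" and f: "\<And>i. i \<in> I \<Longrightarrow> smooth_fun A (f i)"
  shows "u (\<lambda>q. \<Sum>i\<in>I. f i q) = (\<Sum>i\<in>I. u (f i))"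
  using f
proof (induction I rule: infinite_finite_induct)
  case (insert i I)
  then show ?case using tangent_spaceD(2)[OF u, of "f i" "\<lambda>q. \<Sum>i\<in>I. f i q"] smooth_fun_sum[OF A, of I f] by simp
qed (simp_all add: tangent_const[OF u])

lemma tangent_space_zero: "0 \<in> tangent_space A p"
  by (rule tangent_spaceI) auto

lemma tangent_space_add:
  "u \<in> tangent_space A p \<Longrightarrow> v \<in> tangent_space A p \<Longrightarrow> u + v \<in> tangent_space A p"
  by (rule tangent_spaceI) (auto simp: tangent_spaceD algebra_simps)

lemma tangent_space_scaleR: "u \<in> tangent_space A p \<Longrightarrow> c *\<^sub>R u \<in> tangent_space A p"
  by (rule tangent_spaceI) (auto simp: tangent_spaceD algebra_simps scaleR_fun_def)

lemma tangent_space_sum: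
  "(\<And>i. i \<in> I \<Longrightarrow> u i \<in> tangent_space A p) \<Longrightarrow> (\<Sum>i\<in>I. u i) \<in> tangent_space A p"
  by (induction I rule: infinite_finite_induct) (auto intro: tangent_space_zero tangent_space_add)

lemma tangent_space_minus: "u \<in> tangent_space A p \<Longrightarrow> - u \<in> tangent_space A p"
  using tangent_space_scaleR[of u A p "-1"] by simp

lemma tangent_space_diff:
  "u \<in> tangent_space A p \<Longrightarrow> v \<in> tangent_space A p \<Longrightarrow> u - v \<in> tangent_space A p"
  using tangent_space_add[of u A p "- v"] tangent_space_minus[of v A p] by simp

lemma vector_fieldsD:
  "X \<in> vector_fields A \<Longrightarrow> X p \<in> tangent_space A p"
  "X \<in> vector_fields A \<Longrightarrow> smooth_fun A f \<Longrightarrow> smooth_fun A (\<lambda>p. X p f)"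
  unfolding vector_fields_def by auto

lemma vector_fieldsI:
  "(\<And>p. X p \<in> tangent_space A p) \<Longrightarrow> (\<And>f. smooth_fun A f \<Longrightarrow> smooth_fun A (\<lambda>p. X p f)) \<Longrightarrow> X \<in> vector_fields A"
  unfolding vector_fields_def by auto

lemma vector_fields_lincomb:
  assumes A: "smooth_atlas A" and X: "\<And>i. i \<in> I \<Longrightarrow> X i \<in> vector_fields A"
  shows "(\<lambda>p. \<Sum>i\<in>I. c i *\<^sub>R X i p) \<in> vector_fields A"
proof (rule vector_fieldsI)
  show "(\<Sum>i\<in>I. c i *\<^sub>R X i p) \<in> tangent_space A p" for p
    by (intro tangent_space_sum tangent_space_scaleR vector_fieldsD(1) X)
  have "(\<Sum>i\<in>I. c i *\<^sub>R X i p) f = (\<Sum>i\<in>I. c i * X i p f)" for p f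
    by (induction I rule: infinite_finite_induct) (auto simp: scaleR_fun_def)
  then show "smooth_fun A (\<lambda>p. (\<Sum>i\<in>I. c i *\<^sub>R X i p) f)" if "smooth_fun A f" for f
    by (simp only:) (intro smooth_fun_sum A smooth_fun_cmult vector_fieldsD(2)[OF X that])
qed

text \<open>In the Leibniz rule the terms in which each field hits one factor occur in both orders
  and cancel.\<close>

lemma lie_bracket_vector_field:
  assumes A: "smooth_atlas A" and X: "X \<in> vector_fields A" and Y: "Y \<in> vector_fields A"
  shows "lie_bracket X Y \<in> vector_fields A"
proof (rule vector_fieldsI)
  note XD = tangent_spaceD[OF vector_fieldsD(1)[OF X]] and YD = tangent_spaceD[OF vector_fieldsD(1)[OF Y]]
  note XS = vector_fieldsD(2)[OF X] and YS = vector_fieldsD(2)[OF Y]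
  show "smooth_fun A f \<Longrightarrow> smooth_fun A (\<lambda>p. lie_bracket X Y p f)" for f
    unfolding lie_bracket_def by (intro smooth_fun_diff A XS YS)
  show "lie_bracket X Y p \<in> tangent_space A p" for p
  proof (rule tangent_spaceI)
    fix f :: "'a \<Rightarrow> real" assume "\<not> smooth_fun A f"
    then show "lie_bracket X Y p f = 0"
      by (simp add: lie_bracket_def XD(1) YD(1) tangent_const[OF vector_fieldsD(1)[OF X]] tangent_const[OF vector_fieldsD(1)[OF Y]])
  next
    fix f h :: "'a \<Rightarrow> real" assume f: "smooth_fun A f" and h: "smooth_fun A h"
    show "lie_bracket X Y p (\<lambda>q. f q + h q) = lie_bracket X Y p f + lie_bracket X Y p h"
      unfolding lie_bracket_def XD(2)[OF f h] YD(2)[OF f h] XD(2)[OF YS[OF f] YS[OF h]] YD(2)[OF XS[OF f] XS[OF h]]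
      by simp
    have "X p (\<lambda>q. Y q (\<lambda>q. f q * h q)) = X p (\<lambda>q. Y q f * h q) + X p (\<lambda>q. f q * Y q h)"
      unfolding YD(4)[OF f h] by (rule XD(2)[OF smooth_fun_mult[OF A YS[OF f] h] smooth_fun_mult[OF A f YS[OF h]]])
    moreover have "Y p (\<lambda>q. X q (\<lambda>q. f q * h q)) = Y p (\<lambda>q. X q f * h q) + Y p (\<lambda>q. f q * X q h)"
      unfolding XD(4)[OF f h] by (rule YD(2)[OF smooth_fun_mult[OF A XS[OF f] h] smooth_fun_mult[OF A f XS[OF h]]])
    ultimately show "lie_bracket X Y p (\<lambda>q. f q * h q) = lie_bracket X Y p f * h p + f p * lie_bracket X Y p h"
      unfolding lie_bracket_def XD(4)[OF YS[OF f] h] XD(4)[OF f YS[OF h]] YD(4)[OF XS[OF f] h] YD(4)[OF f XS[OF h]]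
      by (simp add: algebra_simps)
  next
    fix c and f :: "'a \<Rightarrow> real" assume f: "smooth_fun A f"
    show "lie_bracket X Y p (\<lambda>q. c * f q) = c * lie_bracket X Y p f"
      unfolding lie_bracket_def XD(3)[OF f] YD(3)[OF f] XD(3)[OF YS[OF f]] YD(3)[OF XS[OF f]] by (simp add: algebra_simps)
  qed
qed

text \<open>Coordinates around a point, cut off so that they and their coordinate fields are global.\<close>

definition coord_patch ::
    "('m, 'e::euclidean_space) atlas \<Rightarrow> 'm set \<Rightarrow> ('m \<Rightarrow> 'e) \<Rightarrow> 'e \<Rightarrow> real \<Rightarrow> ('e \<Rightarrow> 'm \<Rightarrow> real) \<Rightarrow>
      ('e \<Rightarrow> 'm vfield) \<Rightarrow> bool"
  where "coord_patch A U \<phi> y0 r x E \<longleftrightarrow> (U, \<phi>) \<in> A \<and> r > 0 \<and> ball y0 r \<subseteq> \<phi> ` U \<and>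
    (\<forall>i\<in>Basis. smooth_fun A (x i) \<and> E i \<in> vector_fields A) \<and>
    (\<forall>q\<in>U. \<phi> q \<in> ball y0 r \<longrightarrow> (\<forall>i\<in>Basis. x i q = \<phi> q \<bullet> i \<and>
      (\<forall>f. smooth_fun A f \<longrightarrow> E i q f = frechet_derivative (f \<circ> inv_into U \<phi>) (at (\<phi> q)) i)))"

lemma coord_patch_exists:
  fixes A :: "('m::{t2_space,second_countable_topology}, 'e::euclidean_space) atlas"
  assumes A: "smooth_atlas A" and U: "(U, \<phi>) \<in> A" "p \<in> U"
  shows "\<exists>r x E. coord_patch A U \<phi> (\<phi> p) r x E"
proof -
  note cU = smooth_atlasD[OF A U(1)]
  let ?y0 = "\<phi> p"
  have "?y0 \<in> \<phi> ` U" using U by blast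
  then obtain R where R: "R > 0" "ball ?y0 R \<subseteq> \<phi> ` U" using cU(2) openE by blast
  \<comment> \<open>The bump is 1 up to radius r and vanishes beyond 2r, and the closed ball of
    radius 2r must still lie in the chart image.\<close>
  define r where "r = R / 3"
  have r: "r > 0" "ball ?y0 R = ball ?y0 (3 * r)" using R by (simp_all add: r_def)
  obtain b :: "'e \<Rightarrow> real" where b: "smooth_on UNIV b" "\<And>z. z \<in> cball ?y0 r \<Longrightarrow> b z = 1" "\<And>z. z \<notin> ball ?y0 (2 * r) \<Longrightarrow> b z = 0"
    using smooth_plateau[OF r(1)] by metis
  have ext: "smooth_fun A (\<lambda>q. if q \<in> U then b (\<phi> q) * g (\<phi> q) else 0)" if "smooth_on (\<phi> ` U) g" for g
  proof (rule smooth_bump_extension[OF A U(1) cU(2) order_refl b(1) _ _ _ that])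
    show "compact (cball ?y0 (2 * r))" by simp
    show "cball ?y0 (2 * r) \<subseteq> \<phi> ` U" using R r by (auto simp: subset_iff)
    show "b z = 0" if "z \<notin> cball ?y0 (2 * r)" for z using that b(3) by auto
  qed
  define x where "x i q = (if q \<in> U then b (\<phi> q) * (\<phi> q \<bullet> i) else 0)" for i q
  \<comment> \<open>The outer case distinction makes \<open>E i q\<close> vanish on functions that
    are not smooth, as membership in the tangent space demands.\<close>
  define E where "E i q f = (if smooth_fun A f then if q \<in> U then
      b (\<phi> q) * frechet_derivative (f \<circ> inv_into U \<phi>) (at (\<phi> q)) i else 0 else 0)" for i q f
  have E: "E i \<in> vector_fields A" for i
  proof (rule vector_fieldsI)
    show "smooth_fun A (\<lambda>p. E i p f)" if "smooth_fun A f" for f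
      using ext[OF smooth_on_frechet_derivative[OF smooth_fun_chart[OF that U(1)]]] that by (simp add: E_def)
    show "E i q \<in> tangent_space A q" for q
    proof (cases "q \<in> U")
      case q: True
      have im: "\<phi> q \<in> \<phi> ` U" using q by blast
      note inv = inv_into_f_f[OF cU(5) q]
      note D = smooth_on_has_derivative[OF smooth_fun_chart[OF _ U(1)] im]
      show ?thesis
      proof (rule tangent_spaceI)
        fix f h :: "'m \<Rightarrow> real" assume f: "smooth_fun A f" and h: "smooth_fun A h"
        show "E i q (\<lambda>q. f q + h q) = E i q f + E i q h"
          using frechet_derivative_eqI[OF has_derivative_add[OF D[OF f] D[OF h]], of i] f h smooth_fun_add[OF A f h]
          by (simp add: E_def q o_def algebra_simps)
        show "E i q (\<lambda>q. f q * h q) = E i q f * h q + f q * E i q h"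
          using frechet_derivative_eqI[OF has_derivative_mult[OF D[OF f] D[OF h]], of i] f h smooth_fun_mult[OF A f h]
          by (simp add: E_def q o_def algebra_simps inv)
      next
        fix c and f :: "'m \<Rightarrow> real" assume f: "smooth_fun A f"
        show "E i q (\<lambda>q. c * f q) = c * E i q f"
          using frechet_derivative_eqI[OF has_derivative_mult_right[OF D[OF f], of c], of i] f smooth_fun_cmult[OF A f]
          by (simp add: E_def q o_def algebra_simps)
      qed (simp add: E_def)
    next
      case False
      then have "E i q = 0" by (auto simp: E_def fun_eq_iff)
      then show ?thesis by (simp add: tangent_space_zero)
    qed
  qed
  have "smooth_fun A (x i)" for i
    using ext[OF smooth_on_linear[OF bounded_linear_inner_left cU(2)], of i] by (simp add: x_def[abs_def])
  then have "coord_patch A U \<phi> ?y0 r x E"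
    unfolding coord_patch_def using U(1) r E R(2) b(2) by (auto simp: x_def E_def subset_iff)
  then show ?thesis by blast
qed

lemma coord_patchD:
  assumes "coord_patch A U \<phi> y0 r x E"
  shows "(U, \<phi>) \<in> A" "r > 0" "ball y0 r \<subseteq> \<phi> ` U"
    "i \<in> Basis \<Longrightarrow> smooth_fun A (x i)" "i \<in> Basis \<Longrightarrow> E i \<in> vector_fields A"
    "q \<in> U \<Longrightarrow> \<phi> q \<in> ball y0 r \<Longrightarrow> i \<in> Basis \<Longrightarrow> x i q = \<phi> q \<bullet> i"
    "q \<in> U \<Longrightarrow> \<phi> q \<in> ball y0 r \<Longrightarrow> i \<in> Basis \<Longrightarrow> smooth_fun A f \<Longrightarrow>
      E i q f = frechet_derivative (f \<circ> inv_into U \<phi>) (at (\<phi> q)) i"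
  using assms unfolding coord_patch_def by blast+

text \<open>
  By Hadamard's lemma a function is, up to second order, affine in the coordinates, so a derivation
  is determined by its values on them.
\<close>

lemma tangent_coord_formula:
  fixes A :: "('m::{t2_space,second_countable_topology}, 'e::euclidean_space) atlas"
  assumes A: "smooth_atlas A" and cp: "coord_patch A U \<phi> y0 r x E" and q: "q \<in> U" "\<phi> q \<in> ball y0 r"
    and u: "u \<in> tangent_space A q" and f: "smooth_fun A f"
  shows "u f = frechet_derivative (f \<circ> inv_into U \<phi>) (at (\<phi> q)) (\<Sum>i\<in>Basis. u (x i) *\<^sub>R i)"
proof -
  note P = coord_patchD[OF cp]
  note cU = smooth_atlasD[OF A P(1)]
  let ?z = "\<phi> q"
  have zU: "?z \<in> \<phi> ` U" using q by blast
  have "open (ball y0 r)" by simp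
  then obtain R where R: "R > 0" "ball ?z R \<subseteq> ball y0 r" using q(2) openE by blast
  define s where "s = R / 3"
  have s: "s > 0" using R by (simp add: s_def)
  obtain b :: "'e \<Rightarrow> real" where b: "smooth_on UNIV b" "\<And>y. y \<in> cball ?z s \<Longrightarrow> b y = 1" "\<And>y. y \<notin> ball ?z (2 * s) \<Longrightarrow> b y = 0"
    using smooth_plateau[OF s] by metis
  have RU: "ball ?z R \<subseteq> \<phi> ` U" using R(2) P(3) by blast
  have Rs: "cball ?z (2 * s) \<subseteq> ball ?z R" using s by (auto simp: s_def)
  define ext where "ext g q' = (if q' \<in> U then b (\<phi> q') * g (\<phi> q') else 0)" for g :: "'e \<Rightarrow> real" and q'
  have ext: "smooth_fun A (ext g)" if "smooth_on (ball ?z R) g" for g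
    unfolding ext_def[abs_def]
    by (rule smooth_bump_extension[OF A P(1) open_ball RU b(1) _ Rs _ that]) (use b(3) in auto)
  have b1: "b ?z = 1" using b(2) s by simp
  have extz: "ext g q = g ?z" for g using q(1) b1 by (simp add: ext_def)
  define a where "a i = ext (\<lambda>y. (y - ?z) \<bullet> i)" for i
  have a: "smooth_fun A (a i)" for i
    unfolding a_def by (intro ext smooth_on_inner smooth_on_diff smooth_on_const smooth_on_ident) auto
  have aq: "a i q = 0" for i by (simp add: a_def extz)
  \<comment> \<open>The cut-off itself. It enters squared below, because each term of the Hadamard
    expansion, once made global, carries two cut-off factors, one from \<open>a i\<close> and one
    from \<open>ext (k i)\<close>.\<close>
  define C where "C = ext (\<lambda>_. 1)"
  have C: "smooth_fun A C" unfolding C_def by (intro ext smooth_on_const)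
  have Cq: "C q = 1" by (simp add: C_def extz)
  have rep: "u h = (\<Sum>i\<in>Basis. u (a i) * frechet_derivative (h \<circ> inv_into U \<phi>) (at ?z) i)" if h: "smooth_fun A h" for h
  proof -
    let ?h = "h \<circ> inv_into U \<phi>"
    have hs: "smooth_on (ball ?z R) ?h" by (rule smooth_on_subset[OF smooth_fun_chart[OF h P(1)] RU])
    obtain k where k: "\<And>i. i \<in> Basis \<Longrightarrow> smooth_on (ball ?z R) (k i)" "\<And>i. i \<in> Basis \<Longrightarrow> k i ?z = frechet_derivative ?h (at ?z) i"
      "\<And>y. y \<in> ball ?z R \<Longrightarrow> ?h y = ?h ?z + (\<Sum>i\<in>Basis. ((y - ?z) \<bullet> i) * k i y)"
      using hadamard[OF hs R(1)] by blast
    define d where "d q' = h q' - h q" for q'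
    have d: "smooth_fun A d" unfolding d_def[abs_def] by (rule smooth_fun_diff[OF A h smooth_fun_const])
    have "(\<lambda>q'. (C q' * C q') * d q') = (\<lambda>q'. \<Sum>i\<in>Basis. a i q' * ext (k i) q')"
    proof
      fix q'
      show "(C q' * C q') * d q' = (\<Sum>i\<in>Basis. a i q' * ext (k i) q')"
      proof (cases "q' \<in> U \<and> \<phi> q' \<in> ball ?z R")
        case True
        then have "d q' = (\<Sum>i\<in>Basis. ((\<phi> q' - ?z) \<bullet> i) * k i (\<phi> q'))"
          using k(3)[of "\<phi> q'"] cU(5) q(1) by (simp add: d_def)
        then show ?thesis using True by (simp add: C_def a_def ext_def sum_distrib_left mult_ac)
      next
        case False
        then have "ext g q' = 0" for g using b(3)[of "\<phi> q'"] R(1) by (auto simp: ext_def s_def)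
        then show ?thesis by (simp add: C_def a_def)
      qed
    qed
    \<comment> \<open>By the Leibniz rule: \<open>d\<close> vanishes and \<open>C\<close> is 1 at q,
      so the derivative of the cut-off drops out.\<close>
    moreover have "u (\<lambda>q'. (C q' * C q') * d q') = u h"
      using tangent_spaceD(4)[OF u smooth_fun_mult[OF A C C] d] tangent_diff[OF A u h smooth_fun_const, of "h q"]
        tangent_const[OF u] Cq by (simp add: d_def[abs_def])
    moreover have "u (\<lambda>q'. \<Sum>i\<in>Basis. a i q' * ext (k i) q') = (\<Sum>i\<in>Basis. u (a i) * k i ?z)"
    proof -
      have "u (\<lambda>q'. \<Sum>i\<in>Basis. a i q' * ext (k i) q') = (\<Sum>i\<in>Basis. u (\<lambda>q'. a i q' * ext (k i) q'))"
        by (rule tangent_sum[OF A u]) (intro smooth_fun_mult A a ext k(1))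
      also have "\<dots> = (\<Sum>i\<in>Basis. u (a i) * k i ?z)"
      proof (rule sum.cong[OF refl])
        fix i :: 'e assume i: "i \<in> Basis"
        show "u (\<lambda>q'. a i q' * ext (k i) q') = u (a i) * k i ?z"
          using tangent_spaceD(4)[OF u a[of i] ext[OF k(1)[OF i]]] by (simp add: aq extz)
      qed
      finally show ?thesis .
    qed
    ultimately show ?thesis using k(2) by simp
  qed
  \<comment> \<open>The representation is applied to \<open>x j\<close> itself, whose partial
    derivatives are Kronecker deltas. This replaces coordinates centred at q by the fixed ones of
    the patch.\<close>
  have "u (x j) = u (a j)" if j: "j \<in> Basis" for j
  proof -
    have "((\<lambda>y. y \<bullet> j) has_derivative (\<lambda>v. v \<bullet> j)) (at ?z)" by (auto intro!: derivative_eq_intros)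
    moreover have "(x j \<circ> inv_into U \<phi>) y = y \<bullet> j" if "y \<in> ball y0 r" for y
    proof -
      have "y \<in> \<phi> ` U" using that P(3) by blast
      then show ?thesis using P(6)[of "inv_into U \<phi> y" j] that j by (simp add: f_inv_into_f inv_into_into)
    qed
    ultimately have "(x j \<circ> inv_into U \<phi> has_derivative (\<lambda>v. v \<bullet> j)) (at ?z)"
      using has_derivative_cong_open[OF open_ball q(2), of "x j \<circ> inv_into U \<phi>" "\<lambda>y. y \<bullet> j"] by simp
    then have "frechet_derivative (x j \<circ> inv_into U \<phi>) (at ?z) i = i \<bullet> j" for i by (rule frechet_derivative_eqI)
    then have "u (x j) = (\<Sum>i\<in>Basis. u (a i) * (i \<bullet> j))" using rep[OF P(4)[OF j]] by simp
    also have "\<dots> = (\<Sum>i\<in>Basis. if i = j then u (a i) else 0)"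
      using j by (intro sum.cong) (auto simp: inner_Basis)
    finally show ?thesis using j by simp
  qed
  note xa = this
  have "smooth_on (\<phi> ` U) (f \<circ> inv_into U \<phi>)" by (rule smooth_fun_chart[OF f P(1)])
  from smooth_on_linear_frechet[OF this zU]
  have lin: "linear (frechet_derivative (f \<circ> inv_into U \<phi>) (at ?z))" .
  show ?thesis unfolding rep[OF f] by (simp add: linear_sum[OF lin] linear_cmul[OF lin] xa cong: sum.cong)
qed

lemma tangent_expand:
  fixes A :: "('m::{t2_space,second_countable_topology}, 'e::euclidean_space) atlas"
  assumes A: "smooth_atlas A" and cp: "coord_patch A U \<phi> y0 r x E" and q: "q \<in> U" "\<phi> q \<in> ball y0 r"
    and u: "u \<in> tangent_space A q"
  shows "u = (\<Sum>i\<in>Basis. u (x i) *\<^sub>R E i q)"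
proof (rule tangent_eqI[OF u])
  note P = coord_patchD[OF cp]
  show "(\<Sum>i\<in>Basis. u (x i) *\<^sub>R E i q) \<in> tangent_space A q"
    by (intro tangent_space_sum tangent_space_scaleR vector_fieldsD(1) P(5))
  fix f :: "'m \<Rightarrow> real" assume f: "smooth_fun A f"
  have zU: "\<phi> q \<in> \<phi> ` U" using q by blast
  note lin = smooth_on_linear_frechet[OF smooth_fun_chart[OF f P(1)] zU]
  have "(\<Sum>i\<in>Basis. u (x i) *\<^sub>R E i q) f = (\<Sum>i\<in>Basis. u (x i) * E i q f)"
  proof -
    have "(\<Sum>i\<in>I. u (x i) *\<^sub>R E i q) f = (\<Sum>i\<in>I. u (x i) * E i q f)" for I
      by (induction I rule: infinite_finite_induct) (auto simp: scaleR_fun_def)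
    then show ?thesis .
  qed
  then show "u f = (\<Sum>i\<in>Basis. u (x i) *\<^sub>R E i q) f"
    unfolding tangent_coord_formula[OF A cp q u f]
    by (simp add: linear_sum[OF lin] linear_cmul[OF lin] P(7)[OF q _ f] cong: sum.cong)
qed

text \<open>Tensor identities are stated for global vector fields; this is how a single tangent
  vector is fed into them.\<close>

lemma tangent_extends:
  fixes A :: "('m::{t2_space,second_countable_topology}, 'e::euclidean_space) atlas"
  assumes A: "smooth_atlas A" and u: "u \<in> tangent_space A p"
  obtains X where "X \<in> vector_fields A" "X p = u"
proof -
  obtain U \<phi> where U: "(U, \<phi>) \<in> A" "p \<in> U" using smooth_atlas_covers[OF A] .
  obtain r x E where cp: "coord_patch A U \<phi> (\<phi> p) r x E" using coord_patch_exists[OF A U] by blast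
  note P = coord_patchD[OF cp]
  show thesis
  proof
    show "(\<lambda>q. \<Sum>i\<in>Basis. u (x i) *\<^sub>R E i q) \<in> vector_fields A" by (rule vector_fields_lincomb[OF A P(5)])
    show "(\<Sum>i\<in>Basis. u (x i) *\<^sub>R E i p) = u" using tangent_expand[OF A cp U(2) _ u] P(2) by simp
  qed
qed

section \<open>Functions on product manifolds, differentiated in one factor\<close>

lemma partial_fst_derivative:
  assumes "smooth_on S F" "(y, z) \<in> S"
  shows "frechet_derivative (\<lambda>y. F (y, z)) (at y) c = frechet_derivative F (at (y, z)) (c, 0)"
proof -
  have "((\<lambda>y. (y, z)) has_derivative (\<lambda>c. (c, 0))) (at y)" by (auto intro!: derivative_eq_intros)
  from has_derivative_compose[OF this smooth_on_has_derivative[OF assms]]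
  show ?thesis by (rule frechet_derivative_eqI)
qed

lemma partial_snd_derivative:
  assumes "smooth_on S F" "(y, z) \<in> S"
  shows "frechet_derivative (\<lambda>z. F (y, z)) (at z) c = frechet_derivative F (at (y, z)) (0, c)"
proof -
  have "((\<lambda>z. (y, z)) has_derivative (\<lambda>c. (0, c))) (at z)" by (auto intro!: derivative_eq_intros)
  from has_derivative_compose[OF this smooth_on_has_derivative[OF assms]]
  show ?thesis by (rule frechet_derivative_eqI)
qed

lemma smooth_fun_slice_fst:
  fixes A :: "('m::{t2_space,second_countable_topology}, 'e::euclidean_space) atlas"
    and B :: "('n::{t2_space,second_countable_topology}, 'f::euclidean_space) atlas"
  assumes "smooth_atlas A" "smooth_atlas B" "smooth_fun (prod_atlas A B) F"
  shows "smooth_fun A (\<lambda>a. F (a, q))"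
  by (rule smooth_fun_compose[OF assms(1) smooth_atlas_prod[OF assms(1,2)] _ assms(3)])
    (intro smooth_map_Pair assms smooth_map_ident smooth_map_const)

lemma smooth_fun_slice_snd:
  fixes A :: "('m::{t2_space,second_countable_topology}, 'e::euclidean_space) atlas"
    and B :: "('n::{t2_space,second_countable_topology}, 'f::euclidean_space) atlas"
  assumes "smooth_atlas A" "smooth_atlas B" "smooth_fun (prod_atlas A B) F"
  shows "smooth_fun B (\<lambda>q. F (a, q))"
  by (rule smooth_fun_compose[OF assms(2) smooth_atlas_prod[OF assms(1,2)] _ assms(3)])
    (intro smooth_map_Pair assms smooth_map_ident smooth_map_const)

lemma smooth_fun_diagonal:
  fixes A :: "('m::{t2_space,second_countable_topology}, 'e::euclidean_space) atlas"
  assumes "smooth_atlas A" "smooth_fun (prod_atlas A A) F"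
  shows "smooth_fun A (\<lambda>a. F (a, a))"
  by (rule smooth_fun_compose[OF assms(1) smooth_atlas_prod[OF assms(1,1)] _ assms(2)])
    (intro smooth_map_Pair assms smooth_map_ident)

lemma prod_chart_at:
  fixes A :: "('m::{t2_space,second_countable_topology}, 'e::euclidean_space) atlas"
    and B :: "('n::{t2_space,second_countable_topology}, 'f::euclidean_space) atlas"
  assumes A: "smooth_atlas A" and B: "smooth_atlas B" and F: "smooth_fun (prod_atlas A B) F"
    and U: "(U, \<phi>) \<in> A" and V: "(V, \<psi>) \<in> B"
  shows "smooth_on (\<phi> ` U \<times> \<psi> ` V) (\<lambda>z. F (inv_into U \<phi> (fst z), inv_into V \<psi> (snd z)))"
proof -
  note cU = smooth_atlasD[OF A U] and cV = smooth_atlasD[OF B V]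
  have o: "open (\<phi> ` U \<times> \<psi> ` V)" by (rule open_Times[OF cU(2) cV(2)])
  have "smooth_on (\<phi> ` U \<times> \<psi> ` V) (F \<circ> inv_into (U \<times> V) (map_prod \<phi> \<psi>))"
    using smooth_fun_chart[OF F prod_atlasI[OF U V]] by (simp add: map_prod_image_Times)
  then show ?thesis
    by (rule smooth_on_eq[OF o]) (simp add: inv_into_map_prod[OF cU(5) cV(5)])
qed

lemma tangent_chart_formula:
  fixes A :: "('m::{t2_space,second_countable_topology}, 'e::euclidean_space) atlas"
  assumes A: "smooth_atlas A" and v: "v \<in> tangent_space A a"
  shows "\<exists>U \<phi> c. (U, \<phi>) \<in> A \<and> a \<in> U \<and>
    (\<forall>f. smooth_fun A f \<longrightarrow> v f = frechet_derivative (f \<circ> inv_into U \<phi>) (at (\<phi> a)) c)"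
proof -
  obtain U \<phi> where U: "(U, \<phi>) \<in> A" "a \<in> U" using smooth_atlas_covers[OF A] .
  obtain r x E where cp: "coord_patch A U \<phi> (\<phi> a) r x E" using coord_patch_exists[OF A U] by blast
  have "\<phi> a \<in> ball (\<phi> a) r" using coord_patchD(2)[OF cp] by simp
  from U tangent_coord_formula[OF A cp U(2) this v] show ?thesis by blast
qed

text \<open>One chart and one direction c represent v on functions of a single variable and,
  uniformly in the second variable and its chart, on functions on the product. Fixing them once
  makes a derivative with a parameter a partial derivative in a product chart.\<close>

lemma tangent_of_parametric:
  fixes A :: "('m::{t2_space,second_countable_topology}, 'e::euclidean_space) atlas"
    and B :: "('n::{t2_space,second_countable_topology}, 'f::euclidean_space) atlas"
  assumes A: "smooth_atlas A" and B: "smooth_atlas B" and v: "v \<in> tangent_space A a"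
  shows "\<exists>U \<phi> c. (U, \<phi>) \<in> A \<and> a \<in> U \<and>
    (\<forall>f. smooth_fun A f \<longrightarrow> v f = frechet_derivative (f \<circ> inv_into U \<phi>) (at (\<phi> a)) c) \<and>
    (\<forall>F V \<psi> q. smooth_fun (prod_atlas A B) F \<longrightarrow> (V, \<psi>) \<in> B \<longrightarrow> q \<in> V \<longrightarrow>
      v (\<lambda>a. F (a, q)) = frechet_derivative (\<lambda>z. F (inv_into U \<phi> (fst z), inv_into V \<psi> (snd z))) (at (\<phi> a, \<psi> q)) (c, 0))"
proof -
  obtain U \<phi> c where U: "(U, \<phi>) \<in> A" "a \<in> U"
    and v': "\<forall>f. smooth_fun A f \<longrightarrow> v f = frechet_derivative (f \<circ> inv_into U \<phi>) (at (\<phi> a)) c"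
    using tangent_chart_formula[OF A v] by blast
  have "v (\<lambda>a. F (a, q)) = frechet_derivative (\<lambda>z. F (inv_into U \<phi> (fst z), inv_into V \<psi> (snd z))) (at (\<phi> a, \<psi> q)) (c, 0)"
    if F: "smooth_fun (prod_atlas A B) F" and V: "(V, \<psi>) \<in> B" "q \<in> V" for F V \<psi> q
  proof -
    have mem: "(\<phi> a, \<psi> q) \<in> \<phi> ` U \<times> \<psi> ` V" using U V by blast
    have "v (\<lambda>a. F (a, q)) = frechet_derivative (\<lambda>y. F (inv_into U \<phi> y, q)) (at (\<phi> a)) c"
      using v'[rule_format, OF smooth_fun_slice_fst[OF A B F]] by (simp add: o_def)
    also have "\<dots> = frechet_derivative (\<lambda>z. F (inv_into U \<phi> (fst z), inv_into V \<psi> (snd z))) (at (\<phi> a, \<psi> q)) (c, 0)"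
      using partial_fst_derivative[OF prod_chart_at[OF A B F U(1) V(1)] mem, of c]
        inv_into_f_f[OF smooth_atlasD(5)[OF B V(1)] V(2)] by simp
    finally show ?thesis .
  qed
  then show ?thesis using U v' by (intro exI[of _ U] exI[of _ \<phi>] exI[of _ c]) simp
qed

lemma smooth_fun_parametric:
  fixes A :: "('m::{t2_space,second_countable_topology}, 'e::euclidean_space) atlas"
    and B :: "('n::{t2_space,second_countable_topology}, 'f::euclidean_space) atlas"
  assumes A: "smooth_atlas A" and B: "smooth_atlas B" and F: "smooth_fun (prod_atlas A B) F"
    and v: "v \<in> tangent_space A a"
  shows "smooth_fun B (\<lambda>q. v (\<lambda>a. F (a, q)))"
  unfolding smooth_fun_def
proof (intro ballI, clarify)
  obtain U \<phi> c where U: "(U, \<phi>) \<in> A" "a \<in> U"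
    and "\<forall>f. smooth_fun A f \<longrightarrow> v f = frechet_derivative (f \<circ> inv_into U \<phi>) (at (\<phi> a)) c"
    and vF: "\<forall>F V \<psi> q. smooth_fun (prod_atlas A B) F \<longrightarrow> (V, \<psi>) \<in> B \<longrightarrow> q \<in> V \<longrightarrow>
      v (\<lambda>a. F (a, q)) = frechet_derivative (\<lambda>z. F (inv_into U \<phi> (fst z), inv_into V \<psi> (snd z))) (at (\<phi> a, \<psi> q)) (c, 0)"
    using tangent_of_parametric[OF A B v] by (elim exE conjE) (rule that)
  fix V \<psi> assume V: "(V, \<psi>) \<in> B"
  note cV = smooth_atlasD[OF B V]
  let ?F = "\<lambda>z. F (inv_into U \<phi> (fst z), inv_into V \<psi> (snd z))"
  have "smooth_on (\<psi> ` V) (\<lambda>z. frechet_derivative ?F (at (\<phi> a, z)) (c, 0))"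
  proof (rule smooth_on_frechet_derivative_joint[OF _ prod_chart_at[OF A B F U(1) V] cV(2)])
    show "open (\<phi> ` U \<times> \<psi> ` V)" by (rule open_Times[OF smooth_atlasD(2)[OF A U(1)] cV(2)])
    show "smooth_on (\<psi> ` V) (Pair (\<phi> a))" by (intro smooth_on_Pair cV(2) smooth_on_const smooth_on_ident)
  qed (use U(2) in \<open>auto intro: smooth_on_const\<close>)
  then show "smooth_on (\<psi> ` V) ((\<lambda>q. v (\<lambda>a. F (a, q))) \<circ> inv_into V \<psi>)"
  proof (rule smooth_on_eq[OF cV(2)])
    fix z assume "z \<in> \<psi> ` V"
    then have "inv_into V \<psi> z \<in> V" "\<psi> (inv_into V \<psi> z) = z" by (auto simp: inv_into_into f_inv_into_f)
    then show "frechet_derivative ?F (at (\<phi> a, z)) (c, 0) = ((\<lambda>q. v (\<lambda>a. F (a, q))) \<circ> inv_into V \<psi>) z"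
      using vF[rule_format, OF F V, of "inv_into V \<psi> z"] by simp
  qed
qed

text \<open>Symmetry of mixed second derivatives in a product chart. Applied to a group factor and a
  manifold factor, it commutes a derivation at the identity with a vector field.\<close>

lemma tangent_interchange:
  fixes A :: "('m::{t2_space,second_countable_topology}, 'e::euclidean_space) atlas"
    and B :: "('n::{t2_space,second_countable_topology}, 'f::euclidean_space) atlas"
  assumes A: "smooth_atlas A" and B: "smooth_atlas B" and F: "smooth_fun (prod_atlas A B) F"
    and v: "v \<in> tangent_space A a" and u: "u \<in> tangent_space B b"
  shows "u (\<lambda>q. v (\<lambda>a. F (a, q))) = v (\<lambda>a. u (\<lambda>q. F (a, q)))"
proof -
  obtain U \<phi> c where U: "(U, \<phi>) \<in> A" "a \<in> U"
    and v1: "\<forall>f. smooth_fun A f \<longrightarrow> v f = frechet_derivative (f \<circ> inv_into U \<phi>) (at (\<phi> a)) c"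
    and v2: "\<forall>F V \<psi> q. smooth_fun (prod_atlas A B) F \<longrightarrow> (V, \<psi>) \<in> B \<longrightarrow> q \<in> V \<longrightarrow>
      v (\<lambda>a. F (a, q)) = frechet_derivative (\<lambda>z. F (inv_into U \<phi> (fst z), inv_into V \<psi> (snd z))) (at (\<phi> a, \<psi> q)) (c, 0)"
    using tangent_of_parametric[OF A B v] by (elim exE conjE) (rule that)
  obtain V \<psi> d where V: "(V, \<psi>) \<in> B" "b \<in> V"
    and u1: "\<forall>f. smooth_fun B f \<longrightarrow> u f = frechet_derivative (f \<circ> inv_into V \<psi>) (at (\<psi> b)) d"
    using tangent_chart_formula[OF B u] by blast
  note cU = smooth_atlasD[OF A U(1)] and cV = smooth_atlasD[OF B V(1)]
  let ?F = "\<lambda>z. F (inv_into U \<phi> (fst z), inv_into V \<psi> (snd z))"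
  let ?S = "\<phi> ` U \<times> \<psi> ` V"
  have o: "open ?S" by (rule open_Times[OF cU(2) cV(2)])
  note sF = prod_chart_at[OF A B F U(1) V(1)]
  have mem: "(\<phi> a, \<psi> b) \<in> ?S" using U V by blast
  \<comment> \<open>The factors are swapped so that the inner derivative of the opposite order is
    recognised as a smooth function of a.\<close>
  have F': "smooth_fun (prod_atlas B A) (\<lambda>z. F (snd z, fst z))"
    by (rule smooth_fun_compose[OF smooth_atlas_prod[OF B A] smooth_atlas_prod[OF A B] _ F])
      (intro smooth_map_Pair smooth_atlas_prod A B smooth_map_fst smooth_map_snd)
  have "u (\<lambda>q. v (\<lambda>a. F (a, q))) = frechet_derivative ((\<lambda>q. v (\<lambda>a. F (a, q))) \<circ> inv_into V \<psi>) (at (\<psi> b)) d"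
    by (rule u1[rule_format, OF smooth_fun_parametric[OF A B F v]])
  also have "\<dots> = frechet_derivative (\<lambda>z. frechet_derivative ?F (at (\<phi> a, z)) (c, 0)) (at (\<psi> b)) d"
  proof (subst frechet_derivative_cong_open[OF cV(2)])
    fix z assume "z \<in> \<psi> ` V"
    then have "inv_into V \<psi> z \<in> V" "\<psi> (inv_into V \<psi> z) = z" by (auto simp: inv_into_into f_inv_into_f)
    then show "((\<lambda>q. v (\<lambda>a. F (a, q))) \<circ> inv_into V \<psi>) z = frechet_derivative ?F (at (\<phi> a, z)) (c, 0)"
      using v2[rule_format, OF F V(1), of "inv_into V \<psi> z"] by simp
  qed (use V in auto)
  also have "\<dots> = frechet_derivative (\<lambda>z. frechet_derivative ?F (at z) (c, 0)) (at (\<phi> a, \<psi> b)) (0, d)"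
    by (rule partial_snd_derivative[OF smooth_on_frechet_derivative[OF sF] mem])
  also have "\<dots> = frechet_derivative (\<lambda>z. frechet_derivative ?F (at z) (0, d)) (at (\<phi> a, \<psi> b)) (c, 0)"
    by (rule symmetric_second_derivative[OF o sF mem])
  also have "\<dots> = frechet_derivative (\<lambda>y. frechet_derivative ?F (at (y, \<psi> b)) (0, d)) (at (\<phi> a)) c"
    by (rule partial_fst_derivative[OF smooth_on_frechet_derivative[OF sF] mem, symmetric])
  also have "\<dots> = frechet_derivative ((\<lambda>a. u (\<lambda>q. F (a, q))) \<circ> inv_into U \<phi>) (at (\<phi> a)) c"
  proof (subst frechet_derivative_cong_open[OF cU(2)])
    fix y assume y: "y \<in> \<phi> ` U"
    have "u (\<lambda>q. F (inv_into U \<phi> y, q)) = frechet_derivative ((\<lambda>q. F (inv_into U \<phi> y, q)) \<circ> inv_into V \<psi>) (at (\<psi> b)) d"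
      by (rule u1[rule_format, OF smooth_fun_slice_snd[OF A B F]])
    also have "\<dots> = frechet_derivative ?F (at (y, \<psi> b)) (0, d)"
      using partial_snd_derivative[OF sF, of y "\<psi> b" d] y V by (simp add: o_def)
    finally show "frechet_derivative ?F (at (y, \<psi> b)) (0, d) = ((\<lambda>a. u (\<lambda>q. F (a, q))) \<circ> inv_into U \<phi>) y"
      by simp
  qed (use U in \<open>auto simp: o_def\<close>)
  also have "\<dots> = v (\<lambda>a. u (\<lambda>q. F (a, q)))"
    using v1[rule_format, OF smooth_fun_parametric[OF B A F' u]] by simp
  finally show ?thesis .
qed

text \<open>The product rule for an expression in which the variable occurs twice: each occurrence
  is differentiated with the other one frozen. Pullbacks and conjugations by a group element are of
  this kind.\<close>

lemma tangent_diagonal: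
  fixes A :: "('m::{t2_space,second_countable_topology}, 'e::euclidean_space) atlas"
  assumes A: "smooth_atlas A" and F: "smooth_fun (prod_atlas A A) F" and v: "v \<in> tangent_space A a"
  shows "v (\<lambda>c. F (c, c)) = v (\<lambda>c. F (c, a)) + v (\<lambda>c. F (a, c))"
proof -
  obtain U \<phi> c where U: "(U, \<phi>) \<in> A" "a \<in> U"
    and v1: "\<forall>f. smooth_fun A f \<longrightarrow> v f = frechet_derivative (f \<circ> inv_into U \<phi>) (at (\<phi> a)) c"
    using tangent_chart_formula[OF A v] by blast
  let ?F = "\<lambda>z. F (inv_into U \<phi> (fst z), inv_into U \<phi> (snd z))"
  note sF = prod_chart_at[OF A A F U(1) U(1)]
  have mem: "(\<phi> a, \<phi> a) \<in> \<phi> ` U \<times> \<phi> ` U" using U by blast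
  note D = smooth_on_has_derivative[OF sF mem]
  note inv = inv_into_f_f[OF smooth_atlasD(5)[OF A U(1)] U(2)]
  have "((\<lambda>y. (y, y)) has_derivative (\<lambda>c. (c, c))) (at (\<phi> a))" by (auto intro!: derivative_eq_intros)
  from has_derivative_compose[OF this D]
  have "frechet_derivative (\<lambda>y. ?F (y, y)) (at (\<phi> a)) c = frechet_derivative ?F (at (\<phi> a, \<phi> a)) (c, c)"
    by (rule frechet_derivative_eqI)
  also have "\<dots> = frechet_derivative ?F (at (\<phi> a, \<phi> a)) (c, 0) + frechet_derivative ?F (at (\<phi> a, \<phi> a)) (0, c)"
    using linear_add[OF smooth_on_linear_frechet[OF sF mem], of "(c, 0)" "(0, c)"] by simp
  also have "\<dots> = frechet_derivative (\<lambda>y. ?F (y, \<phi> a)) (at (\<phi> a)) c + frechet_derivative (\<lambda>y. ?F (\<phi> a, y)) (at (\<phi> a)) c"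
    by (simp only: partial_fst_derivative[OF sF mem] partial_snd_derivative[OF sF mem])
  finally show ?thesis
    using v1[rule_format, OF smooth_fun_diagonal[OF A F]] v1[rule_format, OF smooth_fun_slice_fst[OF A A F]] v1[rule_format, OF smooth_fun_slice_snd[OF A A F]]
    by (simp add: o_def inv)
qed

lemma smooth_fun_locally_constant:
  fixes A :: "('m::{t2_space,second_countable_topology}, 'e::euclidean_space) atlas"
  assumes A: "smooth_atlas A" and f: "smooth_fun A f" and conn: "connected (UNIV :: 'm set)"
    and zero: "\<And>p u. u \<in> tangent_space A p \<Longrightarrow> u f = 0"
  shows "f p = f q"
proof -
  have "\<exists>W. open W \<and> p \<in> W \<and> (\<forall>q\<in>W. f q = f p)" for p
  proof -
    obtain U \<phi> where U: "(U, \<phi>) \<in> A" "p \<in> U" using smooth_atlas_covers[OF A] .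
    obtain r x E where cp: "coord_patch A U \<phi> (\<phi> p) r x E" using coord_patch_exists[OF A U] by blast
    note P = coord_patchD[OF cp] and cU = smooth_atlasD[OF A U(1)]
    let ?f = "f \<circ> inv_into U \<phi>"
    have D: "(?f has_derivative (\<lambda>v. 0)) (at y within ball (\<phi> p) r)" if y: "y \<in> ball (\<phi> p) r" for y
    proof -
      have yU: "y \<in> \<phi> ` U" using y P(3) by blast
      then obtain q where q: "q \<in> U" "y = \<phi> q" by blast
      have "frechet_derivative ?f (at y) i = 0" if "i \<in> Basis" for i
        using P(7)[OF q(1) _ that f] zero[OF vector_fieldsD(1)[OF P(5)[OF that]]] y q(2) by simp
      then have "frechet_derivative ?f (at y) v = 0" for v
        unfolding frechet_derivative_expand[OF smooth_fun_chart[OF f U(1)] yU, of v] by simp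
      then have "frechet_derivative ?f (at y) = (\<lambda>v. 0)" by blast
      then show ?thesis
        using smooth_on_has_derivative[OF smooth_fun_chart[OF f U(1)] yU] has_derivative_at_withinI by metis
    qed
    obtain k where k: "\<And>y. y \<in> ball (\<phi> p) r \<Longrightarrow> ?f y = k"
      using has_derivative_zero_constant[OF convex_ball D] by blast
    let ?W = "U \<inter> \<phi> -` ball (\<phi> p) r"
    have "f q = k" if "q \<in> ?W" for q
      using k[of "\<phi> q"] that inv_into_f_f[OF cU(5)] by auto
    moreover have "p \<in> ?W" using U P(2) by simp
    moreover have "open ?W" by (rule open_chart_preimage[OF A U(1) open_ball])
    ultimately show ?thesis by metis
  qed
  then have "\<exists>T. openin (top_of_set UNIV) T \<and> p \<in> T \<and> (\<forall>x\<in>T. f x = f p)" for p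
    by (simp add: openin_open)
  then have "f constant_on UNIV"
    by (intro locally_constant_imp_constant[OF conn]) auto
  then obtain k where "\<forall>x\<in>UNIV. f x = k" unfolding constant_on_def by blast
  then show ?thesis by simp
qed

text \<open>Joint smoothness in parameter and point, for which \<open>smooth_fun_parametric\<close>
  with its fixed tangent vector is not enough. In coordinates X acts as the sum of its components
  times partial derivatives in the second factor.\<close>

lemma smooth_fun_vector_field_parametric:
  fixes A :: "('m::{t2_space,second_countable_topology}, 'e::euclidean_space) atlas"
    and B :: "('n::{t2_space,second_countable_topology}, 'f::euclidean_space) atlas"
  assumes A: "smooth_atlas A" and B: "smooth_atlas B" and F: "smooth_fun (prod_atlas B A) F"
    and X: "X \<in> vector_fields A"
  shows "smooth_fun (prod_atlas B A) (\<lambda>z. X (snd z) (\<lambda>q. F (fst z, q)))" (is "smooth_fun _ ?H")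
proof (rule smooth_fun_localI[OF smooth_atlas_prod[OF B A]])
  fix z0 :: "'n \<times> 'm"
  obtain U \<phi> where U: "(U, \<phi>) \<in> A" "snd z0 \<in> U" using smooth_atlas_covers[OF A] .
  obtain V \<psi> where V: "(V, \<psi>) \<in> B" "fst z0 \<in> V" using smooth_atlas_covers[OF B] .
  obtain r x E where cp: "coord_patch A U \<phi> (\<phi> (snd z0)) r x E" using coord_patch_exists[OF A U] by blast
  note P = coord_patchD[OF cp] and cU = smooth_atlasD[OF A U(1)] and cV = smooth_atlasD[OF B V(1)]
  let ?b = "ball (\<phi> (snd z0)) r"
  let ?W = "V \<times> (U \<inter> \<phi> -` ?b)"
  let ?S = "\<psi> ` V \<times> ?b"
  let ?F = "\<lambda>z. F (inv_into V \<psi> (fst z), inv_into U \<phi> (snd z))"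
  have oS: "open ?S" by (rule open_Times[OF cV(2) open_ball])
  have oS': "open (\<psi> ` V \<times> \<phi> ` U)" by (rule open_Times[OF cV(2) cU(2)])
  have sub: "?S \<subseteq> \<psi> ` V \<times> \<phi> ` U" using P(3) by blast
  have im: "map_prod \<psi> \<phi> ` ?W = ?S" using P(3) by (auto simp: map_prod_image_Times)
  note sF = prod_chart_at[OF B A F V(1) U(1)]
  have "smooth_on ?S (\<lambda>y. \<Sum>i\<in>Basis. ((\<lambda>q. X q (x i)) \<circ> inv_into U \<phi>) (snd y) * frechet_derivative ?F (at y) (0, i))"
  proof (intro smooth_on_sum oS smooth_on_mult smooth_on_subset[OF smooth_on_frechet_derivative[OF sF] sub])
    fix i :: 'e assume i: "i \<in> Basis"
    show "smooth_on ?S (\<lambda>y. ((\<lambda>q. X q (x i)) \<circ> inv_into U \<phi>) (snd y))"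
      by (rule smooth_on_compose[OF oS cU(2) _ smooth_fun_chart[OF vector_fieldsD(2)[OF X P(4)[OF i]] U(1)]
            smooth_on_snd[OF oS smooth_on_ident]]) (use P(3) in auto)
  qed
  then have "smooth_on ?S (?H \<circ> inv_into (V \<times> U) (map_prod \<psi> \<phi>))"
  proof (rule smooth_on_eq[OF oS])
    fix y assume y: "y \<in> ?S"
    then have yU: "y \<in> \<psi> ` V \<times> \<phi> ` U" using sub by blast
    let ?a = "inv_into V \<psi> (fst y)" and ?q = "inv_into U \<phi> (snd y)"
    have q: "?q \<in> U" "\<phi> ?q = snd y" using yU by (auto simp: inv_into_into f_inv_into_f)
    have inv: "inv_into (V \<times> U) (map_prod \<psi> \<phi>) y = (?a, ?q)" by (rule inv_into_map_prod[OF cV(5) cU(5) yU])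
    have qb: "\<phi> ?q \<in> ?b" using y q by auto
    have sF': "smooth_fun A (\<lambda>q. F (?a, q))" by (rule smooth_fun_slice_snd[OF B A F])
    have yU': "(fst y, snd y) \<in> \<psi> ` V \<times> \<phi> ` U" using yU by simp
    have "X ?q (\<lambda>q. F (?a, q)) = frechet_derivative (\<lambda>y'. F (?a, inv_into U \<phi> y')) (at (snd y)) (\<Sum>i\<in>Basis. X ?q (x i) *\<^sub>R i)"
      using tangent_coord_formula[OF A cp q(1) qb vector_fieldsD(1)[OF X] sF'] q(2) by (simp add: o_def)
    also have "\<dots> = frechet_derivative ?F (at y) (0, \<Sum>i\<in>Basis. X ?q (x i) *\<^sub>R i)"
      using partial_snd_derivative[OF sF yU', of "\<Sum>i\<in>Basis. X ?q (x i) *\<^sub>R i"] by simp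
    also have "\<dots> = frechet_derivative ?F (at y) (\<Sum>i\<in>Basis. X ?q (x i) *\<^sub>R (0, i))"
    proof -
      have "(0, \<Sum>i\<in>Basis. X ?q (x i) *\<^sub>R i) = (\<Sum>i\<in>Basis. X ?q (x i) *\<^sub>R ((0::'f), i))"
        by (rule prod_eqI) (simp_all add: fst_sum snd_sum)
      then show ?thesis by simp
    qed
    also have "\<dots> = (\<Sum>i\<in>Basis. X ?q (x i) * frechet_derivative ?F (at y) (0, i))"
      using smooth_on_linear_frechet[OF sF yU] by (simp add: linear_sum linear_cmul del: scaleR_Pair)
    finally show "(\<Sum>i\<in>Basis. ((\<lambda>q. X q (x i)) \<circ> inv_into U \<phi>) (snd y) * frechet_derivative ?F (at y) (0, i)) =
        (?H \<circ> inv_into (V \<times> U) (map_prod \<psi> \<phi>)) y"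
      by (simp add: inv)
  qed
  then have s: "smooth_on (map_prod \<psi> \<phi> ` ?W) (?H \<circ> inv_into (V \<times> U) (map_prod \<psi> \<phi>))" by (simp only: im)
  have oW: "open ?W" by (rule open_Times[OF cV(1) open_chart_preimage[OF A U(1) open_ball]])
  have "z0 \<in> ?W" using U V P(2) by (simp add: mem_Times_iff)
  then show "\<exists>U' \<phi>' W. (U', \<phi>') \<in> prod_atlas B A \<and> open W \<and> z0 \<in> W \<and> W \<subseteq> U' \<and> smooth_on (\<phi>' ` W) (?H \<circ> inv_into U' \<phi>')"
    using prod_atlasI[OF V(1) U(1)] oW s
    by (intro exI[of _ "V \<times> U"] exI[of _ "map_prod \<psi> \<phi>"] exI[of _ ?W]) auto
qed

section \<open>Fundamental vector fields of an action\<close>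

lemma differential_apply: "smooth_fun B f \<Longrightarrow> differential B F u f = u (\<lambda>p. f (F p))"
  by (simp add: differential_def o_def)

lemma differential_tangent:
  assumes A: "smooth_atlas A" and B: "smooth_atlas B" and F: "smooth_map A B F" and u: "u \<in> tangent_space A p"
  shows "differential B F u \<in> tangent_space B (F p)"
proof (rule tangent_spaceI)
  note c = smooth_fun_compose[OF A B F]
  fix f h assume f: "smooth_fun B f" and h: "smooth_fun B h"
  show "differential B F u (\<lambda>q. f q + h q) = differential B F u f + differential B F u h"
    by (simp add: differential_apply f h smooth_fun_add[OF B f h] tangent_spaceD(2)[OF u c[OF f] c[OF h]])
  show "differential B F u (\<lambda>q. f q * h q) = differential B F u f * h (F p) + f (F p) * differential B F u h"
    by (simp add: differential_apply f h smooth_fun_mult[OF B f h] tangent_spaceD(4)[OF u c[OF f] c[OF h]])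
next
  fix c f assume f: "smooth_fun B f"
  show "differential B F u (\<lambda>q. c * f q) = c * differential B F u f"
    by (simp add: differential_apply f smooth_fun_cmult[OF B f]
        tangent_spaceD(3)[OF u smooth_fun_compose[OF A B F f]])
qed (simp add: differential_def)

lemma differential_lincomb:
  "differential B F (a *\<^sub>R u + b *\<^sub>R v) = a *\<^sub>R differential B F u + b *\<^sub>R differential B F v"
  by (auto simp: differential_def scaleR_fun_def)

lemma differential_compose:
  assumes "smooth_atlas B" "smooth_atlas C" "smooth_map B C H"
  shows "differential C H (differential B F u) = differential C (\<lambda>p. H (F p)) u"
  using smooth_fun_compose[OF assms] by (auto simp: differential_def o_def)

lemma differential_ident: "u \<in> tangent_space A p \<Longrightarrow> differential A (\<lambda>p. p) u = u"
  by (auto simp: differential_def o_def tangent_spaceD(1))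

locale lie_action =
  fixes A :: "('m::{t2_space, second_countable_topology}, 'e::euclidean_space) atlas"
    and G :: "'g::{t2_space, second_countable_topology} monoid"
    and B :: "('g, 'd::euclidean_space) atlas"
    and \<Phi> :: "'g \<Rightarrow> 'm \<Rightarrow> 'm"
  assumes atlas_A: "smooth_atlas A" and lie_group: "lie_group G B" and action: "smooth_action G B A \<Phi>"
begin

abbreviation mul (infixl "\<cdot>" 70) where "a \<cdot> b \<equiv> a \<otimes>\<^bsub>G\<^esub> b"
abbreviation iv where "iv a \<equiv> inv\<^bsub>G\<^esub> a"
abbreviation un where "un \<equiv> \<one>\<^bsub>G\<^esub>"
abbreviation \<gg> where "\<gg> \<equiv> tangent_space B un"

lemma atlas_B: "smooth_atlas B" and group_G: "group G" and carrier_G: "carrier G = UNIV"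
  using lie_group by (auto simp: lie_group_def)

lemma group_simps [simp]:
  "(a \<cdot> b) \<cdot> c = a \<cdot> (b \<cdot> c)" "un \<cdot> a = a" "a \<cdot> un = a" "a \<cdot> iv a = un" "iv a \<cdot> a = un" "iv (iv a) = a"
  "iv un = un" "iv (a \<cdot> b) = iv b \<cdot> iv a" "a \<cdot> (iv a \<cdot> b) = b" "iv a \<cdot> (a \<cdot> b) = b"
proof -
  interpret group G by (rule group_G)
  show "(a \<cdot> b) \<cdot> c = a \<cdot> (b \<cdot> c)" "un \<cdot> a = a" "a \<cdot> un = a" "a \<cdot> iv a = un" "iv a \<cdot> a = un" "iv (iv a) = a"
    "iv un = un" "iv (a \<cdot> b) = iv b \<cdot> iv a"
    by (simp_all add: carrier_G m_assoc inv_mult_group)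
  show "a \<cdot> (iv a \<cdot> b) = b" "iv a \<cdot> (a \<cdot> b) = b"
    by (simp_all add: carrier_G m_assoc[symmetric])
qed

lemma action_simps [simp]:
  "\<Phi> (a \<cdot> b) p = \<Phi> a (\<Phi> b p)" "\<Phi> un p = p" "\<Phi> (iv a) (\<Phi> a p) = p" "\<Phi> a (\<Phi> (iv a) p) = p"
proof -
  have ga: "group_action G UNIV \<Phi>" using action by (simp add: smooth_action_def)
  have mult: "\<Phi> (a \<cdot> b) p = \<Phi> a (\<Phi> b p)" for a b p
    using group_action.composition_rule[OF ga] by (simp add: carrier_G)
  have one: "\<Phi> un p = p" for p
    using group_action.id_eq_one[OF ga] by (metis UNIV_I restrict_apply')
  show "\<Phi> (a \<cdot> b) p = \<Phi> a (\<Phi> b p)" "\<Phi> un p = p" by (rule mult, rule one)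
  show "\<Phi> (iv a) (\<Phi> a p) = p" "\<Phi> a (\<Phi> (iv a) p) = p"
    by (simp_all add: mult[symmetric] one)
qed

lemma smooth_map_mul:
  fixes C :: "('c::{t2_space,second_countable_topology}, 'k::euclidean_space) atlas"
  assumes C: "smooth_atlas C" and F: "smooth_map C B F" "smooth_map C B H"
  shows "smooth_map C B (\<lambda>x. F x \<cdot> H x)"
proof -
  have "smooth_map (prod_atlas B B) B (\<lambda>(a, b). a \<cdot> b)" using lie_group by (simp add: lie_group_def)
  from smooth_map_compose[OF C smooth_atlas_prod[OF atlas_B atlas_B] atlas_B
      smooth_map_Pair[OF C atlas_B atlas_B F] this] show ?thesis by simp
qed

lemma smooth_map_iv:
  fixes C :: "('c::{t2_space,second_countable_topology}, 'k::euclidean_space) atlas"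
  assumes C: "smooth_atlas C" and F: "smooth_map C B F"
  shows "smooth_map C B (\<lambda>x. iv (F x))"
proof -
  have "smooth_map B B (\<lambda>a. iv a)" using lie_group by (simp add: lie_group_def)
  from smooth_map_compose[OF C atlas_B atlas_B F this] show ?thesis .
qed

lemma smooth_map_action:
  fixes C :: "('c::{t2_space,second_countable_topology}, 'k::euclidean_space) atlas"
  assumes C: "smooth_atlas C" and F: "smooth_map C B F" "smooth_map C A H"
  shows "smooth_map C A (\<lambda>x. \<Phi> (F x) (H x))"
proof -
  have "smooth_map (prod_atlas B A) A (\<lambda>(a, p). \<Phi> a p)" using action by (simp add: smooth_action_def)
  from smooth_map_compose[OF C smooth_atlas_prod[OF atlas_B atlas_A] atlas_A
      smooth_map_Pair[OF C atlas_B atlas_A F] this] show ?thesis by simp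
qed

lemmas atlases = atlas_A atlas_B smooth_atlas_prod[OF atlas_B atlas_A] smooth_atlas_prod[OF atlas_B atlas_B]
  smooth_atlas_prod[OF atlas_A atlas_B]
lemmas smooth_map_intros = smooth_map_mul smooth_map_iv smooth_map_action smooth_map_ident smooth_map_const
  smooth_map_fst smooth_map_snd atlases

lemma smooth_translate: "smooth_map A A (\<Phi> a)"
  using smooth_map_action[OF atlas_A smooth_map_const[OF atlas_B] smooth_map_ident[OF atlas_A], of a] .

lemma smooth_orbit_map: "smooth_map B A (\<lambda>a. \<Phi> a p)"
  by (intro smooth_map_intros)

lemma smooth_fun_translate: "smooth_fun A f \<Longrightarrow> smooth_fun A (\<lambda>p. f (\<Phi> a p))"
  by (rule smooth_fun_compose[OF atlas_A atlas_A smooth_translate])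

lemma smooth_fun_action: "smooth_fun A f \<Longrightarrow> smooth_fun (prod_atlas B A) (\<lambda>z. f (\<Phi> (fst z) (snd z)))"
  by (rule smooth_fun_compose[OF _ atlas_A]) (intro smooth_map_intros)+

abbreviation d\<Phi> where "d\<Phi> a \<equiv> differential A (\<Phi> a)"

lemma d\<Phi>_tangent: "u \<in> tangent_space A p \<Longrightarrow> d\<Phi> a u \<in> tangent_space A (\<Phi> a p)"
  by (rule differential_tangent[OF atlas_A atlas_A smooth_translate])

lemma d\<Phi>_mul: "d\<Phi> a (d\<Phi> b u) = d\<Phi> (a \<cdot> b) u"
proof -
  have "\<Phi> (a \<cdot> b) = (\<lambda>p. \<Phi> a (\<Phi> b p))" by auto
  then show ?thesis using differential_compose[OF atlas_A atlas_A smooth_translate, of a "\<Phi> b" u] by simp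
qed

lemma d\<Phi>_un: "u \<in> tangent_space A p \<Longrightarrow> d\<Phi> un u = u"
proof -
  have "\<Phi> un = (\<lambda>p. p)" by auto
  then show "u \<in> tangent_space A p \<Longrightarrow> d\<Phi> un u = u" using differential_ident[of u A p] by simp
qed

lemma d\<Phi>_iv:
  "u \<in> tangent_space A p \<Longrightarrow> d\<Phi> (iv a) (d\<Phi> a u) = u"
  "u \<in> tangent_space A p \<Longrightarrow> d\<Phi> a (d\<Phi> (iv a) u) = u"
  using d\<Phi>_mul[of "iv a" a u] d\<Phi>_mul[of a "iv a" u] d\<Phi>_un[of u p] by simp_all

definition push :: "'g \<Rightarrow> 'm vfield \<Rightarrow> 'm vfield"
  where "push a X q = d\<Phi> a (X (\<Phi> (iv a) q))"

lemma push_apply: "smooth_fun A f \<Longrightarrow> push a X q f = X (\<Phi> (iv a) q) (\<lambda>p. f (\<Phi> a p))"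
  by (simp add: push_def differential_apply)

lemma push_at: "push a X (\<Phi> a p) = d\<Phi> a (X p)"
  by (simp add: push_def)

lemma push_vector_field:
  assumes X: "X \<in> vector_fields A" shows "push a X \<in> vector_fields A"
proof (rule vector_fieldsI)
  show "push a X p \<in> tangent_space A p" for p
    using d\<Phi>_tangent[OF vector_fieldsD(1)[OF X, of "\<Phi> (iv a) p"], of a] by (simp add: push_def)
  fix f assume f: "smooth_fun A f"
  have "smooth_fun A (\<lambda>q. X (\<Phi> (iv a) q) (\<lambda>p. f (\<Phi> a p)))"
    by (rule smooth_fun_translate[OF vector_fieldsD(2)[OF X smooth_fun_translate[OF f]]])
  then show "smooth_fun A (\<lambda>p. push a X p f)" by (simp add: push_apply[OF f])
qed

lemma push_lie_bracket:
  assumes X: "X \<in> vector_fields A" and Y: "Y \<in> vector_fields A"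
  shows "lie_bracket (push a X) (push a Y) = push a (lie_bracket X Y)"
proof
  fix q
  show "lie_bracket (push a X) (push a Y) q = push a (lie_bracket X Y) q"
  proof (rule tangent_eqI)
    show "lie_bracket (push a X) (push a Y) q \<in> tangent_space A q"
      by (intro vector_fieldsD(1) lie_bracket_vector_field atlas_A push_vector_field X Y)
    show "push a (lie_bracket X Y) q \<in> tangent_space A q"
      by (intro vector_fieldsD(1) lie_bracket_vector_field atlas_A push_vector_field X Y)
    fix f assume f: "smooth_fun A f"
    have "push a X q (\<lambda>q. push a Y q f) = X (\<Phi> (iv a) q) (\<lambda>p. Y p (\<lambda>p. f (\<Phi> a p)))"
      "push a Y q (\<lambda>q. push a X q f) = Y (\<Phi> (iv a) q) (\<lambda>p. X p (\<lambda>p. f (\<Phi> a p)))"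
      by (simp_all only: push_apply[OF vector_fieldsD(2)[OF push_vector_field[OF Y] f]]
          push_apply[OF vector_fieldsD(2)[OF push_vector_field[OF X] f]])
        (simp_all add: push_apply[OF f])
    then show "lie_bracket (push a X) (push a Y) q f = push a (lie_bracket X Y) q f"
      by (simp add: push_apply[OF f] lie_bracket_def)
  qed
qed

definition fund :: "'g tvec \<Rightarrow> 'm vfield"
  where "fund w p = differential A (\<lambda>a. \<Phi> a p) w"

lemma fund_apply: "smooth_fun A f \<Longrightarrow> fund w p f = w (\<lambda>a. f (\<Phi> a p))"
  by (simp add: fund_def differential_apply)

lemma fund_lincomb: "fund (a *\<^sub>R u + b *\<^sub>R v) = (\<lambda>p. a *\<^sub>R fund u p + b *\<^sub>R fund v p)"
  by (simp add: fund_def[abs_def] differential_lincomb)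

lemma fund_vector_field:
  assumes w: "w \<in> \<gg>" shows "fund w \<in> vector_fields A"
proof (rule vector_fieldsI)
  show "fund w p \<in> tangent_space A p" for p
    using differential_tangent[OF atlas_B atlas_A smooth_orbit_map w, of p] by (simp add: fund_def)
  fix f assume f: "smooth_fun A f"
  show "smooth_fun A (\<lambda>p. fund w p f)"
    using smooth_fun_parametric[OF atlas_B atlas_A smooth_fun_action[OF f] w] by (simp add: fund_apply[OF f])
qed

definition invariant :: "'m vfield \<Rightarrow> bool"
  where "invariant X \<longleftrightarrow> (\<forall>a p. d\<Phi> a (X p) = X (\<Phi> a p))"

text \<open>Invariance says that Z f at \<open>\<Phi> a p\<close> is Z at p applied to f composed
  with \<open>\<Phi> a\<close>. Differentiate this in a at the identity and exchange the two
  derivations.\<close>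

lemma bracket_fund_invariant:
  assumes w: "w \<in> \<gg>" and Z: "Z \<in> vector_fields A" "invariant Z"
  shows "lie_bracket (fund w) Z = 0"
proof
  fix p
  show "lie_bracket (fund w) Z p = 0 p"
  proof (rule tangent_eqI)
    show "lie_bracket (fund w) Z p \<in> tangent_space A p"
      by (intro vector_fieldsD(1) lie_bracket_vector_field atlas_A fund_vector_field w Z)
    show "0 p \<in> tangent_space A p" by (simp add: tangent_space_zero)
    fix f assume f: "smooth_fun A f"
    have "Z (\<Phi> a p) f = Z p (\<lambda>q. f (\<Phi> a q))" for a
      using Z(2) differential_apply[OF f, of "\<Phi> a" "Z p"] by (simp add: invariant_def)
    then have "fund w p (\<lambda>q. Z q f) = w (\<lambda>a. Z p (\<lambda>q. f (\<Phi> a q)))"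
      by (simp add: fund_apply vector_fieldsD(2)[OF Z(1) f])
    also have "\<dots> = Z p (\<lambda>q. w (\<lambda>a. f (\<Phi> a q)))"
      using tangent_interchange[OF atlas_B atlas_A smooth_fun_action[OF f] w vector_fieldsD(1)[OF Z(1)]] by simp
    also have "\<dots> = Z p (\<lambda>q. fund w q f)" by (simp add: fund_apply[OF f])
    finally show "lie_bracket (fund w) Z p f = 0 p f" by (simp add: lie_bracket_def)
  qed
qed

text \<open>The group element occurs in the base point and in the pullback. Differentiating the two
  occurrences separately gives the two terms of the bracket.\<close>

lemma pullback_derivative:
  assumes w: "w \<in> \<gg>" and Y: "Y \<in> vector_fields A" and f: "smooth_fun A f"
  shows "smooth_fun B (\<lambda>a. d\<Phi> (iv a) (Y (\<Phi> a p)) f)" "w (\<lambda>a. d\<Phi> (iv a) (Y (\<Phi> a p)) f) = lie_bracket (fund w) Y p f"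
proof -
  let ?F = "\<lambda>z. f (\<Phi> (iv (fst z)) (snd z))"
  have F: "smooth_fun (prod_atlas B A) ?F"
    by (rule smooth_fun_compose[OF _ atlas_A _ f]) (intro smooth_map_intros)+
  have YF: "smooth_fun (prod_atlas B A) (\<lambda>z. Y (snd z) (\<lambda>q. f (\<Phi> (iv (fst z)) q)))"
    using smooth_fun_vector_field_parametric[OF atlas_A atlas_B F Y] by simp
  \<comment> \<open>First component: the base point; second component: the pullback. The function to
    be differentiated is the diagonal.\<close>
  let ?H = "\<lambda>z. Y (\<Phi> (fst z) p) (\<lambda>q. f (\<Phi> (iv (snd z)) q))"
  have H: "smooth_fun (prod_atlas B B) ?H"
    using smooth_fun_compose[OF smooth_atlas_prod[OF atlas_B atlas_B] smooth_atlas_prod[OF atlas_B atlas_A] _ YF,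
        of "\<lambda>z. (snd z, \<Phi> (fst z) p)"]
    by (simp add: smooth_map_Pair smooth_map_intros)
  have eq: "d\<Phi> (iv a) (Y (\<Phi> a p)) f = ?H (a, a)" for a by (simp add: differential_apply[OF f])
  show "smooth_fun B (\<lambda>a. d\<Phi> (iv a) (Y (\<Phi> a p)) f)"
    unfolding eq by (rule smooth_fun_diagonal[OF atlas_B H])
  have "w (\<lambda>a. d\<Phi> (iv a) (Y (\<Phi> a p)) f) = w (\<lambda>a. ?H (a, un)) + w (\<lambda>a. ?H (un, a))"
    unfolding eq by (rule tangent_diagonal[OF atlas_B H w])
  also have "w (\<lambda>a. ?H (a, un)) = fund w p (\<lambda>q. Y q f)"
    by (simp add: fund_apply[OF vector_fieldsD(2)[OF Y f]])
  also have "w (\<lambda>a. ?H (un, a)) = Y p (\<lambda>q. w (\<lambda>a. f (\<Phi> (iv a) q)))"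
    using tangent_interchange[OF atlas_B atlas_A F w vector_fieldsD(1)[OF Y, of p]] by simp
  also have "\<dots> = Y p (\<lambda>q. - fund w q f)"
  proof -
    \<comment> \<open>The product rule for the constant function obtained from a times its inverse
      gives the sign.\<close>
    have "w (\<lambda>a. f (\<Phi> (iv a) q)) = - w (\<lambda>a. f (\<Phi> a q))" for q
    proof -
      have K: "smooth_fun (prod_atlas B B) (\<lambda>z. f (\<Phi> (fst z \<cdot> iv (snd z)) q))"
        by (rule smooth_fun_compose[OF _ atlas_A _ f]) (intro smooth_map_intros)+
      from tangent_diagonal[OF atlas_B K w] show ?thesis by (simp add: tangent_const[OF w])
    qed
    then show ?thesis by (simp add: fund_apply[OF f])
  qed
  also have "\<dots> = - Y p (\<lambda>q. fund w q f)"
    by (rule tangent_minus[OF vector_fieldsD(1)[OF Y] vector_fieldsD(2)[OF fund_vector_field[OF w] f]])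
  finally show "w (\<lambda>a. d\<Phi> (iv a) (Y (\<Phi> a p)) f) = lie_bracket (fund w) Y p f"
    by (simp add: lie_bracket_def)
qed

end

lemma smooth_funs_separate:
  fixes A :: "('m::{t2_space,second_countable_topology}, 'e::euclidean_space) atlas"
  assumes A: "smooth_atlas A" and pq: "p \<noteq> q"
  shows "\<exists>f. smooth_fun A f \<and> f p \<noteq> f q"
proof -
  obtain U \<phi> where U: "(U, \<phi>) \<in> A" "p \<in> U" using smooth_atlas_covers[OF A] .
  note cU = smooth_atlasD[OF A U(1)]
  have "\<phi> p \<in> \<phi> ` U" using U by blast
  then obtain R where R: "R > 0" "ball (\<phi> p) R \<subseteq> \<phi> ` U" using cU(2) openE by blast
  \<comment> \<open>If q lies in the same chart, its coordinates must stay outside the support of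
    radius 2s; otherwise only the chart limits the radius.\<close>
  define s where "s = (if q \<in> U then min R (dist (\<phi> p) (\<phi> q)) else R) / 3"
  have "q \<in> U \<Longrightarrow> \<phi> p \<noteq> \<phi> q" using inj_onD[OF cU(5)] U(2) pq by blast
  then have s: "s > 0" "3 * s \<le> R" "q \<in> U \<Longrightarrow> 3 * s \<le> dist (\<phi> p) (\<phi> q)" using R(1) by (auto simp: s_def)
  obtain b :: "'e \<Rightarrow> real" where b: "smooth_on UNIV b" "\<And>z. z \<in> cball (\<phi> p) s \<Longrightarrow> b z = 1" "\<And>z. z \<notin> ball (\<phi> p) (2 * s) \<Longrightarrow> b z = 0"
    using smooth_plateau[OF s(1)] by metis
  define f where "f = (\<lambda>q. if q \<in> U then b (\<phi> q) * 1 else 0)"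
  have "smooth_fun A f"
    unfolding f_def
  proof (rule smooth_bump_extension[OF A U(1) open_ball R(2) b(1) _ _ _ smooth_on_const])
    show "compact (cball (\<phi> p) (2 * s))" by simp
    show "cball (\<phi> p) (2 * s) \<subseteq> ball (\<phi> p) R" using s by auto
    show "b z = 0" if "z \<notin> cball (\<phi> p) (2 * s)" for z using that b(3) by auto
  qed
  moreover have "f p = 1" using U b(2) s(1) by (simp add: f_def)
  moreover have "f q = 0"
  proof (cases "q \<in> U")
    case True
    then have "\<phi> q \<notin> ball (\<phi> p) (2 * s)" using s by simp
    then show ?thesis using b(3) by (simp add: f_def)
  qed (simp add: f_def)
  ultimately show ?thesis by (intro exI[of _ f]) simp
qed

text \<open>Neither symmetry nor antisymmetry is asked, so that the metric and the fundamental form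
  share one Lie derivative formula.\<close>

definition smooth_bilinear_form ::
    "('m, 'e::euclidean_space) atlas \<Rightarrow> ('m \<Rightarrow> 'm tvec \<Rightarrow> 'm tvec \<Rightarrow> real) \<Rightarrow> bool"
  where "smooth_bilinear_form A \<beta> \<longleftrightarrow>
    (\<forall>p. \<forall>u\<in>tangent_space A p. \<forall>v\<in>tangent_space A p. \<forall>w\<in>tangent_space A p. \<forall>a b.
       \<beta> p (a *\<^sub>R u + b *\<^sub>R v) w = a * \<beta> p u w + b * \<beta> p v w \<and>
       \<beta> p w (a *\<^sub>R u + b *\<^sub>R v) = a * \<beta> p w u + b * \<beta> p w v) \<and>
    (\<forall>X\<in>vector_fields A. \<forall>Y\<in>vector_fields A. smooth_fun A (\<lambda>p. \<beta> p (X p) (Y p)))"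

lemma tangent_linear_sum:
  fixes u :: "'i \<Rightarrow> 'm tvec"
  assumes lin: "\<And>u v a b. u \<in> tangent_space A p \<Longrightarrow> v \<in> tangent_space A p \<Longrightarrow>
      \<alpha> (a *\<^sub>R u + b *\<^sub>R v) = a * \<alpha> u + b * (\<alpha> v :: real)"
    and u: "\<And>i. i \<in> I \<Longrightarrow> u i \<in> tangent_space A p"
  shows "\<alpha> (\<Sum>i\<in>I. c i *\<^sub>R u i) = (\<Sum>i\<in>I. c i * \<alpha> (u i))"
  using u
proof (induction I rule: infinite_finite_induct)
  case (insert i I)
  have "(\<Sum>i\<in>I. c i *\<^sub>R u i) \<in> tangent_space A p"
    by (intro tangent_space_sum tangent_space_scaleR) (use insert.prems in blast)
  from lin[OF insert.prems this, of i "c i" 1]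
  have "\<alpha> (c i *\<^sub>R u i + (\<Sum>i\<in>I. c i *\<^sub>R u i)) = c i * \<alpha> (u i) + \<alpha> (\<Sum>i\<in>I. c i *\<^sub>R u i)" by simp
  then show ?case using insert by (simp only: sum.insert insert_iff simp_thms)
qed (use lin[OF tangent_space_zero tangent_space_zero, of 0 0] in simp_all)

lemma one_formD:
  assumes "one_form A \<theta>"
  shows "u \<in> tangent_space A p \<Longrightarrow> v \<in> tangent_space A p \<Longrightarrow> \<theta> p (a *\<^sub>R u + b *\<^sub>R v) = a * \<theta> p u + b * \<theta> p v"
    "X \<in> vector_fields A \<Longrightarrow> smooth_fun A (\<lambda>p. \<theta> p (X p))"
  using assms unfolding one_form_def by blast+

lemma smooth_bilinear_formD:
  assumes "smooth_bilinear_form A \<beta>"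
  shows "w \<in> tangent_space A p \<Longrightarrow> u \<in> tangent_space A p \<Longrightarrow> v \<in> tangent_space A p \<Longrightarrow>
      \<beta> p (a *\<^sub>R u + b *\<^sub>R v) w = a * \<beta> p u w + b * \<beta> p v w"
    "w \<in> tangent_space A p \<Longrightarrow> u \<in> tangent_space A p \<Longrightarrow> v \<in> tangent_space A p \<Longrightarrow>
      \<beta> p w (a *\<^sub>R u + b *\<^sub>R v) = a * \<beta> p w u + b * \<beta> p w v"
    "X \<in> vector_fields A \<Longrightarrow> Y \<in> vector_fields A \<Longrightarrow> smooth_fun A (\<lambda>p. \<beta> p (X p) (Y p))"
  using assms unfolding smooth_bilinear_form_def by blast+

section \<open>Lie derivatives of invariant tensors along fundamental fields\<close>

context lie_action
begin

text \<open>Invariance moves \<theta> from \<open>\<Phi> a p\<close> back to the fixed point p, so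
  that only the pulled back vector depends on a. A finite expansion in coordinates then brings the
  derivation w inside the linear form.\<close>

lemma lie_derivative_one_form:
  assumes w: "w \<in> \<gg>" and Y: "Y \<in> vector_fields A" and \<theta>: "one_form A \<theta>"
    and inv: "\<And>a p u. u \<in> tangent_space A p \<Longrightarrow> \<theta> (\<Phi> a p) (d\<Phi> a u) = \<theta> p u"
  shows "fund w p (\<lambda>q. \<theta> q (Y q)) = \<theta> p (lie_bracket (fund w) Y p)"
proof -
  obtain U \<phi> where U: "(U, \<phi>) \<in> A" "p \<in> U" using smooth_atlas_covers[OF atlas_A] .
  obtain r x E where cp: "coord_patch A U \<phi> (\<phi> p) r x E" using coord_patch_exists[OF atlas_A U] by blast
  note P = coord_patchD[OF cp]
  have pb: "\<phi> p \<in> ball (\<phi> p) r" using P(2) by simp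
  note ex = tangent_expand[OF atlas_A cp U(2) pb]
  have Ep: "E i p \<in> tangent_space A p" if "i \<in> Basis" for i using vector_fieldsD(1)[OF P(5)[OF that]] .
  have \<theta>ex: "\<theta> p u = (\<Sum>i\<in>Basis. u (x i) * \<theta> p (E i p))" if u: "u \<in> tangent_space A p" for u
    by (subst ex[OF u], rule tangent_linear_sum[OF one_formD(1)[OF \<theta>] Ep])
  let ?u = "\<lambda>a. d\<Phi> (iv a) (Y (\<Phi> a p))"
  have Yp: "Y q \<in> tangent_space A q" for q by (rule vector_fieldsD(1)[OF Y])
  have u: "?u a \<in> tangent_space A p" for a using d\<Phi>_tangent[OF Yp, of "iv a" "\<Phi> a p"] by simp
  have "fund w p (\<lambda>q. \<theta> q (Y q)) = w (\<lambda>a. \<theta> (\<Phi> a p) (Y (\<Phi> a p)))"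
    by (rule fund_apply[OF one_formD(2)[OF \<theta> Y]])
  also have "\<dots> = w (\<lambda>a. \<theta> p (?u a))"
  proof -
    have "\<theta> (\<Phi> a p) (Y (\<Phi> a p)) = \<theta> p (?u a)" for a
      using inv[OF u, of a a] d\<Phi>_iv(2)[OF Yp, of a] by simp
    then show ?thesis by simp
  qed
  also have "\<dots> = w (\<lambda>a. \<Sum>i\<in>Basis. \<theta> p (E i p) * ?u a (x i))" by (simp add: \<theta>ex[OF u] mult.commute)
  also have "\<dots> = (\<Sum>i\<in>Basis. w (\<lambda>a. \<theta> p (E i p) * ?u a (x i)))"
    by (rule tangent_sum[OF atlas_B w]) (intro smooth_fun_cmult atlas_B pullback_derivative(1)[OF w Y] P(4))
  also have "\<dots> = (\<Sum>i\<in>Basis. lie_bracket (fund w) Y p (x i) * \<theta> p (E i p))"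
    by (rule sum.cong[OF refl])
      (simp add: tangent_spaceD(3)[OF w pullback_derivative(1)[OF w Y P(4)]] pullback_derivative(2)[OF w Y P(4)])
  also have "\<dots> = \<theta> p (lie_bracket (fund w) Y p)"
    by (rule \<theta>ex[symmetric]) (intro vector_fieldsD(1) lie_bracket_vector_field atlas_A fund_vector_field w Y)
  finally show ?thesis .
qed

text \<open>As for 1-forms, with the product rule for the coordinates of the two pulled back
  vectors. For \<open>g\<close> this becomes Killing's equation, for \<omega> the vanishing of its
  Lie derivative.\<close>

lemma lie_derivative_bilinear:
  assumes w: "w \<in> \<gg>" and Y: "Y \<in> vector_fields A" and Z: "Z \<in> vector_fields A" and \<beta>: "smooth_bilinear_form A \<beta>"
    and inv: "\<And>a p u v. u \<in> tangent_space A p \<Longrightarrow> v \<in> tangent_space A p \<Longrightarrow> \<beta> (\<Phi> a p) (d\<Phi> a u) (d\<Phi> a v) = \<beta> p u v"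
  shows "fund w p (\<lambda>q. \<beta> q (Y q) (Z q)) = \<beta> p (lie_bracket (fund w) Y p) (Z p) + \<beta> p (Y p) (lie_bracket (fund w) Z p)"
proof -
  obtain U \<phi> where U: "(U, \<phi>) \<in> A" "p \<in> U" using smooth_atlas_covers[OF atlas_A] .
  obtain r x E where cp: "coord_patch A U \<phi> (\<phi> p) r x E" using coord_patch_exists[OF atlas_A U] by blast
  note P = coord_patchD[OF cp]
  have pb: "\<phi> p \<in> ball (\<phi> p) r" using P(2) by simp
  note ex = tangent_expand[OF atlas_A cp U(2) pb]
  have Ep: "E i p \<in> tangent_space A p" if "i \<in> Basis" for i using vector_fieldsD(1)[OF P(5)[OF that]] .
  let ?c = "\<lambda>i j. \<beta> p (E i p) (E j p)"
  have \<beta>ex: "\<beta> p u v = (\<Sum>i\<in>Basis. \<Sum>j\<in>Basis. ?c i j * (u (x i) * v (x j)))"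
    if u: "u \<in> tangent_space A p" and v: "v \<in> tangent_space A p" for u v
  proof -
    have "\<beta> p u v = (\<Sum>i\<in>Basis. u (x i) * \<beta> p (E i p) v)"
      by (subst ex[OF u], rule tangent_linear_sum[where \<alpha>="\<lambda>u. \<beta> p u v", OF smooth_bilinear_formD(1)[OF \<beta> v] Ep])
    also have "\<dots> = (\<Sum>i\<in>Basis. u (x i) * (\<Sum>j\<in>Basis. v (x j) * ?c i j))"
    proof (intro sum.cong refl arg_cong2[where f="(*)"])
      fix i :: 'e assume i: "i \<in> Basis"
      show "\<beta> p (E i p) v = (\<Sum>j\<in>Basis. v (x j) * ?c i j)"
        by (subst ex[OF v], rule tangent_linear_sum[where \<alpha>="\<lambda>v. \<beta> p (E i p) v", OF smooth_bilinear_formD(2)[OF \<beta> Ep[OF i]] Ep])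
    qed
    finally show ?thesis by (simp add: sum_distrib_left mult_ac)
  qed
  let ?u = "\<lambda>Y a. d\<Phi> (iv a) (Y (\<Phi> a p))"
  have VT: "Y q \<in> tangent_space A q" if "Y \<in> vector_fields A" for Y q by (rule vector_fieldsD(1)[OF that])
  have u: "?u Y a \<in> tangent_space A p" if "Y \<in> vector_fields A" for Y a using d\<Phi>_tangent[OF VT[OF that], of "iv a" "\<Phi> a p"] by simp
  have u0: "?u Y un = Y p" if "Y \<in> vector_fields A" for Y using d\<Phi>_un[OF VT[OF that]] by simp
  note pd1 = pullback_derivative(1)[OF w _ P(4)] and pd2 = pullback_derivative(2)[OF w _ P(4)]
  have br: "lie_bracket (fund w) Y p \<in> tangent_space A p" if "Y \<in> vector_fields A" for Y
    by (intro VT lie_bracket_vector_field atlas_A fund_vector_field w that)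
  have "fund w p (\<lambda>q. \<beta> q (Y q) (Z q)) = w (\<lambda>a. \<beta> (\<Phi> a p) (Y (\<Phi> a p)) (Z (\<Phi> a p)))"
    by (rule fund_apply[OF smooth_bilinear_formD(3)[OF \<beta> Y Z]])
  also have "\<dots> = w (\<lambda>a. \<beta> p (?u Y a) (?u Z a))"
  proof -
    have "\<beta> (\<Phi> a p) (Y (\<Phi> a p)) (Z (\<Phi> a p)) = \<beta> p (?u Y a) (?u Z a)" for a
      using inv[OF u[OF Y] u[OF Z], of a a a] d\<Phi>_iv(2)[OF VT[OF Y], of a] d\<Phi>_iv(2)[OF VT[OF Z], of a] by simp
    then show ?thesis by simp
  qed
  also have "\<dots> = w (\<lambda>a. \<Sum>i\<in>Basis. \<Sum>j\<in>Basis. ?c i j * (?u Y a (x i) * ?u Z a (x j)))"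
    by (simp only: \<beta>ex[OF u[OF Y] u[OF Z]])
  also have "\<dots> = (\<Sum>i\<in>Basis. \<Sum>j\<in>Basis. w (\<lambda>a. ?c i j * (?u Y a (x i) * ?u Z a (x j))))"
  proof -
    have s: "smooth_fun B (\<lambda>a. ?c i j * (?u Y a (x i) * ?u Z a (x j)))" if "i \<in> Basis" "j \<in> Basis" for i j
      by (intro smooth_fun_cmult smooth_fun_mult atlas_B pd1 Y Z that)
    have "w (\<lambda>a. \<Sum>i\<in>Basis. \<Sum>j\<in>Basis. ?c i j * (?u Y a (x i) * ?u Z a (x j))) =
        (\<Sum>i\<in>Basis. w (\<lambda>a. \<Sum>j\<in>Basis. ?c i j * (?u Y a (x i) * ?u Z a (x j))))"
      by (rule tangent_sum[OF atlas_B w]) (intro smooth_fun_sum atlas_B s)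
    also have "\<dots> = (\<Sum>i\<in>Basis. \<Sum>j\<in>Basis. w (\<lambda>a. ?c i j * (?u Y a (x i) * ?u Z a (x j))))"
      by (intro sum.cong refl tangent_sum[OF atlas_B w] s)
    finally show ?thesis .
  qed
  also have "\<dots> = (\<Sum>i\<in>Basis. \<Sum>j\<in>Basis. ?c i j * (lie_bracket (fund w) Y p (x i) * Z p (x j))
      + ?c i j * (Y p (x i) * lie_bracket (fund w) Z p (x j)))"
  proof (intro sum.cong refl)
    fix i j :: 'e assume i: "i \<in> Basis" and j: "j \<in> Basis"
    have "w (\<lambda>a. ?c i j * (?u Y a (x i) * ?u Z a (x j))) = ?c i j * w (\<lambda>a. ?u Y a (x i) * ?u Z a (x j))"
      by (rule tangent_spaceD(3)[OF w]) (intro smooth_fun_mult atlas_B pd1 Y Z i j)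
    also have "w (\<lambda>a. ?u Y a (x i) * ?u Z a (x j)) = w (\<lambda>a. ?u Y a (x i)) * ?u Z un (x j) + ?u Y un (x i) * w (\<lambda>a. ?u Z a (x j))"
      by (rule tangent_spaceD(4)[OF w pd1[OF Y i] pd1[OF Z j]])
    also have "\<dots> = lie_bracket (fund w) Y p (x i) * Z p (x j) + Y p (x i) * lie_bracket (fund w) Z p (x j)"
      unfolding pd2[OF Y i] pd2[OF Z j] u0[OF Y] u0[OF Z] ..
    finally show "w (\<lambda>a. ?c i j * (?u Y a (x i) * ?u Z a (x j))) = ?c i j * (lie_bracket (fund w) Y p (x i) * Z p (x j))
      + ?c i j * (Y p (x i) * lie_bracket (fund w) Z p (x j))" by (simp add: distrib_left)
  qed
  also have "\<dots> = \<beta> p (lie_bracket (fund w) Y p) (Z p) + \<beta> p (Y p) (lie_bracket (fund w) Z p)"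
    unfolding \<beta>ex[OF br[OF Y] VT[OF Z]] \<beta>ex[OF VT[OF Y] br[OF Z]] by (simp only: sum.distrib)
  finally show ?thesis .
qed

section \<open>The adjoint action and the center\<close>

definition Ad :: "'g \<Rightarrow> 'g tvec \<Rightarrow> 'g tvec"
  where "Ad b w = differential B (\<lambda>a. b \<cdot> a \<cdot> iv b) w"

text \<open>The left-invariant field with value w at the identity. It links generators, which are
  tangent vectors, to the elements of \<open>lie_algebra\<close>, which are fields.\<close>

definition linv :: "'g tvec \<Rightarrow> 'g vfield"
  where "linv w b = differential B (\<lambda>a. b \<cdot> a) w"

lemma Ad_apply: "smooth_fun B h \<Longrightarrow> Ad b w h = w (\<lambda>a. h (b \<cdot> (a \<cdot> iv b)))"
  by (simp add: Ad_def differential_apply)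

lemma linv_apply: "smooth_fun B h \<Longrightarrow> linv w b h = w (\<lambda>a. h (b \<cdot> a))"
  by (simp add: linv_def differential_apply)

lemma smooth_conj: "smooth_map B B (\<lambda>a. b \<cdot> a \<cdot> iv b)"
  by (intro smooth_map_intros)

lemma smooth_left: "smooth_map B B (\<lambda>a. b \<cdot> a)"
  by (intro smooth_map_intros)

lemma Ad_in: "w \<in> \<gg> \<Longrightarrow> Ad b w \<in> \<gg>"
  using differential_tangent[OF atlas_B atlas_B smooth_conj, of w un b] by (simp add: Ad_def)

lemma Ad_mul: "Ad a (Ad b w) = Ad (a \<cdot> b) w"
proof -
  have "(\<lambda>c. a \<cdot> b \<cdot> c \<cdot> iv (a \<cdot> b)) = (\<lambda>c. a \<cdot> (b \<cdot> c \<cdot> iv b) \<cdot> iv a)" by simp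
  then show ?thesis
    unfolding Ad_def using differential_compose[OF atlas_B atlas_B smooth_conj[of a], of "\<lambda>c. b \<cdot> c \<cdot> iv b" w]
    by (simp only:)
qed

lemma Ad_un: "w \<in> \<gg> \<Longrightarrow> Ad un w = w"
  using differential_ident[of w B un] by (simp add: Ad_def)

lemma Ad_lincomb: "Ad b (s *\<^sub>R u + t *\<^sub>R v) = s *\<^sub>R Ad b u + t *\<^sub>R Ad b v"
  unfolding Ad_def by (rule differential_lincomb)

text \<open>Since b a = (b a b^-1) b, pushing a fundamental field forward conjugates its generator.
  Generators fixed by \<open>Ad\<close> therefore give invariant fields.\<close>

lemma d\<Phi>_fund:
  assumes "w \<in> \<gg>" shows "d\<Phi> b (fund w p) = fund (Ad b w) (\<Phi> b p)"
proof (rule tangent_eqI)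
  show "d\<Phi> b (fund w p) \<in> tangent_space A (\<Phi> b p)"
    by (intro d\<Phi>_tangent vector_fieldsD(1) fund_vector_field assms)
  show "fund (Ad b w) (\<Phi> b p) \<in> tangent_space A (\<Phi> b p)"
    by (intro vector_fieldsD(1) fund_vector_field Ad_in assms)
  fix f assume f: "smooth_fun A f"
  have "smooth_fun B (\<lambda>a. f (\<Phi> a (\<Phi> b p)))"
    by (rule smooth_fun_compose[OF atlas_B atlas_A smooth_orbit_map f])
  then show "d\<Phi> b (fund w p) f = fund (Ad b w) (\<Phi> b p) f"
    by (simp add: differential_apply[OF f] fund_apply[OF f] fund_apply[OF smooth_fun_translate[OF f]] Ad_apply)
qed

lemma invariant_fund: "w \<in> \<gg> \<Longrightarrow> (\<And>b. Ad b w = w) \<Longrightarrow> invariant (fund w)"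
  unfolding invariant_def using d\<Phi>_fund by simp

lemma linv_lie_algebra:
  assumes w: "w \<in> \<gg>" shows "linv w \<in> lie_algebra G B"
proof -
  have vf: "linv w \<in> vector_fields B"
  proof (rule vector_fieldsI)
    show "linv w b \<in> tangent_space B b" for b
      using differential_tangent[OF atlas_B atlas_B smooth_left w, of b] by (simp add: linv_def)
    fix h assume h: "smooth_fun B h"
    have "smooth_fun (prod_atlas B B) (\<lambda>z. h (snd z \<cdot> fst z))"
      by (rule smooth_fun_compose[OF _ atlas_B _ h]) (intro smooth_map_intros)+
    from smooth_fun_parametric[OF atlas_B atlas_B this w] show "smooth_fun B (\<lambda>b. linv w b h)"
      by (simp add: linv_apply[OF h])
  qed
  have "differential B (\<lambda>c. a \<cdot> c) (linv w b) = linv w (a \<cdot> b)" for a b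
    using differential_compose[OF atlas_B atlas_B smooth_left, of a "\<lambda>c. b \<cdot> c" w] by (simp add: linv_def)
  then show ?thesis using vf by (simp add: lie_algebra_def)
qed

lemma lie_algebra_linv:
  assumes "\<zeta> \<in> lie_algebra G B" shows "\<zeta> un \<in> \<gg>" "\<zeta> = linv (\<zeta> un)"
proof -
  show "\<zeta> un \<in> \<gg>" using assms vector_fieldsD(1) by (auto simp: lie_algebra_def)
  show "\<zeta> = linv (\<zeta> un)"
  proof
    fix b
    have "differential B (\<lambda>c. b \<cdot> c) (\<zeta> un) = \<zeta> (b \<cdot> un)" using assms by (simp only: lie_algebra_def mem_Collect_eq)
    then show "\<zeta> b = linv (\<zeta> un) b" by (simp add: linv_def)
  qed
qed

lemma tangent_inverse:
  assumes w: "w \<in> \<gg>" and k: "smooth_fun B k"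
  shows "w (\<lambda>c. k (iv c)) = - w k"
proof -
  have K: "smooth_fun (prod_atlas B B) (\<lambda>z. k (fst z \<cdot> iv (snd z)))"
    by (rule smooth_fun_compose[OF _ atlas_B _ k]) (intro smooth_map_intros)+
  from tangent_diagonal[OF atlas_B K w] show ?thesis by (simp add: tangent_const[OF w])
qed

text \<open>At the identity the bracket of two left-invariant fields compares the two orders of
  differentiating a function of a product. \<open>tangent_interchange\<close> aligns the
  derivations, so that only the order of the factors differs.\<close>

lemma center_commute:
  assumes \<zeta>: "\<zeta> \<in> lie_algebra_center G B" and w: "w \<in> \<gg>" and k: "smooth_fun B k"
  shows "w (\<lambda>c. \<zeta> un (\<lambda>a. k (c \<cdot> a))) = w (\<lambda>c. \<zeta> un (\<lambda>a. k (a \<cdot> c)))"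
proof -
  have \<zeta>L: "\<zeta> \<in> lie_algebra G B" using \<zeta> by (simp add: lie_algebra_center_def)
  have br: "lie_bracket \<zeta> (linv w) = 0" using \<zeta> linv_lie_algebra[OF w] by (simp add: lie_algebra_center_def)
  define v where "v = \<zeta> un"
  have v: "v \<in> \<gg>" and \<zeta>v: "\<zeta> = linv v" unfolding v_def using lie_algebra_linv[OF \<zeta>L] by auto
  have un: "linv u un h = u h" if "u \<in> \<gg>" for u h
    using differential_ident[OF that] by (simp add: linv_def)
  have K: "smooth_fun (prod_atlas B B) (\<lambda>z. k (fst z \<cdot> snd z))"
    by (rule smooth_fun_compose[OF _ atlas_B _ k]) (intro smooth_map_intros)+
  have "lie_bracket \<zeta> (linv w) un k = 0" using br by simp
  then have "v (\<lambda>q. linv w q k) = w (\<lambda>q. linv v q k)"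
    unfolding \<zeta>v lie_bracket_def by (simp add: un[OF v] un[OF w])
  then have "v (\<lambda>a. w (\<lambda>c. k (a \<cdot> c))) = w (\<lambda>c. v (\<lambda>a. k (c \<cdot> a)))"
    by (simp add: linv_apply[OF k])
  then show ?thesis
    using tangent_interchange[OF atlas_B atlas_B K v w] by (simp add: v_def)
qed

text \<open>The value of \<open>Ad b (\<zeta> un)\<close> on a test function is a smooth function of
  b. Its derivative vanishes everywhere because the infinitesimal adjoint action on a central
  element is zero, and connectedness makes it constant.\<close>

lemma center_Ad:
  assumes conn: "connected (UNIV :: 'g set)" and \<zeta>: "\<zeta> \<in> lie_algebra_center G B"
  shows "Ad b (\<zeta> un) = \<zeta> un"
proof -
  define v where "v = \<zeta> un"
  have v: "v \<in> \<gg>" unfolding v_def using lie_algebra_linv(1) \<zeta> by (simp add: lie_algebra_center_def)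
  have "v (\<lambda>a. h (b \<cdot> (a \<cdot> iv b))) = v h" if h: "smooth_fun B h" for h
  proof -
    define f where "f b = v (\<lambda>a. h (b \<cdot> (a \<cdot> iv b)))" for b
    have "smooth_fun (prod_atlas B B) (\<lambda>z. h (snd z \<cdot> (fst z \<cdot> iv (snd z))))"
      by (rule smooth_fun_compose[OF _ atlas_B _ h]) (intro smooth_map_intros)+
    from smooth_fun_parametric[OF atlas_B atlas_B this v] have f: "smooth_fun B f" by (simp add: f_def[abs_def])
    have "u f = 0" if u: "u \<in> tangent_space B b" for u b
    proof -
      \<comment> \<open>Left translation by the inverse of b reduces everything to a derivative at
        the identity; \<open>k\<close> absorbs the conjugation by b into the test function.\<close>
      define w where "w = differential B (\<lambda>d. iv b \<cdot> d) u"
      have w: "w \<in> \<gg>" unfolding w_def using differential_tangent[OF atlas_B atlas_B smooth_left u, of "iv b"] by simp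
      define k where "k x = h (b \<cdot> (x \<cdot> iv b))" for x
      have k: "smooth_fun B k" unfolding k_def[abs_def]
        by (rule smooth_fun_compose[OF _ atlas_B _ h]) (intro smooth_map_intros)+
      have fb: "smooth_fun B (\<lambda>c. f (b \<cdot> c))" by (rule smooth_fun_compose[OF atlas_B atlas_B smooth_left f])
      have "u f = w (\<lambda>c. f (b \<cdot> c))" by (simp add: w_def differential_apply[OF fb])
      also have "\<dots> = w (\<lambda>c. v (\<lambda>a. k (c \<cdot> (a \<cdot> iv c))))" by (simp add: f_def k_def)
      \<comment> \<open>Product rule for the two occurrences of c in the conjugation. Separating
        them takes smoothness in three independent group variables.\<close>
      also have "\<dots> = w (\<lambda>c. v (\<lambda>a. k (c \<cdot> (a \<cdot> iv un)))) + w (\<lambda>c. v (\<lambda>a. k (un \<cdot> (a \<cdot> iv c))))"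
      proof -
        have "smooth_fun (prod_atlas B (prod_atlas B B)) (\<lambda>z. k (fst (snd z) \<cdot> (fst z \<cdot> iv (snd (snd z)))))"
        proof (rule smooth_fun_compose[OF smooth_atlas_prod[OF atlas_B atlases(4)] atlas_B _ k])
          have s: "smooth_map (prod_atlas B (prod_atlas B B)) (prod_atlas B B) snd"
            by (rule smooth_map_snd[OF atlas_B atlases(4)])
          show "smooth_map (prod_atlas B (prod_atlas B B)) B (\<lambda>z. fst (snd z) \<cdot> (fst z \<cdot> iv (snd (snd z))))"
            by (intro smooth_map_mul smooth_map_iv smooth_map_fst smooth_atlas_prod atlas_B
                smooth_map_compose[OF smooth_atlas_prod[OF atlas_B atlases(4)] atlases(4) atlas_B s smooth_map_fst[OF atlas_B atlas_B]]
                smooth_map_compose[OF smooth_atlas_prod[OF atlas_B atlases(4)] atlases(4) atlas_B s smooth_map_snd[OF atlas_B atlas_B]])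
        qed
        from smooth_fun_parametric[OF atlas_B atlases(4) this v]
        have "smooth_fun (prod_atlas B B) (\<lambda>z. v (\<lambda>a. k (fst z \<cdot> (a \<cdot> iv (snd z)))))" by simp
        from tangent_diagonal[OF atlas_B this w] show ?thesis by simp
      qed
      also have "w (\<lambda>c. v (\<lambda>a. k (un \<cdot> (a \<cdot> iv c)))) = - w (\<lambda>c. v (\<lambda>a. k (a \<cdot> c)))"
      proof -
        have "smooth_fun (prod_atlas B B) (\<lambda>z. k (fst z \<cdot> snd z))"
          by (rule smooth_fun_compose[OF _ atlas_B _ k]) (intro smooth_map_intros)+
        from tangent_inverse[OF w smooth_fun_parametric[OF atlas_B atlas_B this v]] show ?thesis by simp
      qed
      also have "w (\<lambda>c. v (\<lambda>a. k (c \<cdot> (a \<cdot> iv un)))) = w (\<lambda>c. v (\<lambda>a. k (a \<cdot> c)))"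
        using center_commute[OF \<zeta> w k] by (simp add: v_def)
      finally show ?thesis by simp
    qed
    then have "f b = f un" by (rule smooth_fun_locally_constant[OF atlas_B f conn])
    then show ?thesis by (simp add: f_def)
  qed
  then show ?thesis unfolding v_def[symmetric]
    by (intro tangent_eqI[OF Ad_in[OF v] v]) (simp add: Ad_apply)
qed

text \<open>Were v nonzero, Euler polygons of its left-invariant field would yield some b other than
  the identity that no first integral of this field separates from it. The functions
  \<open>f (\<Phi> a p)\<close> of a are such first integrals, so b would act trivially, against
  faithfulness.\<close>

lemma fund_injective:
  assumes faithful: "\<And>a. (\<And>p. \<Phi> a p = p) \<Longrightarrow> a = un" and v: "v \<in> \<gg>" and zero: "\<And>p. fund v p = 0"
  shows "v = 0"
proof (rule ccontr)
  assume "v \<noteq> 0"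
  obtain U \<phi> where U: "(U, \<phi>) \<in> B" "un \<in> U" using smooth_atlas_covers[OF atlas_B] .
  obtain r x E where cp: "coord_patch B U \<phi> (\<phi> un) r x E" using coord_patch_exists[OF atlas_B U] by blast
  note P = coord_patchD[OF cp] and cU = smooth_atlasD[OF atlas_B U(1)]
  let ?y0 = "\<phi> un"
  have pb: "?y0 \<in> ball ?y0 r" using P(2) by simp
  have lvf: "linv v \<in> vector_fields B" using linv_lie_algebra[OF v] by (simp add: lie_algebra_def)
  have lun: "linv v un = v" using differential_ident[OF v] by (simp add: linv_def)
  define V where "V y = (\<Sum>i\<in>Basis. linv v (inv_into U \<phi> y) (x i) *\<^sub>R i)" for y
  have sub: "cball ?y0 (r / 2) \<subseteq> ball ?y0 r" using P(2) by auto
  have "continuous_on (\<phi> ` U) (\<lambda>y. ((\<lambda>b. linv v b (x i)) \<circ> inv_into U \<phi>) y)" if "i \<in> Basis" for i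
    using smooth_on_continuous[OF smooth_fun_chart[OF vector_fieldsD(2)[OF lvf P(4)[OF that]] U(1)]] by simp
  then have "continuous_on (\<phi> ` U) V" unfolding V_def[abs_def] by (intro continuous_intros) simp
  then have cV: "continuous_on (cball ?y0 (r / 2)) V" using continuous_on_subset sub P(3) by blast
  have "V ?y0 \<noteq> 0"
  proof
    assume "V ?y0 = 0"
    then have "(\<Sum>i\<in>Basis. v (x i) *\<^sub>R i) = 0" by (simp add: V_def inv_into_f_f[OF cU(5) U(2)] lun)
    then have "v (x i) = 0" if "i \<in> Basis" for i
      using that by (metis inner_zero_left inner_sum_left_Basis)
    then show False using tangent_expand[OF atlas_B cp U(2) pb v] \<open>v \<noteq> 0\<close> by simp
  qed
  from euler_polygon[OF _ open_ball sub cV this] P(2)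
  obtain y where y: "y \<in> cball ?y0 (r / 2)" "y \<noteq> ?y0"
    and yF: "\<And>F::'d \<Rightarrow> real. smooth_on (ball ?y0 r) F \<Longrightarrow> (\<forall>y\<in>cball ?y0 (r / 2). frechet_derivative F (at y) (V y) = 0) \<Longrightarrow> F y = F ?y0"
    by auto
  define b where "b = inv_into U \<phi> y"
  have yU: "y \<in> \<phi> ` U" using y sub P(3) by blast
  have "\<phi> b = y" unfolding b_def by (rule f_inv_into_f[OF yU])
  then have "b \<noteq> un" using y(2) by auto
  moreover have "\<Phi> b p = p" for p
  proof (rule ccontr)
    assume "\<Phi> b p \<noteq> p"
    then obtain f where f: "smooth_fun A f" "f (\<Phi> b p) \<noteq> f p" using smooth_funs_separate[OF atlas_A] by blast
    define h where "h a = f (\<Phi> a p)" for a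
    have h: "smooth_fun B h" unfolding h_def[abs_def] by (rule smooth_fun_compose[OF atlas_B atlas_A smooth_orbit_map f(1)])
    have "(h \<circ> inv_into U \<phi>) y = (h \<circ> inv_into U \<phi>) ?y0"
    proof (rule yF)
      show "smooth_on (ball ?y0 r) (h \<circ> inv_into U \<phi>)" by (rule smooth_on_subset[OF smooth_fun_chart[OF h U(1)] P(3)])
      show "\<forall>y\<in>cball ?y0 (r / 2). frechet_derivative (h \<circ> inv_into U \<phi>) (at y) (V y) = 0"
      proof
        fix z assume z: "z \<in> cball ?y0 (r / 2)"
        then have zU: "z \<in> \<phi> ` U" using sub P(3) by blast
        let ?c = "inv_into U \<phi> z"
        have c: "?c \<in> U" "\<phi> ?c = z" using zU by (auto simp: inv_into_into f_inv_into_f)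
        have "linv v ?c h = frechet_derivative (h \<circ> inv_into U \<phi>) (at z) (V z)"
          using tangent_coord_formula[OF atlas_B cp c(1) _ vector_fieldsD(1)[OF lvf] h] c(2) z sub by (auto simp: V_def)
        \<comment> \<open>Left translation by c amounts to composing the test function with
          \<open>\<Phi> c\<close>, so \<open>fund v p = 0\<close> yields vanishing at every group
          element.\<close>
        moreover have "linv v ?c h = fund v p (\<lambda>q. f (\<Phi> ?c q))"
          by (simp add: linv_apply[OF h] fund_apply[OF smooth_fun_translate[OF f(1)]] h_def)
        ultimately show "frechet_derivative (h \<circ> inv_into U \<phi>) (at z) (V z) = 0" using zero[of p] by simp
      qed
    qed
    then have "h b = h un" by (simp add: b_def inv_into_f_f[OF cU(5) U(2)])
    then show False using f(2) by (simp add: h_def)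
  qed
  ultimately show False using faithful by blast
qed

end

section \<open>Closed 1-forms: local primitives and orbits\<close>

lemma coord_fields_commute:
  fixes A :: "('m::{t2_space,second_countable_topology}, 'e::euclidean_space) atlas"
  assumes A: "smooth_atlas A" and cp: "coord_patch A U \<phi> y0 r x E" and q: "q \<in> U" "\<phi> q \<in> ball y0 r"
    and i: "i \<in> Basis" and j: "j \<in> Basis"
  shows "lie_bracket (E i) (E j) q = 0"
proof (rule tangent_eqI)
  note P = coord_patchD[OF cp] and cU = smooth_atlasD[OF A coord_patchD(1)[OF cp]]
  show "lie_bracket (E i) (E j) q \<in> tangent_space A q"
    by (intro vector_fieldsD(1) lie_bracket_vector_field A P(5) i j)
  show "0 \<in> tangent_space A q" by (rule tangent_space_zero)
  fix f assume f: "smooth_fun A f"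
  let ?f = "f \<circ> inv_into U \<phi>"
  have sf: "smooth_on (ball y0 r) ?f" by (rule smooth_on_subset[OF smooth_fun_chart[OF f P(1)] P(3)])
  have *: "E i q (\<lambda>q. E j q f) = frechet_derivative (\<lambda>y. frechet_derivative ?f (at y) j) (at (\<phi> q)) i"
    if i: "i \<in> Basis" and j: "j \<in> Basis" for i j
  proof -
    have "E i q (\<lambda>q. E j q f) = frechet_derivative ((\<lambda>q. E j q f) \<circ> inv_into U \<phi>) (at (\<phi> q)) i"
      by (rule P(7)[OF q i vector_fieldsD(2)[OF P(5)[OF j] f]])
    also have "\<dots> = frechet_derivative (\<lambda>y. frechet_derivative ?f (at y) j) (at (\<phi> q)) i"
    proof (subst frechet_derivative_cong_open[OF open_ball q(2)])
      fix y assume y: "y \<in> ball y0 r"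
      then have "y \<in> \<phi> ` U" using P(3) by blast
      then have "inv_into U \<phi> y \<in> U" "\<phi> (inv_into U \<phi> y) = y" by (auto simp: inv_into_into f_inv_into_f)
      then show "((\<lambda>q. E j q f) \<circ> inv_into U \<phi>) y = frechet_derivative ?f (at y) j"
        using P(7)[OF _ _ j f, of "inv_into U \<phi> y"] y by simp
    qed simp
    finally show ?thesis .
  qed
  show "lie_bracket (E i) (E j) q f = 0 f"
    unfolding lie_bracket_def *[OF i j] *[OF j i] symmetric_second_derivative[OF open_ball sf q(2), of j i] by simp
qed

text \<open>Coordinate fields commute, so closedness on them is equality of the cross derivatives of
  the components, the hypothesis of \<open>poincare_one_form\<close>.\<close>

lemma closed_one_form_local_primitive:
  fixes A :: "('m::{t2_space,second_countable_topology}, 'e::euclidean_space) atlas"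
  assumes A: "smooth_atlas A" and cp: "coord_patch A U \<phi> y0 r x E"
    and \<theta>: "one_form A \<theta>"
    and closed: "\<And>X Y p. X \<in> vector_fields A \<Longrightarrow> Y \<in> vector_fields A \<Longrightarrow> ext_d1 \<theta> X Y p = 0"
  shows "\<exists>F. \<forall>q\<in>U. \<phi> q \<in> ball y0 r \<longrightarrow>
    (F has_derivative (\<lambda>v. \<Sum>i\<in>Basis. (v \<bullet> i) * \<theta> q (E i q))) (at (\<phi> q))"
proof -
  note P = coord_patchD[OF cp] and cU = smooth_atlasD[OF A coord_patchD(1)[OF cp]]
  define th where "th i = (\<lambda>q. \<theta> q (E i q)) \<circ> inv_into U \<phi>" for i
  have s: "smooth_on (ball y0 r) (th i)" if "i \<in> Basis" for i unfolding th_def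
    by (rule smooth_on_subset[OF smooth_fun_chart[OF one_formD(2)[OF \<theta> P(5)[OF that]] P(1)] P(3)])
  have cl: "frechet_derivative (th i) (at y) j = frechet_derivative (th j) (at y) i"
    if i: "i \<in> Basis" and j: "j \<in> Basis" and y: "y \<in> ball y0 r" for i j y
  proof -
    let ?q = "inv_into U \<phi> y"
    have yU: "y \<in> \<phi> ` U" using P(3) y by blast
    then have q: "?q \<in> U" "\<phi> ?q = y" by (auto simp: inv_into_into f_inv_into_f)
    have qb: "\<phi> ?q \<in> ball y0 r" using q y by simp
    have d: "E j ?q (\<lambda>q. \<theta> q (E i q)) = frechet_derivative (th i) (at y) j" if "i \<in> Basis" "j \<in> Basis" for i j
      using P(7)[OF q(1) qb that(2) one_formD(2)[OF \<theta> P(5)[OF that(1)]]] q(2) by (simp add: th_def)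
    have "\<theta> ?q 0 = 0" using one_formD(1)[OF \<theta> tangent_space_zero tangent_space_zero, of ?q 0 0] by simp
    then show ?thesis
      using closed[OF P(5)[OF i] P(5)[OF j], of ?q] d[OF i j] d[OF j i] coord_fields_commute[OF A cp q(1) qb i j]
      by (simp add: ext_d1_def)
  qed
  obtain F where F: "\<And>y. y \<in> ball y0 r \<Longrightarrow> (F has_derivative (\<lambda>v. \<Sum>i\<in>Basis. (v \<bullet> i) * th i y)) (at y)"
    using poincare_one_form[of y0 r th, OF s cl] by blast
  show ?thesis
  proof (intro exI ballI impI)
    fix q assume q: "q \<in> U" "\<phi> q \<in> ball y0 r"
    show "(F has_derivative (\<lambda>v. \<Sum>i\<in>Basis. (v \<bullet> i) * \<theta> q (E i q))) (at (\<phi> q))"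
      using F[OF q(2)] q(1) by (simp add: th_def inv_into_f_f[OF cU(5)])
  qed
qed

text \<open>Constancy will be available only along a sequence of points, those reached by group
  elements near the identity. For a differentiable function this already kills the directional
  derivative.\<close>

lemma has_derivative_zero_if_constant_on_sequence:
  fixes F :: "'a::real_normed_vector \<Rightarrow> real"
  assumes F: "(F has_derivative D) (at y)" and t: "t \<longlonglongrightarrow> 0" "\<And>n. t n \<noteq> 0"
    and ev: "eventually (\<lambda>n. F (y + t n *\<^sub>R c) = F y) sequentially"
  shows "D c = 0"
proof -
  have "((\<lambda>s. y + s *\<^sub>R c) has_derivative (\<lambda>h. h *\<^sub>R c)) (at 0)" by (auto intro!: derivative_eq_intros)
  moreover have "(F has_derivative D) (at (y + 0 *\<^sub>R c))" using F by simp
  ultimately have "((\<lambda>s. F (y + s *\<^sub>R c)) has_derivative (\<lambda>h. D (h *\<^sub>R c))) (at 0)"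
    by (rule has_derivative_compose)
  moreover have "(\<lambda>h. D (h *\<^sub>R c)) = (*) (D c)"
    using linear_cmul[OF has_derivative_linear[OF F]] by (auto simp: mult.commute)
  ultimately have "((\<lambda>s. F (y + s *\<^sub>R c)) has_real_derivative D c) (at 0)" by (simp add: has_field_derivative_def)
  then have "((\<lambda>h. (F (y + h *\<^sub>R c) - F y) / h) \<longlongrightarrow> D c) (at 0)" by (simp add: DERIV_def)
  moreover have "filterlim t (at 0) sequentially" using t by (simp add: filterlim_at)
  ultimately have "((\<lambda>n. (F (y + t n *\<^sub>R c) - F y) / t n) \<longlonglongrightarrow> D c)" by (rule filterlim_compose)
  moreover have "((\<lambda>n. (F (y + t n *\<^sub>R c) - F y) / t n) \<longlonglongrightarrow> 0)"
    by (rule Lim_transform_eventually[OF tendsto_const]) (use ev in \<open>auto elim: eventually_mono\<close>)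
  ultimately show ?thesis by (rule LIMSEQ_unique)
qed

context lie_action
begin

text \<open>Cartan's formula: the differential of \<open>\<theta> (fund w)\<close> is the Lie
  derivative of \<theta> minus the contraction of its exterior derivative, and both are
  zero.\<close>

lemma fund_one_form_constant:
  assumes \<theta>: "one_form A \<theta>"
    and closed: "\<And>X Y p. X \<in> vector_fields A \<Longrightarrow> Y \<in> vector_fields A \<Longrightarrow> ext_d1 \<theta> X Y p = 0"
    and inv: "\<And>a p u. u \<in> tangent_space A p \<Longrightarrow> \<theta> (\<Phi> a p) (d\<Phi> a u) = \<theta> p u"
    and conn: "connected (UNIV :: 'm set)" and w: "w \<in> \<gg>"
  shows "\<theta> p (fund w p) = \<theta> q (fund w q)"
proof (rule smooth_fun_locally_constant[OF atlas_A one_formD(2)[OF \<theta> fund_vector_field[OF w]] conn])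
  fix p u assume u: "u \<in> tangent_space A p"
  obtain Y where Y: "Y \<in> vector_fields A" "Y p = u" using tangent_extends[OF atlas_A u] .
  show "u (\<lambda>p. \<theta> p (fund w p)) = 0"
    using closed[OF fund_vector_field[OF w] Y(1), of p] lie_derivative_one_form[OF w Y(1) \<theta> inv, of p] Y(2)
    by (simp add: ext_d1_def)
qed

text \<open>The derivative of the orbit map takes values in the fundamental vectors at every group
  element b, not only at the identity: right translation by the inverse of b carries a tangent
  vector at b to the generator.\<close>

lemma orbit_chart_derivative:
  assumes cp: "coord_patch A U \<phi> y0 r x E" and V: "(V, \<psi>) \<in> B" and b: "b \<in> V"
    and q: "\<Phi> b p \<in> U" "\<phi> (\<Phi> b p) \<in> ball y0 r"
  shows "\<exists>D. ((\<lambda>y. \<phi> (\<Phi> (inv_into V \<psi> y) p)) has_derivative D) (at (\<psi> b)) \<and>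
    (\<forall>c. \<exists>w\<in>\<gg>. \<forall>i\<in>Basis. D c \<bullet> i = fund w (\<Phi> b p) (x i))"
proof -
  note P = coord_patchD[OF cp] and cU = smooth_atlasD[OF atlas_A coord_patchD(1)[OF cp]]
    and cV = smooth_atlasD[OF atlas_B V]
  let ?\<pi> = "\<lambda>y. \<phi> (\<Phi> (inv_into V \<psi> y) p)"
  let ?T = "\<psi> ` (V \<inter> (\<lambda>a. \<Phi> a p) -` U)"
  have sT: "smooth_on ?T ?\<pi>"
    using smooth_mapD(2)[OF smooth_orbit_map V P(1), of p] by (simp add: o_def)
  have yT: "\<psi> b \<in> ?T" using b q by blast
  note D = smooth_on_has_derivative[OF sT yT]
  obtain s x' E' where cpB: "coord_patch B V \<psi> (\<psi> b) s x' E'" using coord_patch_exists[OF atlas_B V b] by blast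
  note P' = coord_patchD[OF cpB]
  have bb: "\<psi> b \<in> ball (\<psi> b) s" using P'(2) by simp
  have bV: "\<psi> b \<in> \<psi> ` V" using b by blast
  have "\<exists>w\<in>\<gg>. \<forall>i\<in>Basis. frechet_derivative ?\<pi> (at (\<psi> b)) c \<bullet> i = fund w (\<Phi> b p) (x i)" for c
  proof -
    define t where "t = (\<Sum>i\<in>Basis. (c \<bullet> i) *\<^sub>R E' i b)"
    have t: "t \<in> tangent_space B b" unfolding t_def
      by (intro tangent_space_sum tangent_space_scaleR vector_fieldsD(1) P'(5))
    have th: "t h = frechet_derivative (h \<circ> inv_into V \<psi>) (at (\<psi> b)) c" if h: "smooth_fun B h" for h
    proof -
      have "t h = (\<Sum>i\<in>Basis. (c \<bullet> i) * E' i b h)"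
      proof -
        have "(\<Sum>i\<in>I. (c \<bullet> i) *\<^sub>R E' i b) h = (\<Sum>i\<in>I. (c \<bullet> i) * E' i b h)" for I
          by (induction I rule: infinite_finite_induct) (auto simp: scaleR_fun_def)
        then show ?thesis by (simp add: t_def)
      qed
      also have "\<dots> = (\<Sum>i\<in>Basis. (c \<bullet> i) * frechet_derivative (h \<circ> inv_into V \<psi>) (at (\<psi> b)) i)"
        by (intro sum.cong refl arg_cong2[where f="(*)"] P'(7) b bb h)
      also have "\<dots> = frechet_derivative (h \<circ> inv_into V \<psi>) (at (\<psi> b)) c"
        using frechet_derivative_expand[OF smooth_fun_chart[OF h V] bV, of c] by simp
      finally show ?thesis .
    qed
    define w where "w = differential B (\<lambda>a. a \<cdot> iv b) t"
    have "smooth_map B B (\<lambda>a. a \<cdot> iv b)" by (intro smooth_map_intros)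
    from differential_tangent[OF atlas_B atlas_B this t] have w: "w \<in> \<gg>" by (simp add: w_def)
    moreover have "frechet_derivative ?\<pi> (at (\<psi> b)) c \<bullet> i = fund w (\<Phi> b p) (x i)" if i: "i \<in> Basis" for i
    proof -
      have so: "smooth_fun B (\<lambda>a. x i (\<Phi> a q))" for q
        by (rule smooth_fun_compose[OF atlas_B atlas_A smooth_orbit_map P(4)[OF i]])
      have "fund w (\<Phi> b p) (x i) = t (\<lambda>a. x i (\<Phi> a p))"
        by (simp add: fund_apply[OF P(4)[OF i]] w_def differential_apply[OF so])
      also have "\<dots> = frechet_derivative ((\<lambda>a. x i (\<Phi> a p)) \<circ> inv_into V \<psi>) (at (\<psi> b)) c" by (rule th[OF so])
      also have "\<dots> = frechet_derivative (\<lambda>y. ?\<pi> y \<bullet> i) (at (\<psi> b)) c"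
      proof (subst frechet_derivative_cong_open)
        let ?N = "U \<inter> \<phi> -` ball y0 r"
        have "open ((\<lambda>a. \<Phi> a p) -` ?N)"
          by (rule open_vimage[OF open_chart_preimage[OF atlas_A P(1) open_ball] smooth_mapD(1)[OF smooth_orbit_map]])
        then show "open (\<psi> ` (V \<inter> (\<lambda>a. \<Phi> a p) -` ?N))" by (rule open_chart_image[OF atlas_B V])
        show "\<psi> b \<in> \<psi> ` (V \<inter> (\<lambda>a. \<Phi> a p) -` ?N)" using b q by blast
        show "((\<lambda>a. x i (\<Phi> a p)) \<circ> inv_into V \<psi>) y = ?\<pi> y \<bullet> i" if "y \<in> \<psi> ` (V \<inter> (\<lambda>a. \<Phi> a p) -` ?N)" for y
          using that P(6)[OF _ _ i] by (auto simp: inv_into_f_f[OF cV(5)])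
      qed simp
      also have "\<dots> = frechet_derivative ?\<pi> (at (\<psi> b)) c \<bullet> i"
        by (rule frechet_derivative_eqI[OF has_derivative_inner_left[OF D]])
      finally show ?thesis by simp
    qed
    ultimately show ?thesis by blast
  qed
  then show ?thesis using D by blast
qed

text \<open>Serves in place of openness of orbit maps. Elements carrying p to the points q n
  subconverge, by compactness, to some h fixing p; multiplying by the inverse of h on the right
  makes them tend to the identity without changing where they send p.\<close>

lemma orbit_approximation:
  assumes comp: "compact (UNIV :: 'g set)" and trans: "\<And>p q. \<exists>a. \<Phi> a p = q" and q: "q \<longlonglongrightarrow> p"
  shows "\<exists>\<sigma> a. strict_mono (\<sigma> :: nat \<Rightarrow> nat) \<and> a \<longlonglongrightarrow> un \<and> (\<forall>n. \<Phi> (a n) p = q (\<sigma> n))"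
proof -
  define b where "b n = (SOME a. \<Phi> a p = q n)" for n
  have b: "\<Phi> (b n) p = q n" for n unfolding b_def by (rule someI_ex[OF trans])
  have "seq_compact (UNIV :: 'g set)" using comp by (rule compact_imp_seq_compact)
  then obtain h \<sigma> where h: "strict_mono (\<sigma> :: nat \<Rightarrow> nat)" "(b \<circ> \<sigma>) \<longlonglongrightarrow> h"
    unfolding seq_compact_def by blast
  have cont: "isCont (\<lambda>a. \<Phi> a p) h" "isCont (\<lambda>a. a \<cdot> iv h) h"
  proof -
    show "isCont (\<lambda>a. \<Phi> a p) h"
      using smooth_mapD(1)[OF smooth_orbit_map, of p] by (simp add: continuous_on_eq_continuous_at)
    have "smooth_map B B (\<lambda>a. a \<cdot> iv h)" by (intro smooth_map_intros)
    from smooth_mapD(1)[OF this] show "isCont (\<lambda>a. a \<cdot> iv h) h" by (simp add: continuous_on_eq_continuous_at)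
  qed
  have "(\<lambda>n. \<Phi> ((b \<circ> \<sigma>) n) p) \<longlonglongrightarrow> \<Phi> h p" by (rule isCont_tendsto_compose[OF cont(1) h(2)])
  moreover have "(\<lambda>n. \<Phi> ((b \<circ> \<sigma>) n) p) \<longlonglongrightarrow> p"
    using LIMSEQ_subseq_LIMSEQ[OF q h(1)] by (simp add: b o_def)
  ultimately have hp: "\<Phi> h p = p" by (rule LIMSEQ_unique)
  then have hp': "\<Phi> (iv h) p = p" by (metis action_simps(3))
  have "(\<lambda>n. (b \<circ> \<sigma>) n \<cdot> iv h) \<longlonglongrightarrow> h \<cdot> iv h" by (rule isCont_tendsto_compose[OF cont(2) h(2)])
  then show ?thesis using h(1) b hp'
    by (intro exI[of _ \<sigma>] exI[of _ "\<lambda>n. (b \<circ> \<sigma>) n \<cdot> iv h"]) simp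
qed

text \<open>
  A closed form that vanishes on the fundamental fields has a local primitive that is constant
  on a neighbourhood in the orbit, so by transitivity the form itself vanishes.
\<close>

lemma one_form_vanishing_on_fund:
  assumes comp: "compact (UNIV :: 'g set)" and trans: "\<And>p q. \<exists>a. \<Phi> a p = q"
    and \<theta>: "one_form A \<theta>"
    and closed: "\<And>X Y p. X \<in> vector_fields A \<Longrightarrow> Y \<in> vector_fields A \<Longrightarrow> ext_d1 \<theta> X Y p = 0"
    and zero: "\<And>q w. w \<in> \<gg> \<Longrightarrow> \<theta> q (fund w q) = 0"
    and u: "u \<in> tangent_space A p"
  shows "\<theta> p u = 0"
proof -
  obtain U \<phi> where U: "(U, \<phi>) \<in> A" "p \<in> U" using smooth_atlas_covers[OF atlas_A] .
  obtain r x E where cp: "coord_patch A U \<phi> (\<phi> p) r x E" using coord_patch_exists[OF atlas_A U] by blast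
  note P = coord_patchD[OF cp] and cU = smooth_atlasD[OF atlas_A U(1)]
  let ?y0 = "\<phi> p" let ?b = "ball (\<phi> p) r" let ?N = "U \<inter> \<phi> -` ?b"
  have pb: "?y0 \<in> ?b" using P(2) by simp
  have Ep: "E i q \<in> tangent_space A q" if "i \<in> Basis" for i q using vector_fieldsD(1)[OF P(5)[OF that]] .
  obtain F where F: "\<And>q. q \<in> U \<Longrightarrow> \<phi> q \<in> ?b \<Longrightarrow> (F has_derivative (\<lambda>v. \<Sum>i\<in>Basis. (v \<bullet> i) * \<theta> q (E i q))) (at (\<phi> q))"
    using closed_one_form_local_primitive[OF atlas_A cp \<theta> closed] by blast
  have ex: "\<theta> q v = (\<Sum>i\<in>Basis. v (x i) * \<theta> q (E i q))" if "q \<in> U" "\<phi> q \<in> ?b" and v: "v \<in> tangent_space A q" for q v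
    by (subst tangent_expand[OF atlas_A cp that], rule tangent_linear_sum[OF one_formD(1)[OF \<theta>] Ep])
  obtain V \<psi> where V: "(V, \<psi>) \<in> B" "un \<in> V" using smooth_atlas_covers[OF atlas_B] .
  note cV = smooth_atlasD[OF atlas_B V(1)]
  let ?W = "V \<inter> (\<lambda>a. \<Phi> a p) -` ?N"
  have "open ((\<lambda>a. \<Phi> a p) -` ?N)"
    by (rule open_vimage[OF open_chart_preimage[OF atlas_A P(1) open_ball] smooth_mapD(1)[OF smooth_orbit_map]])
  then have "open (\<psi> ` ?W)" by (rule open_chart_image[OF atlas_B V(1)])
  moreover have "\<psi> un \<in> \<psi> ` ?W" using V U pb by auto
  ultimately obtain s where s: "s > 0" "ball (\<psi> un) s \<subseteq> \<psi> ` ?W" by (rule openE)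
  \<comment> \<open>The local primitive composed with the orbit map. By
    \<open>orbit_chart_derivative\<close> its derivative consists of values of \<theta> on
    fundamental vectors, hence is zero.\<close>
  define k where "k y = F (\<phi> (\<Phi> (inv_into V \<psi> y) p))" for y
  have dk: "(k has_derivative (\<lambda>c. 0)) (at y within ball (\<psi> un) s)" if y: "y \<in> ball (\<psi> un) s" for y
  proof -
    obtain b where b: "y = \<psi> b" "b \<in> V" "\<Phi> b p \<in> U" "\<phi> (\<Phi> b p) \<in> ?b" using y s(2) by blast
    obtain D where D: "((\<lambda>y. \<phi> (\<Phi> (inv_into V \<psi> y) p)) has_derivative D) (at (\<psi> b))"
      and Dw: "\<And>c. \<exists>w\<in>\<gg>. \<forall>i\<in>Basis. D c \<bullet> i = fund w (\<Phi> b p) (x i)"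
      using orbit_chart_derivative[OF cp V(1) b(2-4)] by blast
    have inv: "inv_into V \<psi> (\<psi> b) = b" by (rule inv_into_f_f[OF cV(5) b(2)])
    have F': "(F has_derivative (\<lambda>v. \<Sum>i\<in>Basis. (v \<bullet> i) * \<theta> (\<Phi> b p) (E i (\<Phi> b p)))) (at (\<phi> (\<Phi> (inv_into V \<psi> (\<psi> b)) p)))"
      unfolding inv by (rule F[OF b(3,4)])
    have "(k has_derivative (\<lambda>c. \<Sum>i\<in>Basis. (D c \<bullet> i) * \<theta> (\<Phi> b p) (E i (\<Phi> b p)))) (at (\<psi> b))"
      unfolding k_def[abs_def] by (rule has_derivative_compose[OF D F'])
    moreover have "(\<Sum>i\<in>Basis. (D c \<bullet> i) * \<theta> (\<Phi> b p) (E i (\<Phi> b p))) = 0" for c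
    proof -
      obtain w where w: "w \<in> \<gg>" "\<And>i. i \<in> Basis \<Longrightarrow> D c \<bullet> i = fund w (\<Phi> b p) (x i)" using Dw by blast
      have "(\<Sum>i\<in>Basis. (D c \<bullet> i) * \<theta> (\<Phi> b p) (E i (\<Phi> b p))) = \<theta> (\<Phi> b p) (fund w (\<Phi> b p))"
        unfolding ex[OF b(3,4) vector_fieldsD(1)[OF fund_vector_field[OF w(1)]]] by (simp add: w(2))
      then show ?thesis using zero[OF w(1)] by simp
    qed
    ultimately show ?thesis using b(1) has_derivative_at_withinI by fastforce
  qed
  obtain k0 where k0: "\<And>y. y \<in> ball (\<psi> un) s \<Longrightarrow> k y = k0"
    using has_derivative_zero_constant[OF convex_ball dk] by blast
  define c where "c = (\<Sum>i\<in>Basis. u (x i) *\<^sub>R i)"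
  have ci: "c \<bullet> i = u (x i)" if "i \<in> Basis" for i using that by (simp add: c_def)
  \<comment> \<open>A positive null sequence with t n |c| < r: \<open>norm c + 1\<close> cannot be
    zero, and n + 2 > 1 makes the bound strict.\<close>
  define t where "t n = r / (norm c + 1) / (real n + 2)" for n
  have c1: "norm c + 1 > 0" by (simp add: add_nonneg_pos)
  have t0: "t n > 0" for n using P(2) c1 by (simp add: t_def)
  have "(\<lambda>n. r / (norm c + 1) / (real n + 2)) \<longlonglongrightarrow> 0" by real_asymp
  then have tl: "t \<longlonglongrightarrow> 0" by (simp add: t_def[abs_def])
  have tb: "?y0 + t n *\<^sub>R c \<in> ?b" for n
  proof -
    have "t n * norm c < r"
    proof -
      have "t n * norm c \<le> t n * (norm c + 1)" using t0[of n] by simp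
      also have "\<dots> = r / (real n + 2)" using c1 by (simp add: t_def)
      also have "\<dots> < r" using P(2) by (simp add: divide_less_eq)
      finally show ?thesis .
    qed
    then show ?thesis using t0[of n] by (simp add: dist_norm)
  qed
  \<comment> \<open>Points approaching p along the coordinate line in direction u. Along a
    subsequence they are images of p under group elements tending to the identity, and there the
    primitive is constant.\<close>
  define q where "q n = inv_into U \<phi> (?y0 + t n *\<^sub>R c)" for n
  have qU: "q n \<in> U" "\<phi> (q n) = ?y0 + t n *\<^sub>R c" for n
    using tb[of n] P(3) by (auto simp: q_def inv_into_into f_inv_into_f subset_iff)
  have "q \<longlonglongrightarrow> p"
  proof -
    have "isCont (inv_into U \<phi>) ?y0" using cU(2,4) U(2) by (auto simp: continuous_on_eq_continuous_at)
    moreover have "(\<lambda>n. ?y0 + t n *\<^sub>R c) \<longlonglongrightarrow> ?y0 + 0 *\<^sub>R c" by (intro tendsto_intros tl)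
    ultimately have "(\<lambda>n. inv_into U \<phi> (?y0 + t n *\<^sub>R c)) \<longlonglongrightarrow> inv_into U \<phi> ?y0"
      using isCont_tendsto_compose by fastforce
    then show ?thesis by (simp add: q_def[abs_def] inv_into_f_f[OF cU(5) U(2)])
  qed
  from orbit_approximation[OF comp trans this]
  obtain \<sigma> a where \<sigma>: "strict_mono (\<sigma> :: nat \<Rightarrow> nat)" and a: "a \<longlonglongrightarrow> un" "\<And>n. \<Phi> (a n) p = q (\<sigma> n)" by blast
  have oWs: "open (V \<inter> \<psi> -` ball (\<psi> un) s)" by (rule open_chart_preimage[OF atlas_B V(1) open_ball])
  have "eventually (\<lambda>n. a n \<in> V \<inter> \<psi> -` ball (\<psi> un) s) sequentially"
    using topological_tendstoD[OF a(1) oWs] V(2) s(1) by simp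
  then have "eventually (\<lambda>n. F (?y0 + (t \<circ> \<sigma>) n *\<^sub>R c) = F ?y0) sequentially"
  proof (rule eventually_mono)
    fix n assume n: "a n \<in> V \<inter> \<psi> -` ball (\<psi> un) s"
    have "k (\<psi> (a n)) = F (?y0 + (t \<circ> \<sigma>) n *\<^sub>R c)"
      using n inv_into_f_f[OF cV(5)] a(2)[of n] qU(2)[of "\<sigma> n"] by (simp add: k_def)
    moreover have "k (\<psi> un) = F ?y0" by (simp add: k_def inv_into_f_f[OF cV(5) V(2)])
    ultimately show "F (?y0 + (t \<circ> \<sigma>) n *\<^sub>R c) = F ?y0" using k0[of "\<psi> (a n)"] k0[of "\<psi> un"] n s(1) by simp
  qed
  moreover have "(t \<circ> \<sigma>) \<longlonglongrightarrow> 0" by (rule LIMSEQ_subseq_LIMSEQ[OF tl \<sigma>])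
  moreover have "(t \<circ> \<sigma>) n \<noteq> 0" for n using t0[of "\<sigma> n"] by simp
  ultimately have "(\<Sum>i\<in>Basis. (c \<bullet> i) * \<theta> p (E i p)) = 0"
    using has_derivative_zero_if_constant_on_sequence[OF F[OF U(2) pb]] by blast
  then show ?thesis unfolding ex[OF U(2) pb u] by (simp add: ci)
qed

text \<open>Coordinates at the identity identify the Lie algebra with a euclidean space, where
  \<open>compact_group_invariant_vector\<close> applies to the adjoint action and the linear form w
  \<mapsto> \<theta>(fund w p).\<close>

lemma exists_Ad_invariant:
  assumes comp: "compact (UNIV :: 'g set)" and \<theta>: "one_form A \<theta>"
    and Ad: "\<And>b w. w \<in> \<gg> \<Longrightarrow> \<theta> p (fund (Ad b w) p) = \<theta> p (fund w p)"
    and w: "w \<in> \<gg>" "\<theta> p (fund w p) \<noteq> 0"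
  shows "\<exists>w\<in>\<gg>. \<theta> p (fund w p) \<noteq> 0 \<and> (\<forall>b. Ad b w = w)"
proof -
  obtain U \<phi> where U: "(U, \<phi>) \<in> B" "un \<in> U" using smooth_atlas_covers[OF atlas_B] .
  obtain r x E where cp: "coord_patch B U \<phi> (\<phi> un) r x E" using coord_patch_exists[OF atlas_B U] by blast
  note P = coord_patchD[OF cp]
  have pb: "\<phi> un \<in> ball (\<phi> un) r" using P(2) by simp
  \<comment> \<open>\<open>W\<close> leads from coordinates to tangent vectors at the identity and
    \<open>C\<close> back; they are mutually inverse.\<close>
  define W where "W c = (\<Sum>i\<in>Basis. (c \<bullet> i) *\<^sub>R E i un)" for c
  define C where "C w = (\<Sum>i\<in>Basis. w (x i) *\<^sub>R i)" for w :: "'g tvec"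
  have W: "W c \<in> \<gg>" for c unfolding W_def
    by (intro tangent_space_sum tangent_space_scaleR vector_fieldsD(1) P(5))
  have WC: "W (C w) = w" if "w \<in> \<gg>" for w
    using tangent_expand[OF atlas_B cp U(2) pb that] by (simp add: W_def C_def)
  have Wlin: "W (a *\<^sub>R c + b *\<^sub>R d) = a *\<^sub>R W c + b *\<^sub>R W d" for a b c d
    by (simp add: W_def inner_add_left scaleR_add_left scaleR_sum_right sum.distrib)
  have Clin: "C (a *\<^sub>R u + b *\<^sub>R v) = a *\<^sub>R C u + b *\<^sub>R C v" for a b u v
    by (simp add: C_def scaleR_fun_def scaleR_add_left scaleR_sum_right sum.distrib)
  have CW: "C (W c) = c" for c
  proof -
    have "W c (x j) = c \<bullet> j" if j: "j \<in> Basis" for j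
    proof -
      have "W c (x j) = (\<Sum>i\<in>Basis. (c \<bullet> i) * E i un (x j))"
      proof -
        have "(\<Sum>i\<in>I. (c \<bullet> i) *\<^sub>R E i un) (x j) = (\<Sum>i\<in>I. (c \<bullet> i) * E i un (x j))" for I
          by (induction I rule: infinite_finite_induct) (auto simp: scaleR_fun_def)
        then show ?thesis by (simp add: W_def)
      qed
      also have "\<dots> = (\<Sum>i\<in>Basis. (c \<bullet> i) * (i \<bullet> j))"
      proof (intro sum.cong refl arg_cong2[where f="(*)"])
        fix i :: 'd assume i: "i \<in> Basis"
        have "((\<lambda>y. y \<bullet> j) has_derivative (\<lambda>v. v \<bullet> j)) (at (\<phi> un))" by (auto intro!: derivative_eq_intros)
        moreover have "(x j \<circ> inv_into U \<phi>) y = y \<bullet> j" if "y \<in> ball (\<phi> un) r" for y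
        proof -
          have "y \<in> \<phi> ` U" using that P(3) by blast
          then show ?thesis using P(6)[of "inv_into U \<phi> y" j] that j by (simp add: f_inv_into_f inv_into_into)
        qed
        ultimately have "(x j \<circ> inv_into U \<phi> has_derivative (\<lambda>v. v \<bullet> j)) (at (\<phi> un))"
          using has_derivative_cong_open[OF open_ball pb, of "x j \<circ> inv_into U \<phi>" "\<lambda>y. y \<bullet> j"] by simp
        then show "E i un (x j) = i \<bullet> j"
          unfolding P(7)[OF U(2) pb i P(4)[OF j]] by (rule frechet_derivative_eqI)
      qed
      also have "\<dots> = c \<bullet> j" using euclidean_inner[of c j] by (simp add: j inner_commute[of _ j])
      finally show ?thesis .
    qed
    then show ?thesis by (simp add: C_def euclidean_representation)
  qed
  define \<rho> where "\<rho> b c = C (Ad b (W c))" for b c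
  have W\<rho>: "W (\<rho> b c) = Ad b (W c)" for b c unfolding \<rho>_def by (rule WC[OF Ad_in[OF W]])
  define \<alpha> where "\<alpha> c = \<theta> p (fund (W c) p)" for c
  have fv: "fund v p \<in> tangent_space A p" if "v \<in> \<gg>" for v by (rule vector_fieldsD(1)[OF fund_vector_field[OF that]])
  have lin\<rho>: "\<rho> b (s *\<^sub>R c + t *\<^sub>R d) = s *\<^sub>R \<rho> b c + t *\<^sub>R \<rho> b d" for b s t c d
    by (simp only: \<rho>_def Wlin Ad_lincomb Clin)
  have lin\<alpha>: "\<alpha> (s *\<^sub>R c + t *\<^sub>R d) = s * \<alpha> c + t * \<alpha> d" for s t c d
    by (simp only: \<alpha>_def Wlin fund_lincomb one_formD(1)[OF \<theta> fv[OF W] fv[OF W]])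
  have "\<exists>c. \<alpha> c \<noteq> 0 \<and> (\<forall>b. \<rho> b c = c)"
  proof (rule compact_group_invariant_vector[OF comp])
    show "linear (\<rho> b)" for b
      using lin\<rho>[of b 1 _ 1] lin\<rho>[of b _ _ 0] by (intro linearI) auto
    show "linear \<alpha>"
      using lin\<alpha>[of 1 _ 1] lin\<alpha>[of _ _ 0] by (intro linearI) auto
    show "continuous_on UNIV (\<lambda>b. \<rho> b c)" for c
    proof -
      have "continuous_on UNIV (\<lambda>b. Ad b (W c) (x i))" if i: "i \<in> Basis" for i
      proof -
        have "smooth_fun (prod_atlas B B) (\<lambda>z. x i (snd z \<cdot> (fst z \<cdot> iv (snd z))))"
          by (rule smooth_fun_compose[OF _ atlas_B _ P(4)[OF i]]) (intro smooth_map_intros)+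
        from smooth_fun_parametric[OF atlas_B atlas_B this W]
        have "smooth_fun B (\<lambda>b. Ad b (W c) (x i))" by (simp add: Ad_apply[OF P(4)[OF i]])
        then show ?thesis by (rule smooth_fun_continuous[OF atlas_B])
      qed
      then show ?thesis unfolding \<rho>_def C_def by (intro continuous_intros)
    qed
    show "\<exists>c. \<forall>x. \<rho> a (\<rho> b x) = \<rho> c x" for a b
    proof (intro exI allI)
      show "\<rho> a (\<rho> b y) = \<rho> (a \<cdot> b) y" for y
        unfolding \<rho>_def[of a] W\<rho> Ad_mul by (simp add: \<rho>_def)
    qed
    show un: "\<rho> un c = c" for c by (simp add: \<rho>_def Ad_un[OF W] CW)
    show "c = 0" if "\<rho> b c = 0" for b c
    proof -
      have "\<rho> (iv b) (\<rho> b c) = \<rho> (iv b \<cdot> b) c"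
        unfolding \<rho>_def[of "iv b"] W\<rho> Ad_mul by (simp add: \<rho>_def)
      then have "c = \<rho> (iv b) 0" using that un by simp
      also have "\<dots> = 0" using lin\<rho>[of "iv b" 0 0 0 0] by simp
      finally show ?thesis .
    qed
    show "\<alpha> (\<rho> b c) = \<alpha> c" for b c by (simp add: \<alpha>_def W\<rho> Ad[OF W])
    show "\<alpha> (C w) \<noteq> 0" using w by (simp add: \<alpha>_def WC)
  qed
  then obtain c where c: "\<alpha> c \<noteq> 0" "\<And>b. \<rho> b c = c" by blast
  show ?thesis using c W\<rho> W by (intro bexI[of _ "W c"]) (auto simp: \<alpha>_def, metis)
qed

end

lemma vector_fields_lincomb2:
  assumes A: "smooth_atlas A" and X: "X \<in> vector_fields A" and Y: "Y \<in> vector_fields A"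
  shows "(\<lambda>p. a *\<^sub>R X p + b *\<^sub>R Y p) \<in> vector_fields A"
proof (rule vector_fieldsI)
  show "a *\<^sub>R X p + b *\<^sub>R Y p \<in> tangent_space A p" for p
    by (intro tangent_space_add tangent_space_scaleR vector_fieldsD(1) X Y)
  fix f assume f: "smooth_fun A f"
  have "smooth_fun A (\<lambda>p. a * X p f + b * Y p f)"
    by (intro smooth_fun_add smooth_fun_cmult A vector_fieldsD(2)[OF X f] vector_fieldsD(2)[OF Y f])
  then show "smooth_fun A (\<lambda>p. (a *\<^sub>R X p + b *\<^sub>R Y p) f)" by (simp add: scaleR_fun_def)
qed

lemma lie_bracket_lincomb:
  assumes A: "smooth_atlas A" and X: "X \<in> vector_fields A" and Y: "Y \<in> vector_fields A" and Z: "Z \<in> vector_fields A"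
  shows "lie_bracket (\<lambda>p. a *\<^sub>R X p + b *\<^sub>R Y p) Z p = a *\<^sub>R lie_bracket X Z p + b *\<^sub>R lie_bracket Y Z p"
proof (rule tangent_eqI)
  note XY = vector_fields_lincomb2[OF A X Y, of a b]
  show "lie_bracket (\<lambda>p. a *\<^sub>R X p + b *\<^sub>R Y p) Z p \<in> tangent_space A p"
    by (intro vector_fieldsD(1) lie_bracket_vector_field A XY Z)
  show "a *\<^sub>R lie_bracket X Z p + b *\<^sub>R lie_bracket Y Z p \<in> tangent_space A p"
    by (intro tangent_space_add tangent_space_scaleR vector_fieldsD(1) lie_bracket_vector_field A X Y Z)
  fix f assume f: "smooth_fun A f"
  note Zt = vector_fieldsD(1)[OF Z, of p] and Xf = vector_fieldsD(2)[OF X f] and Yf = vector_fieldsD(2)[OF Y f]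
  have "Z p (\<lambda>q. a * X q f + b * Y q f) = a * Z p (\<lambda>q. X q f) + b * Z p (\<lambda>q. Y q f)"
    using tangent_spaceD(2)[OF Zt smooth_fun_cmult[OF A Xf] smooth_fun_cmult[OF A Yf]]
      tangent_spaceD(3)[OF Zt Xf] tangent_spaceD(3)[OF Zt Yf] by simp
  then show "lie_bracket (\<lambda>p. a *\<^sub>R X p + b *\<^sub>R Y p) Z p f = (a *\<^sub>R lie_bracket X Z p + b *\<^sub>R lie_bracket Y Z p) f"
    by (simp add: lie_bracket_def scaleR_fun_def algebra_simps)
qed

lemma lie_bracket_antisym: "lie_bracket X Y p = - lie_bracket Y X p"
  by (auto simp: lie_bracket_def)

section \<open>Central generators in the kernel of a linear form\<close>

context lie_action
begin

text \<open>Two independent central elements \<zeta>, \<eta> give the kernel element t(\<eta>)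
  \<zeta> - t(\<zeta>) \<eta>, or \<zeta> itself if t(\<zeta>) = 0. Independence is known for fields
  and the result is wanted at the identity, so values there are spread over G by
  \<open>linv\<close>.\<close>

lemma two_dim_center:
  assumes conn: "connected (UNIV :: 'g set)" and dim: "dim (lie_algebra_center G B) \<ge> 2"
    and t: "\<And>u v a b. u \<in> \<gg> \<Longrightarrow> v \<in> \<gg> \<Longrightarrow> t (a *\<^sub>R u + b *\<^sub>R v) = a * t u + b * (t v :: real)"
  shows "\<exists>v\<in>\<gg>. v \<noteq> 0 \<and> t v = 0 \<and> (\<forall>b. Ad b v = v)"
proof -
  let ?Z = "lie_algebra_center G B"
  obtain K where K: "K \<subseteq> ?Z" "independent K" "?Z \<subseteq> span K" "card K = dim ?Z"
    using real_vector.basis_exists[of ?Z] by blast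
  then have "\<not> card K \<le> 1" using dim by simp
  \<comment> \<open>An infinite \<open>K\<close> would have cardinality 0, so that case is ruled out
    as well.\<close>
  then have "\<not> (\<forall>x\<in>K. \<forall>y\<in>K. x = y)" by (metis One_nat_def card_le_Suc0_iff_eq card.infinite zero_le)
  then obtain \<zeta> \<eta> where \<zeta>\<eta>: "\<zeta> \<in> K" "\<eta> \<in> K" "\<zeta> \<noteq> \<eta>" by blast
  have c: "\<zeta> \<in> ?Z" "\<eta> \<in> ?Z" using \<zeta>\<eta> K(1) by auto
  then have L: "\<zeta> \<in> lie_algebra G B" "\<eta> \<in> lie_algebra G B" by (auto simp: lie_algebra_center_def)
  have g: "\<zeta> un \<in> \<gg>" "\<eta> un \<in> \<gg>" using lie_algebra_linv(1) L by auto
  note Ad = center_Ad[OF conn c(1)] center_Ad[OF conn c(2)]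
  have linv0: "linv 0 b = 0" for b by (auto simp: linv_def differential_def)
  show ?thesis
  proof (cases "t (\<zeta> un) = 0")
    case True
    have "\<zeta> un \<noteq> 0"
    proof
      assume "\<zeta> un = 0"
      then have "\<zeta> b = 0" for b
        using fun_cong[OF lie_algebra_linv(2)[OF L(1)], of b] linv0[of b] by (simp only:)
      then have "\<zeta> = 0" by auto
      then show False using K(2) \<zeta>\<eta>(1) dependent_zero by blast
    qed
    then show ?thesis using True g(1) Ad(1) by blast
  next
    case False
    define v where "v = t (\<eta> un) *\<^sub>R \<zeta> un + (- t (\<zeta> un)) *\<^sub>R \<eta> un"
    have v: "v \<in> \<gg>" unfolding v_def by (intro tangent_space_add tangent_space_scaleR g)
    have "t v = 0" unfolding v_def by (simp only: t[OF g]) simp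
    moreover have "Ad b v = v" for b unfolding v_def by (simp only: Ad_lincomb Ad)
    moreover have "v \<noteq> 0"
    proof
      assume "v = 0"
      have eq: "t (\<zeta> un) *\<^sub>R \<eta> b = t (\<eta> un) *\<^sub>R \<zeta> b" for b
      proof -
        have "linv v b = t (\<eta> un) *\<^sub>R linv (\<zeta> un) b + (- t (\<zeta> un)) *\<^sub>R linv (\<eta> un) b"
          unfolding v_def linv_def by (rule differential_lincomb)
        then have "0 = t (\<eta> un) *\<^sub>R linv (\<zeta> un) b + (- t (\<zeta> un)) *\<^sub>R linv (\<eta> un) b"
          unfolding \<open>v = 0\<close> linv0 .
        then have "0 = t (\<eta> un) *\<^sub>R \<zeta> b + (- t (\<zeta> un)) *\<^sub>R \<eta> b"
          unfolding fun_cong[OF lie_algebra_linv(2)[OF L(1)], symmetric]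
            fun_cong[OF lie_algebra_linv(2)[OF L(2)], symmetric] .
        then show ?thesis by (simp add: eq_neg_iff_add_eq_0[symmetric])
      qed
      have "\<eta> b = (t (\<eta> un) / t (\<zeta> un)) *\<^sub>R \<zeta> b" for b
      proof -
        have "\<eta> b = (1 / t (\<zeta> un)) *\<^sub>R (t (\<zeta> un) *\<^sub>R \<eta> b)" using False by simp
        also have "\<dots> = (t (\<eta> un) / t (\<zeta> un)) *\<^sub>R \<zeta> b" unfolding eq by simp
        finally show ?thesis .
      qed
      then have "\<eta> = (t (\<eta> un) / t (\<zeta> un)) *\<^sub>R \<zeta>" by (auto simp: scaleR_fun_def fun_eq_iff)
      moreover have "\<zeta> \<in> span (K - {\<eta>})" using \<zeta>\<eta> by (intro span_base) auto
      ultimately have "\<eta> \<in> span (K - {\<eta>})" by (metis span_scale)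
      then show False using K(2) \<zeta>\<eta>(2) unfolding dependent_def by blast
    qed
    ultimately show ?thesis using v by blast
  qed
qed

end

section \<open>Homogeneous locally conformally Kaehler manifolds\<close>

locale homogeneous_lck = lie_action A G B \<Phi>
  for A :: "('m::{t2_space, second_countable_topology}, 'e::euclidean_space) atlas"
    and G :: "'g::{t2_space, second_countable_topology} monoid"
    and B :: "('g, 'd::euclidean_space) atlas"
    and \<Phi> :: "'g \<Rightarrow> 'm \<Rightarrow> 'm" +
  fixes g :: "'m \<Rightarrow> 'm tvec \<Rightarrow> 'm tvec \<Rightarrow> real"
    and J :: "'m \<Rightarrow> 'm tvec \<Rightarrow> 'm tvec"
    and \<theta> :: "'m \<Rightarrow> 'm tvec \<Rightarrow> real"
    and nabla :: "'m vfield \<Rightarrow> 'm vfield \<Rightarrow> 'm vfield"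
  assumes hermitian: "hermitian_structure A g J" and lee: "lee_form A g J \<theta>"
    and not_kaehler: "\<not> kaehler A g J"
    and transitive: "\<And>p q. \<exists>a. \<Phi> a p = q"
    and g_invariant: "\<And>a. preserves_metric A g (\<Phi> a)"
    and J_invariant: "\<And>a. preserves_complex_structure A J (\<Phi> a)"
    and compact_G: "compact (UNIV :: 'g set)" and connected_G: "connected (UNIV :: 'g set)"
    and levi_civita: "levi_civita A g nabla"
begin

section \<open>Pointwise algebra of the Hermitian structure\<close>

abbreviation \<omega> where "\<omega> \<equiv> fundamental_form g J"
abbreviation T where "T \<equiv> tangent_space A"
abbreviation VF where "VF \<equiv> vector_fields A"

lemma metric: "riemannian_metric A g" and complex: "complex_structure A J"
  and gJ: "u \<in> T p \<Longrightarrow> v \<in> T p \<Longrightarrow> g p (J p u) v = - g p u (J p v)"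
  using hermitian by (auto simp: hermitian_structure_def)

lemma g_left: "u \<in> T p \<Longrightarrow> v \<in> T p \<Longrightarrow> w \<in> T p \<Longrightarrow> g p (a *\<^sub>R u + b *\<^sub>R v) w = a * g p u w + b * g p v w"
  and g_sym: "u \<in> T p \<Longrightarrow> v \<in> T p \<Longrightarrow> g p u v = g p v u"
  and g_pos: "u \<in> T p \<Longrightarrow> u \<noteq> 0 \<Longrightarrow> g p u u > 0"
  and g_smooth: "X \<in> VF \<Longrightarrow> Y \<in> VF \<Longrightarrow> smooth_fun A (\<lambda>p. g p (X p) (Y p))"
  using metric unfolding riemannian_metric_def by blast+

lemma J_tangent: "u \<in> T p \<Longrightarrow> J p u \<in> T p" and JJ: "u \<in> T p \<Longrightarrow> J p (J p u) = - u"
  and J_lin: "u \<in> T p \<Longrightarrow> v \<in> T p \<Longrightarrow> J p (a *\<^sub>R u + b *\<^sub>R v) = a *\<^sub>R J p u + b *\<^sub>R J p v"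
  and J_smooth: "X \<in> VF \<Longrightarrow> (\<lambda>p. J p (X p)) \<in> VF"
  using complex unfolding complex_structure_def almost_complex_structure_def by blast+

lemma nijenhuis_zero: "X \<in> VF \<Longrightarrow> Y \<in> VF \<Longrightarrow> nijenhuis J X Y p = 0"
  using complex unfolding complex_structure_def by simp

lemma theta_form: "one_form A \<theta>"
  and theta_closed: "X \<in> VF \<Longrightarrow> Y \<in> VF \<Longrightarrow> ext_d1 \<theta> X Y p = 0"
  and d_omega: "X \<in> VF \<Longrightarrow> Y \<in> VF \<Longrightarrow> Z \<in> VF \<Longrightarrow>
    ext_d2 \<omega> X Y Z p = - 2 * wedge_1_2 \<theta> \<omega> p (X p) (Y p) (Z p)"
  using lee unfolding lee_form_def by blast+

lemma VFT: "X \<in> VF \<Longrightarrow> X p \<in> T p" by (rule vector_fieldsD(1))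

lemma g_right:
  assumes "u \<in> T p" "v \<in> T p" "w \<in> T p"
  shows "g p w (a *\<^sub>R u + b *\<^sub>R v) = a * g p w u + b * g p w v"
proof -
  have "a *\<^sub>R u + b *\<^sub>R v \<in> T p" using assms by (intro tangent_space_add tangent_space_scaleR)
  then show ?thesis using g_left[OF assms, of a b] assms g_sym by simp
qed

lemma g_zero: "u \<in> T p \<Longrightarrow> g p 0 u = 0" "u \<in> T p \<Longrightarrow> g p u 0 = 0"
  using g_left[OF tangent_space_zero tangent_space_zero, of u p 0 0]
    g_right[OF tangent_space_zero tangent_space_zero, of u p 0 0] by simp_all

lemma J_zero: "J p 0 = 0"
  using J_lin[OF tangent_space_zero tangent_space_zero, of p 0 0] by simp

lemma theta_lin: "u \<in> T p \<Longrightarrow> v \<in> T p \<Longrightarrow> \<theta> p (a *\<^sub>R u + b *\<^sub>R v) = a * \<theta> p u + b * \<theta> p v"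
  by (rule one_formD(1)[OF theta_form])

lemma theta_zero: "\<theta> p 0 = 0"
  using theta_lin[OF tangent_space_zero tangent_space_zero, of p 0 0] by simp

lemma g_minus_right: "u \<in> T p \<Longrightarrow> v \<in> T p \<Longrightarrow> g p u (- v) = - g p u v"
  using g_right[of v p v u "-1" 0] by simp

lemma gJJ: "u \<in> T p \<Longrightarrow> v \<in> T p \<Longrightarrow> g p (J p u) (J p v) = g p u v"
  using gJ[of u p "J p v"] J_tangent[of v p] JJ[of v p] g_minus_right[of u p v] by simp

lemma g_Jself: "u \<in> T p \<Longrightarrow> g p (J p u) u = 0" "u \<in> T p \<Longrightarrow> g p u (J p u) = 0"
  using gJ[of u p u] g_sym[of u p "J p u"] J_tangent[of u p] by auto

lemma omega_antisym: "u \<in> T p \<Longrightarrow> v \<in> T p \<Longrightarrow> \<omega> p u v = - \<omega> p v u"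
  unfolding fundamental_form_def using gJ[of u p v] g_sym[of u p "J p v"] J_tangent[of v p] by simp

lemma g_bilinear: "smooth_bilinear_form A g"
  unfolding smooth_bilinear_form_def using g_left g_right g_smooth by blast

lemma omega_bilinear: "smooth_bilinear_form A \<omega>"
  unfolding smooth_bilinear_form_def fundamental_form_def
proof (intro conjI allI ballI)
  fix p u v w and a b :: real assume T: "u \<in> T p" "v \<in> T p" "w \<in> T p"
  show "g p (J p (a *\<^sub>R u + b *\<^sub>R v)) w = a * g p (J p u) w + b * g p (J p v) w"
    unfolding J_lin[OF T(1,2)] by (rule g_left[OF J_tangent J_tangent]) (use T in auto)
  show "g p (J p w) (a *\<^sub>R u + b *\<^sub>R v) = a * g p (J p w) u + b * g p (J p w) v"
    by (rule g_right[OF T(1,2) J_tangent[OF T(3)]])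
next
  fix X Y assume "X \<in> VF" "Y \<in> VF"
  then show "smooth_fun A (\<lambda>p. g p (J p (X p)) (Y p))" using g_smooth[OF J_smooth] by blast
qed

lemma g_inv: "u \<in> T p \<Longrightarrow> v \<in> T p \<Longrightarrow> g (\<Phi> a p) (d\<Phi> a u) (d\<Phi> a v) = g p u v"
  using g_invariant[of a] unfolding preserves_metric_def by blast

lemma J_inv: "u \<in> T p \<Longrightarrow> J (\<Phi> a p) (d\<Phi> a u) = d\<Phi> a (J p u)"
  using J_invariant[of a] unfolding preserves_complex_structure_def by blast

lemma omega_inv: "u \<in> T p \<Longrightarrow> v \<in> T p \<Longrightarrow> \<omega> (\<Phi> a p) (d\<Phi> a u) (d\<Phi> a v) = \<omega> p u v"
  unfolding fundamental_form_def by (simp add: J_inv g_inv J_tangent)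

section \<open>Invariance of the Lee form and constant pairings\<close>

lemma ext_d2_push:
  assumes X: "X \<in> VF" and Y: "Y \<in> VF" and Z: "Z \<in> VF"
  shows "ext_d2 \<omega> (push a X) (push a Y) (push a Z) (\<Phi> a p) = ext_d2 \<omega> X Y Z p"
proof -
  have d: "push a X (\<Phi> a p) (\<lambda>q. \<omega> q (push a Y q) (push a Z q)) = X p (\<lambda>q. \<omega> q (Y q) (Z q))"
    if "X \<in> VF" "Y \<in> VF" "Z \<in> VF" for X Y Z
  proof -
    have "smooth_fun A (\<lambda>q. \<omega> q (push a Y q) (push a Z q))"
      by (intro smooth_bilinear_formD(3)[OF omega_bilinear] push_vector_field that)
    from push_apply[OF this, of a X "\<Phi> a p"] show ?thesis by (simp add: push_at omega_inv VFT that)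
  qed
  have b: "\<omega> (\<Phi> a p) (lie_bracket (push a X) (push a Y) (\<Phi> a p)) (push a Z (\<Phi> a p)) = \<omega> p (lie_bracket X Y p) (Z p)"
    if "X \<in> VF" "Y \<in> VF" "Z \<in> VF" for X Y Z
    by (simp add: push_lie_bracket that push_at omega_inv VFT lie_bracket_vector_field atlas_A)
  show ?thesis unfolding ext_d2_def by (simp only: d[OF X Y Z] d[OF Y X Z] d[OF Z X Y] b[OF X Y Z] b[OF X Z Y] b[OF Y Z X])
qed

text \<open>The tangent space has complex dimension at least two, since its 3-forms do not all vanish.\<close>

lemma orthogonal_complement:
  assumes u: "u \<in> T p" "u \<noteq> 0"
  shows "\<exists>v\<in>T p. v \<noteq> 0 \<and> g p u v = 0 \<and> g p (J p u) v = 0"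
proof -
  obtain X Y Z p0 where XYZ: "X \<in> VF" "Y \<in> VF" "Z \<in> VF" "ext_d2 \<omega> X Y Z p0 \<noteq> 0"
    using not_kaehler hermitian unfolding kaehler_def by blast
  obtain a where a: "\<Phi> a p0 = p" using transitive by blast
  \<comment> \<open>A nonzero exterior derivative of \<omega> is known only at some point
    \<open>p0\<close>. Transitivity transports u there and the vector found back.\<close>
  define u' where "u' = d\<Phi> (iv a) u"
  have p0: "\<Phi> (iv a) p = p0" using a by (metis action_simps(3))
  have u'T: "u' \<in> T p0" unfolding u'_def using d\<Phi>_tangent[OF u(1), of "iv a"] p0 by simp
  have u': "d\<Phi> a u' = u" unfolding u'_def by (rule d\<Phi>_iv(2)[OF u(1)])
  have d0: "d\<Phi> b 0 = 0" for b by (auto simp: differential_def)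
  have "u' \<noteq> 0" using u(2) u' d0 by metis
  have Ju: "J p0 u' \<in> T p0" by (rule J_tangent[OF u'T])
  let ?N = "g p0 u' u'"
  have N: "?N > 0" by (rule g_pos[OF u'T \<open>u' \<noteq> 0\<close>])
  have "\<exists>v\<in>T p0. v \<noteq> 0 \<and> g p0 u' v = 0 \<and> g p0 (J p0 u') v = 0"
  proof (rule ccontr)
    assume H: "\<not> ?thesis"
    \<comment> \<open>Without such a v, the part of w orthogonal to u' and its image under J
      vanishes, so the tangent space at \<open>p0\<close> is a real plane.\<close>
    have dec: "\<exists>s t. w = s *\<^sub>R u' + t *\<^sub>R J p0 u'" if w: "w \<in> T p0" for w
    proof -
      define s where "s = g p0 u' w / ?N"
      define t where "t = g p0 (J p0 u') w / ?N"
      define z where "z = s *\<^sub>R u' + t *\<^sub>R J p0 u'"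
      have z: "z \<in> T p0" unfolding z_def by (intro tangent_space_add tangent_space_scaleR u'T Ju)
      have zu: "g p0 u' z = s * ?N" "g p0 (J p0 u') z = t * ?N"
        unfolding z_def using g_right[OF u'T Ju u'T, of s t] g_right[OF u'T Ju Ju, of s t] g_Jself[OF u'T] gJJ[OF u'T u'T] by simp_all
      have "g p0 u' (w - z) = 0" "g p0 (J p0 u') (w - z) = 0"
        using g_right[OF w z u'T, of 1 "-1"] g_right[OF w z Ju, of 1 "-1"] zu N by (simp_all add: s_def t_def)
      then have "w - z = 0" using H tangent_space_diff[OF w z] by blast
      then have "w = s *\<^sub>R u' + t *\<^sub>R J p0 u'" by (simp add: z_def)
      then show ?thesis by blast
    qed
    have om: "\<omega> p0 (s *\<^sub>R u' + t *\<^sub>R J p0 u') (s' *\<^sub>R u' + t' *\<^sub>R J p0 u') = (s * t' - t * s') * ?N" for s t s' t'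
    proof -
      note b = smooth_bilinear_formD[OF omega_bilinear]
      have "\<omega> p0 u' u' = 0" "\<omega> p0 u' (J p0 u') = ?N" "\<omega> p0 (J p0 u') u' = - ?N" "\<omega> p0 (J p0 u') (J p0 u') = 0"
        using g_Jself[OF u'T] gJJ[OF u'T u'T] omega_antisym[OF Ju u'T] omega_antisym[OF Ju Ju]
        by (auto simp: fundamental_form_def)
      moreover have "s' *\<^sub>R u' + t' *\<^sub>R J p0 u' \<in> T p0" by (intro tangent_space_add tangent_space_scaleR u'T Ju)
      ultimately show ?thesis
        by (simp add: b(1)[OF _ u'T Ju] b(2)[OF u'T u'T Ju] b(2)[OF Ju u'T Ju] algebra_simps)
    qed
    obtain s1 t1 s2 t2 s3 t3 where st: "X p0 = s1 *\<^sub>R u' + t1 *\<^sub>R J p0 u'" "Y p0 = s2 *\<^sub>R u' + t2 *\<^sub>R J p0 u'"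
        "Z p0 = s3 *\<^sub>R u' + t3 *\<^sub>R J p0 u'"
      using dec[OF VFT[OF XYZ(1)]] dec[OF VFT[OF XYZ(2)]] dec[OF VFT[OF XYZ(3)]] by blast
    \<comment> \<open>An alternating 3-form on a plane is zero.\<close>
    have "wedge_1_2 \<theta> \<omega> p0 (X p0) (Y p0) (Z p0) = 0"
      unfolding wedge_1_2_def st om theta_lin[OF u'T Ju] by (simp add: algebra_simps)
    then show False using XYZ d_omega[OF XYZ(1-3), of p0] by simp
  qed
  then obtain v where v: "v \<in> T p0" "v \<noteq> 0" "g p0 u' v = 0" "g p0 (J p0 u') v = 0" by blast
  have "d\<Phi> a v \<noteq> 0" using v(2) d\<Phi>_iv(1)[OF v(1), of a] d0 by metis
  moreover have "g p u (d\<Phi> a v) = 0" using g_inv[OF u'T v(1), of a] v(3) u' a by simp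
  moreover have "g p (J p u) (d\<Phi> a v) = 0" using g_inv[OF Ju v(1), of a] J_inv[OF u'T, of a] v(4) u' a by simp
  moreover have "d\<Phi> a v \<in> T p" using d\<Phi>_tangent[OF v(1), of a] a by simp
  ultimately show ?thesis by blast
qed

text \<open>Take v orthogonal to u and Ju, which is where complex dimension at least two enters. On
  u, v, Jv only \<alpha>(u) |v|^2 survives.\<close>

lemma wedge_omega_injective:
  assumes lin: "\<alpha> 0 = (0::real)"
    and zero: "\<And>u v w. u \<in> T p \<Longrightarrow> v \<in> T p \<Longrightarrow> w \<in> T p \<Longrightarrow>
      \<alpha> u * \<omega> p v w - \<alpha> v * \<omega> p u w + \<alpha> w * \<omega> p u v = 0"
    and u: "u \<in> T p"
  shows "\<alpha> u = 0"
proof (cases "u = 0")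
  case False
  obtain v where v: "v \<in> T p" "v \<noteq> 0" "g p u v = 0" "g p (J p u) v = 0"
    using orthogonal_complement[OF u False] by blast
  have "\<omega> p v (J p v) > 0" unfolding fundamental_form_def gJJ[OF v(1) v(1)] by (rule g_pos[OF v(1,2)])
  moreover have "\<omega> p u (J p v) = 0" "\<omega> p u v = 0"
    unfolding fundamental_form_def gJJ[OF u v(1)] using v by auto
  ultimately show ?thesis using zero[OF u v(1) J_tangent[OF v(1)]] by simp
qed (simp add: lin)

text \<open>Since \<omega> and hence its exterior derivative are invariant, the difference \<alpha>
  of the pulled back and the original Lee form satisfies \<alpha> \<and> \<omega> = 0.\<close>

lemma theta_inv:
  assumes u: "u \<in> T p" shows "\<theta> (\<Phi> a p) (d\<Phi> a u) = \<theta> p u"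
proof -
  define \<alpha> where "\<alpha> u = \<theta> (\<Phi> a p) (d\<Phi> a u) - \<theta> p u" for u
  have "d\<Phi> a 0 = 0" by (auto simp: differential_def)
  then have "\<alpha> 0 = 0" by (simp add: \<alpha>_def theta_zero)
  moreover have "\<alpha> u * \<omega> p v w - \<alpha> v * \<omega> p u w + \<alpha> w * \<omega> p u v = 0"
    if T: "u \<in> T p" "v \<in> T p" "w \<in> T p" for u v w
  proof -
    obtain X where X: "X \<in> VF" "X p = u" using tangent_extends[OF atlas_A T(1)] .
    obtain Y where Y: "Y \<in> VF" "Y p = v" using tangent_extends[OF atlas_A T(2)] .
    obtain Z where Z: "Z \<in> VF" "Z p = w" using tangent_extends[OF atlas_A T(3)] .
    have "wedge_1_2 \<theta> \<omega> (\<Phi> a p) (d\<Phi> a u) (d\<Phi> a v) (d\<Phi> a w) = wedge_1_2 \<theta> \<omega> p u v w"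
      using ext_d2_push[OF X(1) Y(1) Z(1), of a p] d_omega[OF X(1) Y(1) Z(1), of p]
        d_omega[OF push_vector_field[OF X(1)] push_vector_field[OF Y(1)] push_vector_field[OF Z(1)], of a a a "\<Phi> a p"]
      by (simp add: push_at X(2) Y(2) Z(2))
    then show ?thesis by (simp add: wedge_1_2_def omega_inv T \<alpha>_def algebra_simps)
  qed
  ultimately have "\<alpha> u = 0" using u by (rule wedge_omega_injective)
  then show ?thesis by (simp add: \<alpha>_def)
qed

lemma invariant_pairing_constant:
  assumes "X \<in> VF" "invariant X" "Y \<in> VF" "invariant Y"
  shows "g p (X p) (Y p) = g q (X q) (Y q)"
proof -
  obtain a where "\<Phi> a p = q" using transitive by blast
  then show ?thesis using g_inv[OF VFT[OF assms(1), of p] VFT[OF assms(3), of p], of a] assms by (simp add: invariant_def)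
qed

lemma invariant_J:
  assumes "X \<in> VF" "invariant X" shows "invariant (\<lambda>p. J p (X p))"
  using assms J_inv[OF VFT[OF assms(1)]] unfolding invariant_def by metis

lemma invariant_omega_constant:
  assumes "X \<in> VF" "invariant X" "Y \<in> VF" "invariant Y"
  shows "\<omega> p (X p) (Y p) = \<omega> q (X q) (Y q)"
  unfolding fundamental_form_def
  by (rule invariant_pairing_constant[OF J_smooth[OF assms(1)] invariant_J[OF assms(1,2)] assms(3,4)])

lemma invariant_theta_constant:
  assumes "X \<in> VF" "invariant X" shows "\<theta> p (X p) = \<theta> q (X q)"
proof -
  obtain a where "\<Phi> a p = q" using transitive by blast
  then show ?thesis using theta_inv[OF VFT[OF assms(1), of p], of a] assms by (simp add: invariant_def)
qed

lemma invariant_lincomb: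
  "invariant X \<Longrightarrow> invariant Y \<Longrightarrow> invariant (\<lambda>p. a *\<^sub>R X p + b *\<^sub>R Y p)"
  unfolding invariant_def by (simp add: differential_lincomb)

lemma connected_M: "connected (UNIV :: 'm set)"
proof -
  fix p
  have "connected ((\<lambda>a. \<Phi> a p) ` UNIV)"
    by (rule connected_continuous_image[OF smooth_mapD(1)[OF smooth_orbit_map] connected_G])
  moreover have "(\<lambda>a. \<Phi> a p) ` UNIV = UNIV"
  proof (intro equalityI subset_UNIV subsetI)
    fix q
    obtain a where "\<Phi> a p = q" using transitive by blast
    then show "q \<in> (\<lambda>a. \<Phi> a p) ` UNIV" by blast
  qed
  ultimately show ?thesis by simp
qed

text \<open>As \<theta> is invariant and constant along each fundamental field, w \<mapsto>
  \<theta>(fund w) is a linear form fixed by \<open>Ad\<close>. It is not zero by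
  \<open>one_form_vanishing_on_fund\<close>, and averaging yields an \<open>Ad\<close>-fixed
  generator on which it is still nonzero.\<close>

lemma exists_invariant_fund_transversal:
  "\<exists>w\<in>\<gg>. (\<forall>b. Ad b w = w) \<and> (\<forall>p. \<theta> p (fund w p) \<noteq> 0)"
proof -
  obtain X Y Z p0 where XYZ: "X \<in> VF" "Y \<in> VF" "Z \<in> VF" "ext_d2 \<omega> X Y Z p0 \<noteq> 0"
    using not_kaehler hermitian unfolding kaehler_def by blast
  then have "wedge_1_2 \<theta> \<omega> p0 (X p0) (Y p0) (Z p0) \<noteq> 0" using d_omega[OF XYZ(1-3), of p0] by simp
  then obtain u where u: "u \<in> T p0" "\<theta> p0 u \<noteq> 0"
    using VFT[OF XYZ(1), of p0] VFT[OF XYZ(2), of p0] VFT[OF XYZ(3), of p0] that unfolding wedge_1_2_def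
    by fastforce
  have const: "\<theta> p (fund w p) = \<theta> q (fund w q)" if "w \<in> \<gg>" for w p q
    by (rule fund_one_form_constant[OF theta_form _ _ connected_M that]) (rule theta_closed theta_inv, assumption+)+
  have "\<exists>q. \<exists>w\<in>\<gg>. \<theta> q (fund w q) \<noteq> 0"
  proof (rule ccontr)
    assume "\<not> ?thesis"
    then have z: "\<theta> q (fund w q) = 0" if "w \<in> \<gg>" for q w using that by blast
    have "\<theta> p0 u = 0"
      by (rule one_form_vanishing_on_fund[OF compact_G transitive theta_form _ z u(1)]) (rule theta_closed)
    then show False using u(2) by blast
  qed
  then obtain q w where w: "w \<in> \<gg>" "\<theta> q (fund w q) \<noteq> 0" by blast
  have "\<theta> q (fund (Ad b w) q) = \<theta> q (fund w q)" if w: "w \<in> \<gg>" for b w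
  proof -
    have "fund (Ad b w) q = d\<Phi> b (fund w (\<Phi> (iv b) q))" using d\<Phi>_fund[OF w, of b "\<Phi> (iv b) q"] by simp
    then have "\<theta> q (fund (Ad b w) q) = \<theta> (\<Phi> (iv b) q) (fund w (\<Phi> (iv b) q))"
      using theta_inv[OF VFT[OF fund_vector_field[OF w]], of b "\<Phi> (iv b) q"] by simp
    then show ?thesis using const[OF w] by metis
  qed
  from exists_Ad_invariant[OF compact_G theta_form this w]
  obtain w' where w': "w' \<in> \<gg>" "\<theta> q (fund w' q) \<noteq> 0" "\<forall>b. Ad b w' = w'" by blast
  then show ?thesis using const[OF w'(1)] by metis
qed

section \<open>The Levi-Civita connection and Killing fields\<close>

lemma nablaD:
  assumes X: "X \<in> VF" and Y: "Y \<in> VF"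
  shows "nabla X Y \<in> VF" "nabla X Y p - nabla Y X p = lie_bracket X Y p"
    "Z \<in> VF \<Longrightarrow> X p (\<lambda>q. g q (Y q) (Z q)) = g p (nabla X Y p) (Z p) + g p (Y p) (nabla X Z p)"
proof -
  show "nabla X Y \<in> VF" using levi_civita X Y unfolding levi_civita_def affine_connection_def by blast
  have "nabla X Y - nabla Y X = lie_bracket X Y" using levi_civita X Y unfolding levi_civita_def by blast
  then show "nabla X Y p - nabla Y X p = lie_bracket X Y p" by (metis minus_apply)
  show "Z \<in> VF \<Longrightarrow> X p (\<lambda>q. g q (Y q) (Z q)) = g p (nabla X Y p) (Z p) + g p (Y p) (nabla X Z p)"
    using levi_civita X Y unfolding levi_civita_def by blast
qed

lemma g_diff_left: "u \<in> T p \<Longrightarrow> v \<in> T p \<Longrightarrow> w \<in> T p \<Longrightarrow> g p (u - v) w = g p u w - g p v w"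
  using g_left[of u p v w 1 "-1"] by simp

lemma g_diff_right: "u \<in> T p \<Longrightarrow> v \<in> T p \<Longrightarrow> w \<in> T p \<Longrightarrow> g p w (u - v) = g p w u - g p w v"
  using g_right[of u p v w 1 "-1"] by simp

text \<open>The Lie derivative of \<open>g\<close> along the fundamental field vanishes; metric
  compatibility and zero torsion rewrite this as Killing's equation.\<close>

lemma fund_killing:
  assumes k: "k \<in> \<gg>" and Z: "Z \<in> VF" and W: "W \<in> VF"
  shows "g p (nabla Z (fund k) p) (W p) + g p (nabla W (fund k) p) (Z p) = 0"
proof -
  let ?K = "fund k"
  have K: "?K \<in> VF" by (rule fund_vector_field[OF k])
  note n = VFT[OF nablaD(1)]
  have "g p (lie_bracket ?K Z p) (W p) + g p (Z p) (lie_bracket ?K W p) = g p (nabla ?K Z p) (W p) + g p (Z p) (nabla ?K W p)"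
    unfolding nablaD(3)[OF K Z W, symmetric]
    by (rule lie_derivative_bilinear[OF k Z W g_bilinear, symmetric]) (rule g_inv)
  then show ?thesis
    unfolding nablaD(2)[OF K Z, symmetric] nablaD(2)[OF K W, symmetric]
      g_diff_left[OF n[OF K Z] n[OF Z K] VFT[OF W]] g_diff_right[OF n[OF K W] n[OF W K] VFT[OF Z]]
      g_sym[OF VFT[OF Z] n[OF W K]] by simp
qed

text \<open>
  Cartan's formula turns \<open>X\<close> Killing with \<open>\<theta>(X) = 0\<close> into \<open>d(JX) = -2 \<theta> \<and> JX\<close>. Since \<open>JX\<close> is
  Killing too and has constant length, \<open>\<theta>\<close> is a constant multiple of the dual of \<open>JX\<close>, which is then parallel.
\<close>

lemma parallel_if_J_fund:
  assumes v: "v \<in> \<gg>" and inv: "invariant (fund v)" and \<theta>X: "\<And>p. \<theta> p (fund v p) = 0"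
    and k: "k \<in> \<gg>" and K: "\<And>p. fund k p = J p (fund v p)" and nz: "\<And>p. fund v p \<noteq> 0"
  shows "parallel_one_form A nabla \<theta>"
proof -
  let ?X = "fund v" and ?K = "fund k"
  have XV: "?X \<in> VF" and KV: "?K \<in> VF" by (rule fund_vector_field[OF v], rule fund_vector_field[OF k])
  have invK: "invariant ?K" using invariant_J[OF XV inv] by (simp add: K[symmetric] cong: if_cong)
  have omX: "\<omega> q (?X q) u = g q (?K q) u" for q u by (simp add: fundamental_form_def K)
  note n = VFT[OF nablaD(1)]
  \<comment> \<open>Contracting \<omega> with X gives the dual of K. As \<omega> has zero Lie
    derivative along X, d\<omega>(X, Z, W) is minus the exterior derivative of that dual, which
    Killing's equation turns into -2 g(\<nabla>_Z K, W). The factor 2 cancels against the one in -2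
    \<theta> \<and> \<omega>.\<close>
  have main: "g p (nabla Z ?K p) (W p) = - \<theta> p (Z p) * g p (?K p) (W p) + \<theta> p (W p) * g p (?K p) (Z p)"
    if Z: "Z \<in> VF" and W: "W \<in> VF" for Z W p
  proof -
    have ZW: "lie_bracket Z W p \<in> T p" "lie_bracket ?X W p \<in> T p" "lie_bracket ?X Z p \<in> T p"
      by (intro VFT lie_bracket_vector_field atlas_A Z W XV)+
    have 1: "?X p (\<lambda>q. \<omega> q (Z q) (W q)) = \<omega> p (lie_bracket ?X Z p) (W p) - \<omega> p (lie_bracket ?X W p) (Z p)"
    proof -
      have L: "?X p (\<lambda>q. \<omega> q (Z q) (W q)) = \<omega> p (lie_bracket ?X Z p) (W p) + \<omega> p (Z p) (lie_bracket ?X W p)"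
        by (rule lie_derivative_bilinear[OF v Z W omega_bilinear]) (rule omega_inv)
      show ?thesis unfolding L omega_antisym[OF VFT[OF Z] ZW(2)] by simp
    qed
    have 2: "\<omega> p (lie_bracket Z W p) (?X p) = - g p (?K p) (lie_bracket Z W p)"
      using omega_antisym[OF ZW(1) VFT[OF XV]] by (simp add: omX)
    have 3: "g p (?K p) (lie_bracket Z W p) = g p (?K p) (nabla Z W p) - g p (?K p) (nabla W Z p)"
      unfolding nablaD(2)[OF Z W, symmetric] by (rule g_diff_right[OF n[OF Z W] n[OF W Z] VFT[OF KV]])
    have "- Z p (\<lambda>q. g q (?K q) (W q)) + W p (\<lambda>q. g q (?K q) (Z q)) + g p (?K p) (lie_bracket Z W p) =
        2 * \<theta> p (Z p) * g p (?K p) (W p) - 2 * \<theta> p (W p) * g p (?K p) (Z p)"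
      using d_omega[OF XV Z W, of p] unfolding ext_d2_def wedge_1_2_def 1 2 omX \<theta>X by simp
    then have "- g p (nabla Z ?K p) (W p) + g p (nabla W ?K p) (Z p) =
        2 * \<theta> p (Z p) * g p (?K p) (W p) - 2 * \<theta> p (W p) * g p (?K p) (Z p)"
      unfolding 3 nablaD(3)[OF Z KV W] nablaD(3)[OF W KV Z] by simp
    then show ?thesis using fund_killing[OF k Z W, of p] by simp
  qed
  define N where "N = (\<lambda>p. g p (?K p) (?K p))"
  fix p1 :: 'm
  define c where "c = \<theta> p1 (?K p1) / N p1"
  have Kc: "N p = N p1" "\<theta> p (?K p) = \<theta> p1 (?K p1)" for p
    unfolding N_def by (rule invariant_pairing_constant[OF KV invK KV invK], rule invariant_theta_constant[OF KV invK])
  have Npos: "N p1 > 0" unfolding N_def K gJJ[OF VFT[OF XV] VFT[OF XV]] by (rule g_pos[OF VFT[OF XV] nz])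
  \<comment> \<open>Put W = K in \<open>main\<close>: the left side is half the derivative of the
    constant N, so \<theta>(Z) N = \<theta>(K) g(K, Z).\<close>
  have \<theta>K: "\<theta> p (Z p) = c * g p (?K p) (Z p)" if Z: "Z \<in> VF" for Z p
  proof -
    have "N = (\<lambda>q. N p1)" by (rule ext) (rule Kc(1))
    then have "Z p N = 0" by (rule trans[OF arg_cong[where f="Z p"] tangent_const[OF VFT[OF Z]]])
    then have "g p (nabla Z ?K p) (?K p) = 0"
      using nablaD(3)[OF Z KV KV, of p] g_sym[OF VFT[OF KV] n[OF Z KV], of p] by (simp add: N_def)
    then have "\<theta> p (Z p) * N p = \<theta> p (?K p) * g p (?K p) (Z p)"
      using main[OF Z KV, of p] by (simp add: N_def)
    then show ?thesis unfolding c_def Kc(2)[of p] Kc(1)[of p] using Npos by (simp add: field_simps)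
  qed
  \<comment> \<open>With \<theta> proportional to the dual of K, the two terms on the right of
    \<open>main\<close> cancel, so K is parallel.\<close>
  have par: "g p (nabla Z ?K p) (W p) = 0" if "Z \<in> VF" "W \<in> VF" for Z W p
    using main[OF that, of p] \<theta>K[OF that(1), of p] \<theta>K[OF that(2), of p] by simp
  have "Z p (\<lambda>q. \<theta> q (W q)) - \<theta> p (nabla Z W p) = 0" if Z: "Z \<in> VF" and W: "W \<in> VF" for Z W p
  proof -
    have "Z p (\<lambda>q. \<theta> q (W q)) = c * Z p (\<lambda>q. g q (?K q) (W q))"
      unfolding \<theta>K[OF W] by (rule tangent_spaceD(3)[OF VFT[OF Z] g_smooth[OF KV W]])
    then show ?thesis
      unfolding nablaD(3)[OF Z KV W] par[OF Z W] \<theta>K[OF nablaD(1)[OF Z W]] by simp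
  qed
  then show ?thesis unfolding parallel_one_form_def by blast
qed

text \<open>Faithfulness enters twice through \<open>fund_injective\<close>: with invariance it
  makes X nowhere zero, and it turns a vanishing field Y into a vanishing generator, which excludes
  b = 0.\<close>

lemma parallel_lee_form:
  assumes faithful: "\<And>a. (\<And>p. \<Phi> a p = p) \<Longrightarrow> a = un" and dim: "dim (lie_algebra_center G B) \<ge> 2"
  shows "parallel_one_form A nabla \<theta>"
proof -
  fix p1 :: 'm
  obtain w where w: "w \<in> \<gg>" "\<And>b. Ad b w = w" "\<And>p. \<theta> p (fund w p) \<noteq> 0"
    using exists_invariant_fund_transversal by blast
  have fT: "fund u p \<in> T p" if "u \<in> \<gg>" for u p by (rule VFT[OF fund_vector_field[OF that]])
  have "\<theta> p1 (fund (a *\<^sub>R u + b *\<^sub>R v) p1) = a * \<theta> p1 (fund u p1) + b * \<theta> p1 (fund v p1)" if "u \<in> \<gg>" "v \<in> \<gg>" for u v a b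
    unfolding fund_lincomb by (rule theta_lin[OF fT[OF that(1)] fT[OF that(2)]])
  from two_dim_center[OF connected_G dim this]
  obtain v where v: "v \<in> \<gg>" "v \<noteq> 0" "\<theta> p1 (fund v p1) = 0" "\<And>b. Ad b v = v" by blast
  let ?\<xi> = "fund w" and ?X = "fund v"
  let ?J = "\<lambda>X p. J p (X p)"
  have \<xi>V: "?\<xi> \<in> VF" and XV: "?X \<in> VF" by (rule fund_vector_field[OF w(1)], rule fund_vector_field[OF v(1)])
  have \<xi>I: "invariant ?\<xi>" and XI: "invariant ?X" by (rule invariant_fund[OF w(1,2)], rule invariant_fund[OF v(1,4)])
  note J\<xi>V = J_smooth[OF \<xi>V] and J\<xi>I = invariant_J[OF \<xi>V \<xi>I]
  have \<theta>X: "\<theta> p (?X p) = 0" for p using invariant_theta_constant[OF XV XI, of p p1] v(3) by simp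
  have d0: "d\<Phi> b 0 = 0" for b by (auto simp: differential_def)
  have Xnz: "?X p \<noteq> 0" for p
  proof
    assume 0: "?X p = 0"
    have "?X q = 0" for q
    proof -
      obtain a where "\<Phi> a p = q" using transitive by blast
      then show ?thesis using XI 0 d0[of a] by (metis invariant_def)
    qed
    then show False using fund_injective[OF faithful v(1)] v(2) by blast
  qed
  have \<xi>nz: "?\<xi> p \<noteq> 0" for p using w(3)[of p] theta_zero by metis
  define N where "N = g p1 (?\<xi> p1) (?\<xi> p1)"
  \<comment> \<open>Coefficients of the orthogonal projection of X to the span of \<xi> and J\<xi>.
    By invariance they do not depend on the point, and J\<xi> has the same length as \<xi>.\<close>
  define a where "a = g p1 (?\<xi> p1) (?X p1) / N"
  define b where "b = g p1 (J p1 (?\<xi> p1)) (?X p1) / N"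
  have N: "N > 0" unfolding N_def by (rule g_pos[OF VFT[OF \<xi>V] \<xi>nz])
  have c: "g p (?\<xi> p) (?\<xi> p) = N" "g p (?\<xi> p) (?X p) = a * N" "g p (J p (?\<xi> p)) (?X p) = b * N" for p
    using invariant_pairing_constant[OF \<xi>V \<xi>I \<xi>V \<xi>I, of p p1] invariant_pairing_constant[OF \<xi>V \<xi>I XV XI, of p p1]
      invariant_pairing_constant[OF J\<xi>V J\<xi>I XV XI, of p p1] N by (simp_all add: N_def a_def b_def)
  \<comment> \<open>The \<xi> part is subtracted in the Lie algebra, so that Y is still fundamental
    and commutes with every invariant field; the J\<xi> part is subtracted afterwards, as a
    field.\<close>
  define y where "y = 1 *\<^sub>R v + (- a) *\<^sub>R w"
  let ?Y = "fund y"
  have y: "y \<in> \<gg>" unfolding y_def by (intro tangent_space_add tangent_space_scaleR v w)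
  have Yeq: "?Y = (\<lambda>p. 1 *\<^sub>R ?X p + (- a) *\<^sub>R ?\<xi> p)" unfolding y_def by (rule fund_lincomb)
  have YV: "?Y \<in> VF" by (rule fund_vector_field[OF y])
  have YI: "invariant ?Y" unfolding Yeq by (rule invariant_lincomb[OF XI \<xi>I])
  define X' where "X' = (\<lambda>p. 1 *\<^sub>R ?Y p + (- b) *\<^sub>R J p (?\<xi> p))"
  have X'V: "X' \<in> VF" unfolding X'_def by (rule vector_fields_lincomb2[OF atlas_A YV J\<xi>V])
  have X'I: "invariant X'" unfolding X'_def by (rule invariant_lincomb[OF YI J\<xi>I])
  note JX'V = J_smooth[OF X'V] and JX'I = invariant_J[OF X'V X'I]
  have br1: "lie_bracket ?\<xi> X' p = 0" "lie_bracket ?\<xi> (?J X') p = 0" "lie_bracket ?Y (?J X') p = 0" "lie_bracket ?Y (?J ?\<xi>) p = 0" for p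
    using bracket_fund_invariant[OF w(1) X'V X'I] bracket_fund_invariant[OF w(1) JX'V JX'I]
      bracket_fund_invariant[OF y JX'V JX'I] bracket_fund_invariant[OF y J\<xi>V J\<xi>I] by simp_all
  have self: "lie_bracket Z Z p = 0" for Z :: "'m vfield" and p by (auto simp: lie_bracket_def)
  have br2: "lie_bracket (?J ?\<xi>) X' p = 0" for p
  proof -
    have "lie_bracket X' (?J ?\<xi>) p = 0"
      unfolding X'_def lie_bracket_lincomb[OF atlas_A YV J\<xi>V J\<xi>V] br1(4) self by simp
    then show ?thesis by (subst lie_bracket_antisym) simp
  qed
  \<comment> \<open>The other three brackets in the Nijenhuis tensor of \<xi> and X' vanish, so
    integrability of J leaves this one.\<close>
  have br3: "lie_bracket (?J ?\<xi>) (?J X') p = 0" for p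
    using nijenhuis_zero[OF \<xi>V X'V, of p] by (simp add: nijenhuis_def br1 br2 J_zero)
  have br4: "lie_bracket X' (?J X') p = 0" for p
  proof -
    have "lie_bracket X' (?J X') p = 1 *\<^sub>R lie_bracket ?Y (?J X') p + (- b) *\<^sub>R lie_bracket (?J ?\<xi>) (?J X') p"
      by (subst (1) X'_def) (rule lie_bracket_lincomb[OF atlas_A YV J\<xi>V JX'V])
    then show ?thesis by (simp add: br1 br3)
  qed
  have perp: "g p (?\<xi> p) (X' p) = 0" "g p (J p (?\<xi> p)) (X' p) = 0" for p
  proof -
    note t = VFT[OF \<xi>V, of p] VFT[OF XV, of p] VFT[OF YV, of p] VFT[OF J\<xi>V, of p]
    have "g p (?\<xi> p) (?Y p) = 0" "g p (J p (?\<xi> p)) (?Y p) = b * N"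
      unfolding Yeq g_right[OF t(2,1,1)] g_right[OF t(2,1,4)] c g_Jself[OF t(1)] by simp_all
    then show "g p (?\<xi> p) (X' p) = 0" "g p (J p (?\<xi> p)) (X' p) = 0"
      unfolding X'_def g_right[OF t(3,4,1)] g_right[OF t(3,4,4)] g_Jself[OF t(1)] gJJ[OF t(1,1)] c by simp_all
  qed
  \<comment> \<open>The fields \<xi>, X', JX' commute and \<omega> is constant on them, so d\<omega>
    vanishes there, while \<theta> \<and> \<omega> equals \<theta>(\<xi>) |X'|^2 by
    orthogonality.\<close>
  have X'0: "X' p = 0" for p
  proof (rule ccontr)
    assume nz: "X' p \<noteq> 0"
    note t = VFT[OF \<xi>V, of p] VFT[OF X'V, of p] VFT[OF JX'V, of p]
    have om0: "\<omega> p 0 u = 0" if "u \<in> T p" for u using g_zero[OF that] by (simp add: fundamental_form_def J_zero)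
    have const: "Z p (\<lambda>q. \<omega> q (Y1 q) (Y2 q)) = 0"
      if "Z \<in> VF" "Y1 \<in> VF" "invariant Y1" "Y2 \<in> VF" "invariant Y2" for Z Y1 Y2
    proof -
      have "(\<lambda>q. \<omega> q (Y1 q) (Y2 q)) = (\<lambda>q. \<omega> p1 (Y1 p1) (Y2 p1))"
        using invariant_omega_constant[OF that(2-5)] by blast
      then show ?thesis using tangent_const[OF VFT[OF that(1)]] by simp
    qed
    have "ext_d2 \<omega> ?\<xi> X' (?J X') p = 0"
      unfolding ext_d2_def const[OF \<xi>V X'V X'I JX'V JX'I] const[OF X'V \<xi>V \<xi>I JX'V JX'I] const[OF JX'V \<xi>V \<xi>I X'V X'I]
        br1 br4 om0[OF t(1)] om0[OF t(2)] om0[OF t(3)] by simp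
    then have "wedge_1_2 \<theta> \<omega> p (?\<xi> p) (X' p) (J p (X' p)) = 0"
      using d_omega[OF \<xi>V X'V JX'V, of p] by simp
    then have "\<theta> p (?\<xi> p) * g p (X' p) (X' p) = 0"
      unfolding wedge_1_2_def fundamental_form_def gJJ[OF t(2,2)] gJJ[OF t(1,2)] perp by simp
    then show False using w(3)[of p] g_pos[OF t(2) nz] by simp
  qed
  have YJ: "?Y p = b *\<^sub>R J p (?\<xi> p)" for p using X'0[of p] by (simp add: X'_def)
  \<comment> \<open>With b = 0, v would be a times w; then \<theta>(X) = 0 and \<theta>(\<xi>)
    nonzero would force a = 0 and v = 0.\<close>
  have b: "b \<noteq> 0"
  proof
    assume "b = 0"
    then have "?Y p = 0" for p using YJ by simp
    then have "y = 0" using fund_injective[OF faithful y] by blast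
    then have va: "v = a *\<^sub>R w" by (simp add: y_def)
    have "\<theta> p1 (?Y p1) = - a * \<theta> p1 (?\<xi> p1)"
      unfolding Yeq theta_lin[OF VFT[OF XV] VFT[OF \<xi>V]] \<theta>X by simp
    then have "a = 0" using \<open>?Y p1 = 0\<close> theta_zero w(3)[of p1] by simp
    then show False using va v(2) by simp
  qed
  \<comment> \<open>From X = a \<xi> + b J\<xi> follows JX = a J\<xi> - b \<xi>, and J\<xi> = Y / b
    is fundamental.\<close>
  define k where "k = (a / b) *\<^sub>R y + (- b) *\<^sub>R w"
  have k: "k \<in> \<gg>" unfolding k_def by (intro tangent_space_add tangent_space_scaleR y w)
  have "fund k p = J p (?X p)" for p
  proof -
    note t = VFT[OF \<xi>V, of p] VFT[OF J\<xi>V, of p]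
    have "?X p = a *\<^sub>R ?\<xi> p + b *\<^sub>R J p (?\<xi> p)" using fun_cong[OF Yeq, of p] YJ[of p] by (simp add: algebra_simps)
    then have "J p (?X p) = a *\<^sub>R J p (?\<xi> p) + b *\<^sub>R (- ?\<xi> p)" by (simp add: J_lin[OF t] JJ[OF t(1)])
    also have "\<dots> = (a / b) *\<^sub>R ?Y p + (- b) *\<^sub>R ?\<xi> p" using b by (simp add: YJ)
    also have "\<dots> = fund k p" unfolding k_def fund_lincomb ..
    finally show ?thesis by simp
  qed
  then show ?thesis by (rule parallel_if_J_fund[OF v(1) XI \<theta>X k _ Xnz])
qed

end

theorem theorem3p10:
  fixes A :: "('m::{t2_space, second_countable_topology}, 'e::euclidean_space) atlas"
    and g :: "'m \<Rightarrow> 'm tvec \<Rightarrow> 'm tvec \<Rightarrow> real"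
    and J :: "'m \<Rightarrow> 'm tvec \<Rightarrow> 'm tvec"
    and \<theta> :: "'m \<Rightarrow> 'm tvec \<Rightarrow> real"
    and nabla :: "'m vfield \<Rightarrow> 'm vfield \<Rightarrow> 'm vfield"
    and G :: "'g::{t2_space, second_countable_topology} monoid"
    and B :: "('g, 'd::euclidean_space) atlas"
    and \<Phi> :: "'g \<Rightarrow> 'm \<Rightarrow> 'm"
  assumes "smooth_atlas A" and "compact (UNIV :: 'm set)"
    and "lck A g J" and "\<not> kaehler A g J" and "lee_form A g J \<theta>"
    and "lie_group G B" and "compact (UNIV :: 'g set)" and "connected (UNIV :: 'g set)"
    and "smooth_action G B A \<Phi>"
    and "faithful_action G UNIV \<Phi>" and "transitive_action G UNIV \<Phi>"
    and "\<And>a. preserves_metric A g (\<Phi> a)"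
    and "\<And>a. preserves_complex_structure A J (\<Phi> a)"
    and "levi_civita A g nabla"
    and "dim (lie_algebra_center G B) \<ge> 2"
  shows "parallel_one_form A nabla \<theta>"
proof -
  have carrier: "carrier G = UNIV" using assms(6) by (simp add: lie_group_def)
  have trans: "\<exists>a. \<Phi> a p = q" for p q
    using transitive_action.unique_orbit[OF assms(11)] by blast
  interpret homogeneous_lck A G B \<Phi> g J \<theta> nabla
    using assms trans by unfold_locales (auto simp: lck_def)
  \<comment> \<open>Faithfulness is given as injectivity of \<Phi> on the carrier and is used as
    triviality of the kernel.\<close>
  have "a = \<one>\<^bsub>G\<^esub>" if "\<And>p. \<Phi> a p = p" for a
  proof -
    have "\<Phi> a = \<Phi> \<one>\<^bsub>G\<^esub>" using that by auto
    then show ?thesis using faithful_action.faithful[OF assms(10)] carrier by (auto dest: inj_onD)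
  qed
  then show ?thesis using assms(15) by (rule parallel_lee_form)
qed

end
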